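(* Let $G$ be a connected and simply connected Poisson-Lie group with Lie algebra $\mathfrak g$. The left-covariant preconnection $\gamma_\Xi$ on $G$ determined by a linear map $\Xi:\mathfrak g^*\otimes\mathfrak g^*\to\mathfrak g^*$ is bicovariant if and only if $$\mathrm{ad}^*_x\Xi(\phi,\psi)-\Xi(\mathrm{ad}^*_x\phi,\psi)-\Xi(\phi,\mathrm{ad}^*_x\psi)=\phi(x_{(1)})\,\mathrm{ad}^*_{x_{(2)}}(\psi)\qquad(\ast)$$ for all $x\in\mathfrak g$, $\phi,\psi\in\mathfrak g^*$, where $\delta(x)=x_{(1)}\otimes x_{(2)}$; that is, if and only if $(\mathrm{ad}^*,-\Xi)$ makes $\mathfrak g^*$ into a left almost $\mathfrak g$-crossed module. Moreover, condition $(\ast)$ is equivalent to $$\delta_{\mathfrak g^*}\Xi(\phi,\psi)-\Xi(\phi_{(1)},\psi)\otimes\phi_{(2)}-\Xi(\phi,\psi_{(1)})\otimes\psi_{(2)}=\psi_{(1)}\otimes[\phi,\psi_{(2)}]_{\mathfrak g^*}$$ for all $\phi,\psi\in\mathfrak g^*$.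
   Context: A Poisson-Lie group $G$ is a (finite-dimensional) Lie group with a Poisson bracket $\{\ ,\ \}$ on $C^\infty(G)$ such that multiplication $G\times G\to G$ is a Poisson map. Let $P$ be its Poisson bivector, $\{f,h\}=P(df,dh)$, and $D^\vee(g)=(L_{g^{-1}})_*P(g)\in\mathfrak g\otimes\mathfrak g$. The Lie algebra $\mathfrak g$ is a Lie bialgebra with cobracket $\delta(x)=\frac{d}{dt}\big|_{0}(R_{\exp(-tx)})_*P(\exp tx)=x_{(1)}\otimes x_{(2)}$ (summation understood). The dual $\mathfrak g^*$ is a Lie bialgebra with $\langle[\phi,\psi]_{\mathfrak g^*},x\rangle=\langle\phi\otimes\psi,\delta(x)\rangle$ and $\langle\delta_{\mathfrak g^*}\phi,x\otimes y\rangle=\langle\phi,[x,y]\rangle$, written $\delta_{\mathfrak g^*}\phi=\phi_{(1)}\otimes\phi_{(2)}$. The coadjoint action is $\mathrm{ad}^*_x\phi=\phi_{(1)}\langle\phi_{(2)},x\rangle$, i.e. $(\mathrm{ad}^*_x\phi)(y)=-\phi([x,y])$; $\mathrm{Ad}^*$ is the corresponding left coadjoint action of $G$. A preconnection on $G$ is a bilinear map $\gamma:C^\infty(G)\otimes\Omega^1(G)\to\Omega^1(G)$ with $\gamma(xy,\tau)=\gamma(x,\tau)y+x\gamma(y,\tau)$ and $\gamma(x,y\tau)=y\gamma(x,\tau)+\{x,y\}\tau$. Let $\{e_i\}$ be a basis of $\mathfrak g$, $\{f^i\}$ the dual basis, $\{\partial_i\}$ the left-invariant vector fields generated by $\{e_i\}$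 and $\{\omega^i\}$ the dual basis of left-invariant 1-forms. For a linear map $\Xi:\mathfrak g^*\otimes\mathfrak g^*\to\mathfrak g^*$ with $\Xi(f^i,f^j)=\sum_k\Xi^{ij}_kf^k$ put $$\gamma_\Xi\Big(a,\sum_k\tau_k\omega^k\Big)=\sum_k\Big(\{a,\tau_k\}+\sum_{i,j}\Xi^{ij}_k(\partial_ia)\tau_j\Big)\omega^k .$$ A preconnection is called left-covariant if the associated first-order differential calculus is left-covariant to lowest deformation order; this holds exactly when $\gamma=\gamma_\Xi$ for some (unique) $\Xi$, which is taken as the definition here. A left-covariant $\gamma_\Xi$ is called bicovariant if the calculus is also right-covariant to lowest order; this is equivalent to (and taken here to mean) $$\Xi(\phi,\psi)-\mathrm{Ad}^*_{g^{-1}}\Xi(\mathrm{Ad}^*_g\phi,\mathrm{Ad}^*_g\psi)=\phi(D^\vee(g)^{(1)})\,\mathrm{ad}^*_{D^\vee(g)^{(2)}}\psi,\quad\forall g\in G,\ \phi,\psi\in\mathfrak g^*,$$ where $D^\vee(g)=D^\vee(g)^{(1)}\otimes D^\vee(g)^{(2)}$. A left almost $\mathfrak g$-crossed module is a left $\mathfrak g$-module $(V,\triangleright)$ with a linear map $\triangleright':\mathfrak g^*\otimes V\to V$ (not necessarily an action) such that $$\phi_{(1)}\triangleright'v\,\langle\phi_{(2)},x\rangle+x_{(1)}\triangleright v\,\langle\phi,x_{(2)}\rangle=x\triangleright(\phi\triangleright'v)-\phi\triangleright'(x\triangleright v)$$ for all $x\in\mathfrak g,\phi\in\mathfrak g^*,v\in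 V$. "$(\mathrm{ad}^*,-\Xi)$" means $x\triangleright\psi=\mathrm{ad}^*_x\psi$ and $\phi\triangleright'\psi=-\Xi(\phi,\psi)$ on $V=\mathfrak g^*$. *)

theory Defs
  imports "HOL-Analysis.Analysis" "HOL-Algebra.Group"
begin

section \<open>Smooth manifolds\<close>

text \<open>On a finite-dimensional domain, iterated directional differentiability with continuous
  derivatives of order \<open>k\<close> is the usual class \<open>C\<^sup>k\<close>.\<close>

primrec Ck_on :: "nat \<Rightarrow> 'a::euclidean_space set \<Rightarrow> ('a \<Rightarrow> 'b::real_normed_vector) \<Rightarrow> bool" where
  "Ck_on 0 S f \<longleftrightarrow> continuous_on S f"
| "Ck_on (Suc k) S f \<longleftrightarrow> (\<forall>x\<in>S. f differentiable (at x)) \<and>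
     (\<forall>v. Ck_on k S (\<lambda>x. frechet_derivative f (at x) v))"

definition smooth_on :: "'a::euclidean_space set \<Rightarrow> ('a \<Rightarrow> 'b::real_normed_vector) \<Rightarrow> bool" where
  "smooth_on S f \<longleftrightarrow> open S \<and> (\<forall>k. Ck_on k S f)"

type_synonym ('m, 'e) chart = "'m set \<times> ('m \<Rightarrow> 'e)"

definition smooth_atlas :: "('m::topological_space, 'e::euclidean_space) chart set \<Rightarrow> bool" where
  "smooth_atlas A \<longleftrightarrow>
     (\<Union>(U, \<phi>)\<in>A. U) = UNIV \<and>
     (\<forall>(U, \<phi>)\<in>A. open U \<and> open (\<phi> ` U) \<and> homeomorphism U (\<phi> ` U) \<phi> (inv_into U \<phi>)) \<and>
     (\<forall>(U, \<phi>)\<in>A. \<forall>(V, \<psi>)\<in>A. smooth_on (\<phi> ` (U \<inter> V)) (\<psi> \<circ> inv_into U \<phi>))"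

definition model_atlas :: "('e::euclidean_space, 'e) chart set" where
  "model_atlas = {(UNIV, id)}"

definition prod_atlas :: "('m, 'e) chart set \<Rightarrow> ('n, 'f) chart set \<Rightarrow> ('m \<times> 'n, 'e \<times> 'f) chart set" where
  "prod_atlas A B = {(U \<times> V, map_prod \<phi> \<psi>) | U \<phi> V \<psi>. (U, \<phi>) \<in> A \<and> (V, \<psi>) \<in> B}"

definition smooth_map :: "('m::topological_space, 'e::euclidean_space) chart set \<Rightarrow>
    ('n::topological_space, 'f::euclidean_space) chart set \<Rightarrow> ('m \<Rightarrow> 'n) \<Rightarrow> bool" where
  "smooth_map A B F \<longleftrightarrow> continuous_on UNIV F \<and>
     (\<forall>(U, \<phi>)\<in>A. \<forall>(V, \<psi>)\<in>B. smooth_on (\<phi> ` (U \<inter> F -` V)) (\<psi> \<circ> F \<circ> inv_into U \<phi>))"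

definition C_inf :: "('m::topological_space, 'e::euclidean_space) chart set \<Rightarrow> ('m \<Rightarrow> real) set" where
  "C_inf A = {f. smooth_map A model_atlas f}"

text \<open>The tangent space at a point \<open>p\<close> is a copy of the model space \<open>'e\<close>: a tangent vector is
  represented by its coordinates in one chart around \<open>p\<close>, chosen once and for all. Vector fields
  are thus functions \<open>'m \<Rightarrow> 'e\<close>, and 1-forms are functions from \<open>'m\<close> to the dual of \<open>'e\<close>; both are
  sections of the (co)tangent bundle, and since the chosen chart varies with the point, their
  smoothness has to be tested in the charts of the atlas.\<close>

definition chart_at :: "('m, 'e) chart set \<Rightarrow> 'm \<Rightarrow> ('m, 'e) chart" where
  "chart_at A p = (SOME c. c \<in> A \<and> p \<in> fst c)"

text \<open>The differential of \<open>F\<close> at \<open>p\<close>. It covers differentials of functions (\<open>B = model_atlas\<close>) and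
  velocities of curves (\<open>A = model_atlas\<close>, applied to \<open>1\<close>), because the model atlas has the identity as
  its only chart.\<close>

definition tangent_map :: "('m, 'e::euclidean_space) chart set \<Rightarrow> ('n, 'f::euclidean_space) chart set \<Rightarrow>
    ('m \<Rightarrow> 'n) \<Rightarrow> 'm \<Rightarrow> 'e \<Rightarrow>\<^sub>L 'f" where
  "tangent_map A B F p =
     (let (U, \<phi>) = chart_at A p; (V, \<psi>) = chart_at B (F p)
      in Blinfun (frechet_derivative (\<psi> \<circ> F \<circ> inv_into U \<phi>) (at (\<phi> p))))"

abbreviation differential :: "('m, 'e::euclidean_space) chart set \<Rightarrow> ('m \<Rightarrow> real) \<Rightarrow> 'm \<Rightarrow> 'e \<Rightarrow>\<^sub>L real" where
  "differential A f p \<equiv> tangent_map A model_atlas f p"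

definition field_deriv :: "('m, 'e::euclidean_space) chart set \<Rightarrow> ('m \<Rightarrow> 'e) \<Rightarrow> ('m \<Rightarrow> real) \<Rightarrow> 'm \<Rightarrow> real" where
  "field_deriv A X f = (\<lambda>p. blinfun_apply (differential A f p) (X p))"

text \<open>Smooth 1-forms: in every chart the pairing with the coordinate vector fields is smooth.\<close>

definition one_forms :: "('m, 'e::euclidean_space) chart set \<Rightarrow> ('m \<Rightarrow> 'e \<Rightarrow>\<^sub>L real) set" where
  "one_forms A = {\<tau>. \<forall>(U, \<phi>)\<in>A. \<forall>v. smooth_on (\<phi> ` U)
     (\<lambda>q. blinfun_apply (\<tau> (inv_into U \<phi> q))
            (blinfun_apply (tangent_map model_atlas A (inv_into U \<phi>) q) v))}"

section \<open>Tensors\<close>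

text \<open>For a finite-dimensional \<open>V\<close>, the tensor squares of \<open>V\<close> and of its dual are represented by the
  bilinear forms on the dual and on \<open>V\<close>, respectively: \<open>t \<phi> \<psi>\<close> is the pairing of \<open>t\<close> with
  \<open>\<phi> \<otimes> \<psi>\<close>, and similarly for \<open>cotensor2\<close>.\<close>

type_synonym 'e dual = "'e \<Rightarrow>\<^sub>L real"
type_synonym 'e tensor2 = "'e dual \<Rightarrow>\<^sub>L 'e dual \<Rightarrow>\<^sub>L real"
type_synonym 'e cotensor2 = "'e \<Rightarrow>\<^sub>L 'e \<Rightarrow>\<^sub>L real"

text \<open>The basis dual to \<open>Basis\<close>.\<close>

abbreviation dual_basis :: "'e::euclidean_space \<Rightarrow> 'e dual" where
  "dual_basis i \<equiv> blinfun_inner_left i"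

text \<open>Sweedler notation: the value \<open>B t\<^sub>(\<^sub>1\<^sub>) t\<^sub>(\<^sub>2\<^sub>)\<close> of the linear extension of a bilinear map \<open>B\<close> to
  the tensor \<open>t = t\<^sub>(\<^sub>1\<^sub>) \<otimes> t\<^sub>(\<^sub>2\<^sub>)\<close>.\<close>

definition sweedler :: "'e::euclidean_space tensor2 \<Rightarrow> ('e \<Rightarrow> 'e \<Rightarrow> 'v::real_vector) \<Rightarrow> 'v" where
  "sweedler t B = (\<Sum>i\<in>Basis. \<Sum>j\<in>Basis. t (dual_basis i) (dual_basis j) *\<^sub>R B i j)"

definition co_sweedler :: "'e::euclidean_space cotensor2 \<Rightarrow> ('e dual \<Rightarrow> 'e dual \<Rightarrow> 'v::real_vector) \<Rightarrow> 'v" where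
  "co_sweedler t B = (\<Sum>i\<in>Basis. \<Sum>j\<in>Basis. t i j *\<^sub>R B (dual_basis i) (dual_basis j))"

definition cotensor :: "'e::euclidean_space dual \<Rightarrow> 'e dual \<Rightarrow> 'e cotensor2" where
  "cotensor \<phi> \<psi> = Blinfun (\<lambda>x. blinfun_apply \<phi> x *\<^sub>R \<psi>)"

text \<open>\<open>(L \<otimes> L) t\<close>\<close>

definition tensor_push :: "('e::euclidean_space \<Rightarrow>\<^sub>L 'e) \<Rightarrow> 'e tensor2 \<Rightarrow> 'e tensor2" where
  "tensor_push L t = Blinfun (\<lambda>\<phi>. Blinfun (\<lambda>\<psi>. t (\<phi> o\<^sub>L L) (\<psi> o\<^sub>L L)))"

section \<open>Lie groups\<close>

record ('g, 'e) lie_data = "'g monoid" +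
  atlas :: "('g, 'e) chart set"

definition lie_group ::
  "('g::{t2_space,second_countable_topology}, 'e::euclidean_space, 'z) lie_data_scheme \<Rightarrow> bool" where
  "lie_group G \<longleftrightarrow> group G \<and> carrier G = UNIV \<and> smooth_atlas (atlas G) \<and>
     smooth_map (prod_atlas (atlas G) (atlas G)) (atlas G) (\<lambda>(g, h). g \<otimes>\<^bsub>G\<^esub> h) \<and>
     smooth_map (atlas G) (atlas G) (\<lambda>g. inv\<^bsub>G\<^esub> g)"

text \<open>In the following, the Lie algebra is the tangent space at the unit, so its underlying vector
  space is \<open>'e\<close>.\<close>

definition left_field :: "('g, 'e::euclidean_space, 'z) lie_data_scheme \<Rightarrow> 'e \<Rightarrow> 'g \<Rightarrow> 'e" where
  "left_field G x = (\<lambda>g. tangent_map (atlas G) (atlas G) (\<lambda>h. g \<otimes>\<^bsub>G\<^esub> h) \<one>\<^bsub>G\<^esub> x)"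

text \<open>The left-invariant 1-forms; \<open>left_form G (dual_basis k)\<close> is the frame dual to the frame
  \<open>left_field G k\<close>, \<open>k \<in> Basis\<close>.\<close>

definition left_form :: "('g, 'e::euclidean_space, 'z) lie_data_scheme \<Rightarrow> 'e dual \<Rightarrow> 'g \<Rightarrow> 'e dual" where
  "left_form G \<phi> = (\<lambda>g. \<phi> o\<^sub>L tangent_map (atlas G) (atlas G) (\<lambda>h. inv\<^bsub>G\<^esub> g \<otimes>\<^bsub>G\<^esub> h) g)"

text \<open>The commutator of left-invariant vector fields.\<close>

definition lie_bracket ::
  "('g::topological_space, 'e::euclidean_space, 'z) lie_data_scheme \<Rightarrow> 'e \<Rightarrow> 'e \<Rightarrow> 'e" where
  "lie_bracket G x y = (THE z. \<forall>f\<in>C_inf (atlas G).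
     let X = field_deriv (atlas G) (left_field G x);
         Y = field_deriv (atlas G) (left_field G y);
         Z = field_deriv (atlas G) (left_field G z)
     in Z f = (\<lambda>g. X (Y f) g - Y (X f) g))"

definition one_parameter_subgroup ::
  "('g::topological_space, 'e::euclidean_space, 'z) lie_data_scheme \<Rightarrow> (real \<Rightarrow> 'g) \<Rightarrow> bool" where
  "one_parameter_subgroup G c \<longleftrightarrow> smooth_map model_atlas (atlas G) c \<and>
     (\<forall>s t. c (s + t) = c s \<otimes>\<^bsub>G\<^esub> c t)"

definition lie_exp ::
  "('g::topological_space, 'e::euclidean_space, 'z) lie_data_scheme \<Rightarrow> 'e \<Rightarrow> 'g" where
  "lie_exp G x = (THE c. one_parameter_subgroup G c \<and> tangent_map model_atlas (atlas G) c 0 1 = x) 1"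

definition Ad :: "('g, 'e::euclidean_space, 'z) lie_data_scheme \<Rightarrow> 'g \<Rightarrow> 'e \<Rightarrow>\<^sub>L 'e" where
  "Ad G g = tangent_map (atlas G) (atlas G) (\<lambda>h. g \<otimes>\<^bsub>G\<^esub> h \<otimes>\<^bsub>G\<^esub> inv\<^bsub>G\<^esub> g) \<one>\<^bsub>G\<^esub>"

definition coAd :: "('g, 'e::euclidean_space, 'z) lie_data_scheme \<Rightarrow> 'g \<Rightarrow> 'e dual \<Rightarrow> 'e dual" where
  "coAd G g \<phi> = \<phi> o\<^sub>L Ad G (inv\<^bsub>G\<^esub> g)"

definition coad ::
  "('g::topological_space, 'e::euclidean_space, 'z) lie_data_scheme \<Rightarrow> 'e \<Rightarrow> 'e dual \<Rightarrow> 'e dual" where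
  "coad G x \<phi> = Blinfun (\<lambda>y. - \<phi> (lie_bracket G x y))"

section \<open>Poisson-Lie groups\<close>

record ('g, 'e) poisson_data = "('g, 'e) lie_data" +
  pb :: "('g \<Rightarrow> real) \<Rightarrow> ('g \<Rightarrow> real) \<Rightarrow> 'g \<Rightarrow> real"

definition poisson_bracket :: "('m::topological_space, 'e::euclidean_space) chart set \<Rightarrow>
    (('m \<Rightarrow> real) \<Rightarrow> ('m \<Rightarrow> real) \<Rightarrow> 'm \<Rightarrow> real) \<Rightarrow> bool" where
  "poisson_bracket A b \<longleftrightarrow> (\<forall>f\<in>C_inf A. \<forall>g\<in>C_inf A. \<forall>h\<in>C_inf A. \<forall>r.
     b f g \<in> C_inf A \<and>
     b (\<lambda>p. r * f p + g p) h = (\<lambda>p. r * b f h p + b g h p) \<and>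
     b f g = (\<lambda>p. - b g f p) \<and>
     b (\<lambda>p. f p * g p) h = (\<lambda>p. f p * b g h p + b f h p * g p) \<and>
     (\<lambda>p. b f (b g h) p + b g (b h f) p + b h (b f g) p) = (\<lambda>p. 0))"

text \<open>The Poisson bracket of the product of two copies of a Poisson manifold.\<close>

definition prod_pb :: "(('m \<Rightarrow> real) \<Rightarrow> ('m \<Rightarrow> real) \<Rightarrow> 'm \<Rightarrow> real) \<Rightarrow>
    ('m \<times> 'm \<Rightarrow> real) \<Rightarrow> ('m \<times> 'm \<Rightarrow> real) \<Rightarrow> 'm \<times> 'm \<Rightarrow> real" where
  "prod_pb b F H = (\<lambda>(p, q). b (\<lambda>p'. F (p', q)) (\<lambda>p'. H (p', q)) p + b (\<lambda>q'. F (p, q')) (\<lambda>q'. H (p, q')) q)"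

definition poisson_lie_group ::
  "('g::{t2_space,second_countable_topology}, 'e::euclidean_space, 'z) poisson_data_scheme \<Rightarrow> bool" where
  "poisson_lie_group G \<longleftrightarrow> lie_group G \<and> poisson_bracket (atlas G) (pb G) \<and>
     (let m = (\<lambda>(g, h). g \<otimes>\<^bsub>G\<^esub> h) in
      \<forall>f\<in>C_inf (atlas G). \<forall>h\<in>C_inf (atlas G). prod_pb (pb G) (f \<circ> m) (h \<circ> m) = pb G f h \<circ> m)"

definition bivector ::
  "('g::topological_space, 'e::euclidean_space, 'z) poisson_data_scheme \<Rightarrow> 'g \<Rightarrow> 'e tensor2" where
  "bivector G g = (THE t :: 'e tensor2. \<forall>f\<in>C_inf (atlas G). \<forall>h\<in>C_inf (atlas G).
     pb G f h g = t (differential (atlas G) f g) (differential (atlas G) h g))"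

definition D_vee ::
  "('g::topological_space, 'e::euclidean_space, 'z) poisson_data_scheme \<Rightarrow> 'g \<Rightarrow> 'e tensor2" where
  "D_vee G g = tensor_push (tangent_map (atlas G) (atlas G) (\<lambda>h. inv\<^bsub>G\<^esub> g \<otimes>\<^bsub>G\<^esub> h) g) (bivector G g)"

definition cobracket ::
  "('g::topological_space, 'e::euclidean_space, 'z) poisson_data_scheme \<Rightarrow> 'e \<Rightarrow> 'e tensor2" where
  "cobracket G x = vector_derivative
     (\<lambda>t. tensor_push
        (tangent_map (atlas G) (atlas G) (\<lambda>h. h \<otimes>\<^bsub>G\<^esub> lie_exp G (- t *\<^sub>R x)) (lie_exp G (t *\<^sub>R x)))
        (bivector G (lie_exp G (t *\<^sub>R x))))
     (at 0)"

definition dual_bracket ::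
  "('g::topological_space, 'e::euclidean_space, 'z) poisson_data_scheme \<Rightarrow> 'e dual \<Rightarrow> 'e dual \<Rightarrow> 'e dual" where
  "dual_bracket G \<phi> \<psi> = Blinfun (\<lambda>x. cobracket G x \<phi> \<psi>)"

definition dual_cobracket ::
  "('g::topological_space, 'e::euclidean_space, 'z) lie_data_scheme \<Rightarrow> 'e dual \<Rightarrow> 'e cotensor2" where
  "dual_cobracket G \<phi> = Blinfun (\<lambda>x. Blinfun (\<lambda>y. \<phi> (lie_bracket G x y)))"

section \<open>Preconnections\<close>

text \<open>A preconnection is only meant to act on smooth functions and smooth forms; its values on other
  arguments are irrelevant.\<close>

type_synonym ('g, 'e) preconn = "('g \<Rightarrow> real) \<Rightarrow> ('g \<Rightarrow> 'e dual) \<Rightarrow> 'g \<Rightarrow> 'e dual"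

definition preconnection ::
  "('g::topological_space, 'e::euclidean_space, 'z) poisson_data_scheme \<Rightarrow> ('g, 'e) preconn \<Rightarrow> bool" where
  "preconnection G \<gamma> \<longleftrightarrow>
     (\<forall>a\<in>C_inf (atlas G). \<forall>b\<in>C_inf (atlas G). \<forall>\<tau>\<in>one_forms (atlas G). \<forall>\<sigma>\<in>one_forms (atlas G). \<forall>r.
        \<gamma> a \<tau> \<in> one_forms (atlas G) \<and>
        \<gamma> (\<lambda>g. r * a g + b g) \<tau> = (\<lambda>g. r *\<^sub>R \<gamma> a \<tau> g + \<gamma> b \<tau> g) \<and>
        \<gamma> a (\<lambda>g. r *\<^sub>R \<tau> g + \<sigma> g) = (\<lambda>g. r *\<^sub>R \<gamma> a \<tau> g + \<gamma> a \<sigma> g) \<and>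
        \<gamma> (\<lambda>g. a g * b g) \<tau> = (\<lambda>g. b g *\<^sub>R \<gamma> a \<tau> g + a g *\<^sub>R \<gamma> b \<tau> g) \<and>
        \<gamma> a (\<lambda>g. b g *\<^sub>R \<tau> g) = (\<lambda>g. b g *\<^sub>R \<gamma> a \<tau> g + pb G a b g *\<^sub>R \<tau> g))"

text \<open>The basis of the Lie algebra is \<open>Basis\<close>. The coefficient of a form \<open>\<tau>\<close> at the k-th left-invariant
  form is the function \<open>\<tau> (\<partial>\<^sub>k)\<close>, and the structure constants of \<open>\<Xi>\<close> are
  \<open>\<Xi> (dual_basis i) (dual_basis j) k\<close>.\<close>

definition preconn_of ::
  "('g::topological_space, 'e::euclidean_space, 'z) poisson_data_scheme \<Rightarrow>
     ('e dual \<Rightarrow> 'e dual \<Rightarrow> 'e dual) \<Rightarrow> ('g, 'e) preconn" where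
  "preconn_of G \<Xi> a \<tau> =
     (let c = (\<lambda>k g. \<tau> g (left_field G k g))
      in (\<lambda>g. \<Sum>k\<in>Basis.
           (pb G a (c k) g +
            (\<Sum>i\<in>Basis. \<Sum>j\<in>Basis. \<Xi> (dual_basis i) (dual_basis j) k *
               field_deriv (atlas G) (left_field G i) a g * c j g))
           *\<^sub>R left_form G (dual_basis k) g))"

definition left_covariant_via ::
  "('g::topological_space, 'e::euclidean_space, 'z) poisson_data_scheme \<Rightarrow>
     ('e dual \<Rightarrow> 'e dual \<Rightarrow> 'e dual) \<Rightarrow> ('g, 'e) preconn \<Rightarrow> bool" where
  "left_covariant_via G \<Xi> \<gamma> \<longleftrightarrow> preconnection G \<gamma> \<and> bilinear \<Xi> \<and>
     (\<forall>a\<in>C_inf (atlas G). \<forall>\<tau>\<in>one_forms (atlas G). \<gamma> a \<tau> = preconn_of G \<Xi> a \<tau>)"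

definition bicovariant ::
  "('g::topological_space, 'e::euclidean_space, 'z) poisson_data_scheme \<Rightarrow> ('g, 'e) preconn \<Rightarrow> bool" where
  "bicovariant G \<gamma> \<longleftrightarrow> (\<exists>\<Xi>. left_covariant_via G \<Xi> \<gamma> \<and>
     (\<forall>g \<phi> \<psi>. \<Xi> \<phi> \<psi> - coAd G (inv\<^bsub>G\<^esub> g) (\<Xi> (coAd G g \<phi>) (coAd G g \<psi>)) =
        sweedler (D_vee G g) (\<lambda>d1 d2. \<phi> d1 *\<^sub>R coad G d2 \<psi>)))"

section \<open>Almost crossed modules\<close>

definition lie_module ::
  "('g::topological_space, 'e::euclidean_space, 'z) lie_data_scheme \<Rightarrow> ('e \<Rightarrow> 'v::real_vector \<Rightarrow> 'v) \<Rightarrow> bool" where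
  "lie_module G act \<longleftrightarrow> bilinear act \<and>
     (\<forall>x y v. act (lie_bracket G x y) v = act x (act y v) - act y (act x v))"

definition left_almost_crossed_module ::
  "('g::topological_space, 'e::euclidean_space, 'z) poisson_data_scheme \<Rightarrow>
     ('e \<Rightarrow> 'v::real_vector \<Rightarrow> 'v) \<Rightarrow> ('e dual \<Rightarrow> 'v \<Rightarrow> 'v) \<Rightarrow> bool" where
  "left_almost_crossed_module G act act' \<longleftrightarrow> lie_module G act \<and> bilinear act' \<and>
     (\<forall>x \<phi> v.
        co_sweedler (dual_cobracket G \<phi>) (\<lambda>\<phi>1 \<phi>2. \<phi>2 x *\<^sub>R act' \<phi>1 v) +
        sweedler (cobracket G x) (\<lambda>x1 x2. \<phi> x2 *\<^sub>R act x1 v) =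
        act x (act' \<phi> v) - act' \<phi> (act x v))"

end

theory Submission
  imports Defs
begin

text \<open>The defect of bicovariance, the difference of the two sides of its defining equation at \<open>g\<close>,
  is a 1-cocycle on \<open>G\<close>: the terms in \<open>\<Xi>\<close> are a coboundary, and the term in the Poisson tensor is a
  cocycle because the multiplication is a Poisson map. The derivative of the defect at the unit is
  the defect of \<open>(\<ast>)\<close>, because \<open>Ad\<close> has derivative \<open>ad\<close> and the left-trivialised Poisson tensor,
  which vanishes at the unit, has derivative \<open>\<delta>\<close>. A cocycle with vanishing derivative at the unit is
  locally constant everywhere, hence zero on the connected group \<open>G\<close>; no integration along
  one-parameter subgroups is needed. The other two equivalences unfold \<open>(\<ast>)\<close> in coordinates, using
  that \<open>\<delta>\<close> is antisymmetric.

  The functions on \<open>G\<close> on which brackets and fields are defined are global, so bump functions and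
  Hadamard's lemma are needed to turn derivations into tangent vectors; the exponential map, through
  which \<open>\<delta>\<close> is defined, comes from the contraction principle applied to the flow of a
  left-invariant field.\<close>

section \<open>Smooth functions on Euclidean spaces\<close>

text \<open>Tangent vectors are coordinates in a chart chosen anew at every point, so an expression
  in the tangent space at \<open>g\<close> cannot be differentiated in \<open>g\<close> as it
  stands. This shapes most of the groundwork: such expressions are rewritten either as derivatives
  taken at the unit, where one chart serves all \<open>g\<close>, or through a single fixed chart
  around the point under study, and only then shown to be smooth.

  The defect is paired with a vector \<open>y\<close>, which makes it a real function;
  \<open>y\<close> is transported by \<open>Ad\<close> together with the covectors. Its Poisson term
  uses the left trivialisation, whereas \<delta> is defined by the right one. The two differ by
  \<open>Ad\<close>, and the derivative of \<open>Ad\<close> is multiplied by the Poisson tensor at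
  the unit, which is zero.

  Bicovariance asserts the existence of some \<Xi>, so the reduction to the defect of the given
  \<Xi> rests on the preconnection determining \<Xi>. This is seen by evaluating it at the unit on
  functions with prescribed differentials.\<close>

lemma Ck_on_cong:
  assumes "open S" "\<And>x. x \<in> S \<Longrightarrow> f x = g x"
  shows "Ck_on k S f = Ck_on k S g"
  using assms(2)
proof (induction k arbitrary: f g)
  case 0
  then show ?case by (simp cong: continuous_on_cong)
next
  case (Suc k)
  have fd: "frechet_derivative f (at x) = frechet_derivative g (at x)" if "x \<in> S" "f differentiable (at x)" for x
    using frechet_derivative_transform_within_open[OF that(2) assms(1) that(1)] Suc.prems by auto
  have df: "f differentiable (at x) \<longleftrightarrow> g differentiable (at x)" if "x \<in> S" for x
  proof -
    have "g differentiable (at x)" if "f differentiable (at x)" "\<And>y. y \<in> S \<Longrightarrow> f y = g y" for f g :: "'a \<Rightarrow> 'b"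
      using that(1) has_derivative_transform_within_open[of f _ x UNIV S g] that(2) assms(1) \<open>x \<in> S\<close>
      unfolding differentiable_def by blast
    from this[of f g] this[of g f] show ?thesis using Suc.prems by auto
  qed
  show ?case
  proof (cases "\<forall>x\<in>S. f differentiable (at x)")
    case True
    then have "Ck_on k S (\<lambda>x. frechet_derivative f (at x) v) = Ck_on k S (\<lambda>x. frechet_derivative g (at x) v)" for v
      by (intro Suc.IH) (simp add: fd)
    with True df show ?thesis by simp
  next
    case False
    with df show ?thesis by auto
  qed
qed

lemma Ck_on_subset: "Ck_on k S f \<Longrightarrow> T \<subseteq> S \<Longrightarrow> Ck_on k T f"
  by (induction k arbitrary: f) (auto intro: continuous_on_subset)

lemma Ck_on_SucD: "Ck_on (Suc k) S f \<Longrightarrow> Ck_on k S f"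
proof (induction k arbitrary: f)
  case 0
  then show ?case
    by (auto intro!: continuous_at_imp_continuous_on differentiable_imp_continuous_within)
next
  case (Suc k)
  have "Ck_on k S (\<lambda>x. frechet_derivative f (at x) v)" for v
    using Suc.prems by (intro Suc.IH) simp
  with Suc.prems show ?case by simp
qed

lemma Ck_on_local:
  assumes "\<And>x. x \<in> S \<Longrightarrow> \<exists>T. open T \<and> x \<in> T \<and> Ck_on k T f"
  shows "Ck_on k S f"
  using assms
proof (induction k arbitrary: f)
  case 0
  have "isCont f x" if "x \<in> S" for x
    using 0[OF that] by (auto simp: continuous_on_eq_continuous_at)
  then show ?case by (auto intro: continuous_at_imp_continuous_on)
next
  case (Suc k)
  have "f differentiable (at x)" if "x \<in> S" for x
    using Suc.prems[OF that] by auto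
  moreover have "Ck_on k S (\<lambda>x. frechet_derivative f (at x) v)" for v
  proof (rule Suc.IH)
    fix x assume "x \<in> S"
    from Suc.prems[OF this] show "\<exists>T. open T \<and> x \<in> T \<and> Ck_on k T (\<lambda>x. frechet_derivative f (at x) v)"
      by auto
  qed
  ultimately show ?case by simp
qed

lemma Ck_on_const: "Ck_on k S (\<lambda>x. c)"
proof (induction k arbitrary: c)
  case (Suc k)
  then show ?case by simp
qed simp

lemma Ck_on_bounded_linear: "bounded_linear f \<Longrightarrow> Ck_on k S f"
proof (cases k)
  case (Suc m)
  assume "bounded_linear f"
  then have "(f has_derivative f) (at x)" for x by (rule bounded_linear_imp_has_derivative)
  then have "frechet_derivative f (at x) = f" "f differentiable (at x)" for x
    by (metis frechet_derivative_at, meson differentiable_def)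
  then show ?thesis by (simp add: Suc Ck_on_const)
qed (auto intro: linear_continuous_on)

lemma Ck_on_linear_comp:
  assumes "open S" "bounded_linear L" "Ck_on k S f"
  shows "Ck_on k S (\<lambda>x. L (f x))"
  using assms(3)
proof (induction k arbitrary: f)
  case 0
  then show ?case using assms(2) by (auto intro: bounded_linear.continuous_on)
next
  case (Suc k)
  have d: "((\<lambda>x. L (f x)) has_derivative (\<lambda>v. L (frechet_derivative f (at x) v))) (at x)" if "x \<in> S" for x
    using Suc.prems that by (intro bounded_linear.has_derivative[OF assms(2)]) (simp add: frechet_derivative_works[symmetric])
  have e: "frechet_derivative (\<lambda>x. L (f x)) (at x) = (\<lambda>v. L (frechet_derivative f (at x) v))" if "x \<in> S" for x
    by (rule frechet_derivative_at[OF d[OF that], symmetric])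
  have "Ck_on k S (\<lambda>x. frechet_derivative (\<lambda>x. L (f x)) (at x) v)" for v
    using Suc Ck_on_cong[OF assms(1), of "\<lambda>x. frechet_derivative (\<lambda>x. L (f x)) (at x) v"
       "\<lambda>x. L (frechet_derivative f (at x) v)"] by (auto simp: e)
  then show ?case using d by (auto simp: differentiable_def)
qed

lemma Ck_on_add:
  assumes "open S" "Ck_on k S f" "Ck_on k S g"
  shows "Ck_on k S (\<lambda>x. f x + g x)"
  using assms(2,3)
proof (induction k arbitrary: f g)
  case 0
  then show ?case by (auto intro: continuous_intros)
next
  case (Suc k)
  have d: "((\<lambda>x. f x + g x) has_derivative
      (\<lambda>v. frechet_derivative f (at x) v + frechet_derivative g (at x) v)) (at x)" if "x \<in> S" for x
    using Suc.prems that by (intro has_derivative_add) (simp_all add: frechet_derivative_works[symmetric])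
  have e: "frechet_derivative (\<lambda>x. f x + g x) (at x) =
      (\<lambda>v. frechet_derivative f (at x) v + frechet_derivative g (at x) v)" if "x \<in> S" for x
    by (rule frechet_derivative_at[OF d[OF that], symmetric])
  have "Ck_on k S (\<lambda>x. frechet_derivative (\<lambda>x. f x + g x) (at x) v)" for v
    using Suc Ck_on_cong[OF assms(1), of "\<lambda>x. frechet_derivative (\<lambda>x. f x + g x) (at x) v"
       "\<lambda>x. frechet_derivative f (at x) v + frechet_derivative g (at x) v"] by (auto simp: e)
  then show ?case using d by (auto simp: differentiable_def)
qed

lemma Ck_on_sum:
  assumes "open S" "\<And>i. i \<in> I \<Longrightarrow> Ck_on k S (f i)"
  shows "Ck_on k S (\<lambda>x. \<Sum>i\<in>I. f i x)"
  using assms(2)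
  by (induction I rule: infinite_finite_induct) (auto simp: Ck_on_const Ck_on_add[OF assms(1)])

lemma Ck_on_bilinear:
  assumes "open S" "bounded_bilinear B" "Ck_on k S f" "Ck_on k S g"
  shows "Ck_on k S (\<lambda>x. B (f x) (g x))"
  using assms(3,4)
proof (induction k arbitrary: f g)
  case 0
  then show ?case using assms(2) by (auto intro: bounded_bilinear.continuous_on)
next
  case (Suc k)
  have d: "((\<lambda>x. B (f x) (g x)) has_derivative
      (\<lambda>v. B (f x) (frechet_derivative g (at x) v) + B (frechet_derivative f (at x) v) (g x))) (at x)" if "x \<in> S" for x
    using Suc.prems that
    by (intro bounded_bilinear.FDERIV[OF assms(2)]) (simp_all add: frechet_derivative_works[symmetric])
  have e: "frechet_derivative (\<lambda>x. B (f x) (g x)) (at x) =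
      (\<lambda>v. B (f x) (frechet_derivative g (at x) v) + B (frechet_derivative f (at x) v) (g x))" if "x \<in> S" for x
    by (rule frechet_derivative_at[OF d[OF that], symmetric])
  have "Ck_on k S (\<lambda>x. B (f x) (frechet_derivative g (at x) v) + B (frechet_derivative f (at x) v) (g x))" for v
    using Suc.prems by (intro Ck_on_add[OF assms(1)] Suc.IH) (auto intro: Ck_on_SucD)
  then have "Ck_on k S (\<lambda>x. frechet_derivative (\<lambda>x. B (f x) (g x)) (at x) v)" for v
    using Ck_on_cong[OF assms(1), of "\<lambda>x. frechet_derivative (\<lambda>x. B (f x) (g x)) (at x) v"
       "\<lambda>x. B (f x) (frechet_derivative g (at x) v) + B (frechet_derivative f (at x) v) (g x)"] by (auto simp: e)
  then show ?case using d by (auto simp: differentiable_def)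
qed

text \<open>\<open>Ck_on\<close> speaks of derivatives in fixed directions only. This expansion
  reduces a linear map applied to a moving vector to finitely many fixed directions, and is used for
  that purpose throughout.\<close>

lemma linear_Basis_sum:
  assumes "linear (L :: 'a::euclidean_space \<Rightarrow> 'b::real_vector)"
  shows "L v = (\<Sum>i\<in>Basis. (v \<bullet> i) *\<^sub>R L i)"
  using assms by (subst euclidean_representation[of v, symmetric], subst linear_sum) (auto simp: linear_scale)

text \<open>The chain rule produces the derivative of \<open>g\<close> in a moving direction.
  Expanded in the basis, each summand is a coordinate of the derivative of \<open>f\<close> times a
  partial derivative of \<open>g\<close> composed with the same \<open>f\<close>; hence only
  \<open>g\<close> varies in the induction.\<close>

lemma Ck_on_compose:
  fixes f :: "'a::euclidean_space \<Rightarrow> 'b::euclidean_space" and g :: "'b \<Rightarrow> 'c::real_normed_vector"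
  assumes "open S" "open T" "f ` S \<subseteq> T" "Ck_on k S f" "Ck_on k T g"
  shows "Ck_on k S (\<lambda>x. g (f x))"
  using assms(4,5)
proof (induction k arbitrary: g)
  case 0
  then show ?case using assms(3) by (auto intro: continuous_on_compose2)
next
  case (Suc k)
  have d: "((\<lambda>x. g (f x)) has_derivative
      (\<lambda>v. frechet_derivative g (at (f x)) (frechet_derivative f (at x) v))) (at x)" if "x \<in> S" for x
    using Suc.prems that assms(3)
    by (intro has_derivative_compose[of f "frechet_derivative f (at x)" x UNIV g])
       (auto simp: frechet_derivative_works[symmetric] image_subset_iff)
  have e: "frechet_derivative (\<lambda>x. g (f x)) (at x) v =
      (\<Sum>i\<in>Basis. (frechet_derivative f (at x) v \<bullet> i) *\<^sub>R frechet_derivative g (at (f x)) i)" if "x \<in> S" for x v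
  proof -
    have "g differentiable (at (f x))" using that assms(3) Suc.prems(2) by auto
    then show ?thesis
      by (subst frechet_derivative_at[OF d[OF that], symmetric]) (rule linear_Basis_sum[OF linear_frechet_derivative])
  qed
  have f1: "Ck_on k S f" using Suc.prems(1) by (rule Ck_on_SucD)
  have "Ck_on k S (\<lambda>x. (\<Sum>i\<in>Basis. (frechet_derivative f (at x) v \<bullet> i) *\<^sub>R frechet_derivative g (at (f x)) i))" for v
    using Suc.prems f1
    by (intro Ck_on_sum Ck_on_bilinear[OF _ bounded_bilinear_scaleR] assms(1) Suc.IH
        Ck_on_linear_comp[OF _ bounded_linear_inner_left]) auto
  then have "Ck_on k S (\<lambda>x. frechet_derivative (\<lambda>x. g (f x)) (at x) v)" for v
    using Ck_on_cong[OF assms(1), of "\<lambda>x. frechet_derivative (\<lambda>x. g (f x)) (at x) v"] e by auto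
  then show ?case using d by (auto simp: differentiable_def)
qed

section \<open>Smoothness at a point\<close>

text \<open>Asks for an open neighbourhood, not just the point. Thus the property persists nearby,
  is inherited by derivatives, and domains turn into eventuality statements.\<close>

definition smooth_pt :: "('a::euclidean_space \<Rightarrow> 'b::real_normed_vector) \<Rightarrow> 'a \<Rightarrow> bool" where
  "smooth_pt f x \<longleftrightarrow> (\<exists>T. x \<in> T \<and> smooth_on T f)"

lemma smooth_on_iff: "smooth_on S f \<longleftrightarrow> open S \<and> (\<forall>x\<in>S. smooth_pt f x)"
proof
  assume "open S \<and> (\<forall>x\<in>S. smooth_pt f x)"
  then show "smooth_on S f"
    unfolding smooth_on_def smooth_pt_def by (auto intro!: Ck_on_local)
qed (auto simp: smooth_on_def smooth_pt_def)

lemma smooth_pt_eventually: "smooth_pt f x \<Longrightarrow> \<forall>\<^sub>F y in nhds x. smooth_pt f y"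
  unfolding smooth_pt_def eventually_nhds smooth_on_def by blast

lemma smooth_pt_differentiable: "smooth_pt f x \<Longrightarrow> f differentiable (at x)"
  unfolding smooth_pt_def smooth_on_def
  by (meson Ck_on.simps(2))

lemma smooth_pt_has_derivative: "smooth_pt f x \<Longrightarrow> (f has_derivative frechet_derivative f (at x)) (at x)"
  using smooth_pt_differentiable frechet_derivative_works by blast

lemma smooth_pt_isCont: "smooth_pt f x \<Longrightarrow> isCont f x"
  using smooth_pt_differentiable differentiable_imp_continuous_within by blast

lemma smooth_pt_cong:
  assumes "\<forall>\<^sub>F y in nhds x. f y = g y" "smooth_pt f x"
  shows "smooth_pt g x"
proof -
  obtain T where T: "x \<in> T" "smooth_on T f" using assms by (auto simp: smooth_pt_def)
  obtain S where S: "open S" "x \<in> S" "\<forall>y\<in>S. f y = g y" using assms by (auto simp: eventually_nhds)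
  have "Ck_on k (S \<inter> T) g" for k
    using Ck_on_cong[of "S \<inter> T" f g k] Ck_on_subset[of k T f "S \<inter> T"] S T by (auto simp: smooth_on_def)
  then show ?thesis using S T by (auto simp: smooth_pt_def smooth_on_def intro!: exI[of _ "S \<inter> T"])
qed

lemma smooth_pt_derivative:
  assumes "smooth_pt f x"
  shows "smooth_pt (\<lambda>y. frechet_derivative f (at y) v) x"
proof -
  obtain T where T: "x \<in> T" "open T" "\<And>k. Ck_on k T f"
    using assms by (auto simp: smooth_pt_def smooth_on_def)
  have "Ck_on k T (\<lambda>y. frechet_derivative f (at y) v)" for k
    using T(3)[of "Suc k"] by simp
  with T show ?thesis by (auto simp: smooth_pt_def smooth_on_def)
qed

lemma smooth_pt_const [simp]: "smooth_pt (\<lambda>x. c) x"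
  unfolding smooth_pt_def smooth_on_def by (auto intro!: exI[of _ UNIV] Ck_on_const)

lemma smooth_pt_bounded_linear: "bounded_linear f \<Longrightarrow> smooth_pt f x"
  unfolding smooth_pt_def smooth_on_def by (auto intro!: exI[of _ UNIV] Ck_on_bounded_linear)

lemma smooth_pt_ident [simp]: "smooth_pt (\<lambda>x. x) x"
  by (rule smooth_pt_bounded_linear) (rule bounded_linear_ident)

lemma smooth_pt_bilinear:
  assumes "bounded_bilinear B" "smooth_pt f x" "smooth_pt g x"
  shows "smooth_pt (\<lambda>x. B (f x) (g x)) x"
proof -
  obtain S T where "x \<in> S" "smooth_on S f" "x \<in> T" "smooth_on T g"
    using assms by (auto simp: smooth_pt_def)
  then have "open (S \<inter> T)" "x \<in> S \<inter> T" and c: "Ck_on k (S \<inter> T) f" "Ck_on k (S \<inter> T) g" for k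
    by (auto simp: smooth_on_def intro: Ck_on_subset[OF _ Int_lower1] Ck_on_subset[OF _ Int_lower2])
  then show ?thesis
    unfolding smooth_pt_def smooth_on_def using Ck_on_bilinear[OF _ assms(1) c] by blast
qed

lemma smooth_pt_add:
  assumes "smooth_pt f x" "smooth_pt g x"
  shows "smooth_pt (\<lambda>x. f x + g x) x"
proof -
  obtain S T where "x \<in> S" "smooth_on S f" "x \<in> T" "smooth_on T g"
    using assms by (auto simp: smooth_pt_def)
  then have "open (S \<inter> T)" "x \<in> S \<inter> T" and c: "Ck_on k (S \<inter> T) f" "Ck_on k (S \<inter> T) g" for k
    by (auto simp: smooth_on_def intro: Ck_on_subset[OF _ Int_lower1] Ck_on_subset[OF _ Int_lower2])
  then show ?thesis
    unfolding smooth_pt_def smooth_on_def using Ck_on_add[OF _ c] by blast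
qed

lemma smooth_pt_linear_comp: "bounded_linear L \<Longrightarrow> smooth_pt f x \<Longrightarrow> smooth_pt (\<lambda>x. L (f x)) x"
  unfolding smooth_pt_def smooth_on_def using Ck_on_linear_comp by blast

lemmas smooth_pt_mult = smooth_pt_bilinear[OF bounded_bilinear_mult]
  and smooth_pt_scaleR = smooth_pt_bilinear[OF bounded_bilinear_scaleR]
  and smooth_pt_inner = smooth_pt_bilinear[OF bounded_bilinear_inner]

lemma smooth_pt_minus: "smooth_pt f x \<Longrightarrow> smooth_pt (\<lambda>x. - f x) x"
  using smooth_pt_linear_comp[OF bounded_linear_minus[OF bounded_linear_ident]] .

lemma smooth_pt_diff: "smooth_pt f x \<Longrightarrow> smooth_pt g x \<Longrightarrow> smooth_pt (\<lambda>x. f x - g x) x"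
  using smooth_pt_add[OF _ smooth_pt_minus, of f x g] by simp

lemma smooth_pt_compose:
  fixes f :: "'a::euclidean_space \<Rightarrow> 'b::euclidean_space" and g :: "'b \<Rightarrow> 'c::real_normed_vector"
  assumes "smooth_pt g (f x)" "smooth_pt f x"
  shows "smooth_pt (\<lambda>x. g (f x)) x"
proof -
  obtain S T where S: "x \<in> S" "open S" "\<And>k. Ck_on k S f" and T: "f x \<in> T" "open T" "\<And>k. Ck_on k T g"
    using assms unfolding smooth_pt_def smooth_on_def by blast
  have "continuous_on S f" using S(3)[of 0] by simp
  then have op: "open (S \<inter> f -` T)"
    using S T by (intro continuous_open_preimage)
  have "Ck_on k (S \<inter> f -` T) (\<lambda>x. g (f x))" for k
    by (rule Ck_on_compose[OF op T(2) _ Ck_on_subset[OF S(3) Int_lower1] T(3)]) blast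
  with op S T show ?thesis
    unfolding smooth_pt_def smooth_on_def by (intro exI[of _ "S \<inter> f -` T"]) simp
qed

lemma smooth_pt_Pair:
  assumes "smooth_pt f x" "smooth_pt g x"
  shows "smooth_pt (\<lambda>x. (f x, g x)) x"
proof -
  have "smooth_pt (\<lambda>x. (f x, 0) + (0, g x)) x"
    using assms by (intro smooth_pt_add smooth_pt_linear_comp[of "\<lambda>a. (a, 0)"] smooth_pt_linear_comp[of "\<lambda>a. (0, a)"])
      (auto intro: bounded_linear_Pair bounded_linear_ident bounded_linear_zero)
  then show ?thesis by simp
qed

lemma smooth_pt_fst [simp]: "smooth_pt fst x" and smooth_pt_snd [simp]: "smooth_pt snd x"
  by (auto intro!: smooth_pt_bounded_linear bounded_linear_fst bounded_linear_snd)

text \<open>Exhibits a partial derivative as the full derivative in a direction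
  \<open>(0, v)\<close>. The latter is smooth in both variables, which is how derivatives depending
  on a parameter are shown to be smooth.\<close>

lemma smooth_pt_partial_snd:
  fixes f :: "'a::euclidean_space \<times> 'b::euclidean_space \<Rightarrow> 'c::real_normed_vector"
  assumes "smooth_pt f (a, b)"
  shows "((\<lambda>y. f (a, y)) has_derivative (\<lambda>v. frechet_derivative f (at (a, b)) (0, v))) (at b)"
    and "frechet_derivative (\<lambda>y. f (a, y)) (at b) v = frechet_derivative f (at (a, b)) (0, v)"
proof -
  show 1: "((\<lambda>y. f (a, y)) has_derivative (\<lambda>v. frechet_derivative f (at (a, b)) (0, v))) (at b)"
    using smooth_pt_has_derivative[OF assms]
    by (auto intro!: has_derivative_compose[of "\<lambda>y. (a, y)" _ b UNIV f] derivative_eq_intros)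
  then show "frechet_derivative (\<lambda>y. f (a, y)) (at b) v = frechet_derivative f (at (a, b)) (0, v)"
    using frechet_derivative_at[OF 1] by metis
qed

lemma smooth_pt_partial_fst:
  fixes f :: "'a::euclidean_space \<times> 'b::euclidean_space \<Rightarrow> 'c::real_normed_vector"
  assumes "smooth_pt f (a, b)"
  shows "((\<lambda>x. f (x, b)) has_derivative (\<lambda>v. frechet_derivative f (at (a, b)) (v, 0))) (at a)"
    and "frechet_derivative (\<lambda>x. f (x, b)) (at a) v = frechet_derivative f (at (a, b)) (v, 0)"
proof -
  show 1: "((\<lambda>x. f (x, b)) has_derivative (\<lambda>v. frechet_derivative f (at (a, b)) (v, 0))) (at a)"
    using smooth_pt_has_derivative[OF assms]
    by (auto intro!: has_derivative_compose[of "\<lambda>x. (x, b)" _ a UNIV f] derivative_eq_intros)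
  then show "frechet_derivative (\<lambda>x. f (x, b)) (at a) v = frechet_derivative f (at (a, b)) (v, 0)"
    using frechet_derivative_at[OF 1] by metis
qed

lemma Ck_on_continuous: "Ck_on k S f \<Longrightarrow> continuous_on S f"
proof (induction k)
  case (Suc k)
  from Suc.IH[OF Ck_on_SucD[OF Suc.prems]] show ?case .
qed simp

section \<open>Bump functions on Euclidean spaces\<close>

text \<open>For \<open>n = 0\<close> this is the classical smooth function that is flat at the
  origin. The extra power makes the family closed under differentiation up to linear combinations,
  as the induction on the order requires.\<close>

definition flat :: "nat \<Rightarrow> real \<Rightarrow> real" where
  "flat n x = (if x \<le> 0 then 0 else inverse x ^ n * exp (- inverse x))"

lemma flat_has_derivative:
  "(flat n has_real_derivative (flat (n + 2) x - real n * flat (n + 1) x)) (at x)"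
proof -
  consider "x < 0" | "x = 0" | "x > 0" by linarith
  then show ?thesis
  proof cases
    case 1
    have "((\<lambda>x. 0) has_real_derivative 0) (at x)" by simp
    then have "(flat n has_real_derivative 0) (at x)"
      by (rule has_field_derivative_transform_within_open[of _ _ _ "{..<0}"]) (use 1 in \<open>auto simp: flat_def\<close>)
    with 1 show ?thesis by (simp add: flat_def)
  next
    case 2
    \<comment> \<open>For \<open>h > 0\<close> the quotient \<open>flat n h / h\<close> is this
      expression at \<open>y = inverse h\<close>, so the exponential beats the extra power.\<close>
    have "((\<lambda>y. y ^ (n + 1) / exp y) \<longlongrightarrow> (0::real)) at_top" by (rule tendsto_power_div_exp_0)
    then have "((\<lambda>h. inverse h ^ (n + 1) / exp (inverse h)) \<longlongrightarrow> (0::real)) (at_right 0)"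
      by (rule filterlim_compose[OF _ filterlim_inverse_at_top_right])
    then have r: "((\<lambda>h. flat n h / h) \<longlongrightarrow> 0) (at_right 0)"
      by (rule Lim_transform_eventually)
         (auto simp: eventually_at_filter flat_def exp_minus field_simps)
    have l: "((\<lambda>h. flat n h / h) \<longlongrightarrow> 0) (at_left 0)"
      by (rule Lim_transform_eventually[of "\<lambda>_. 0"])
         (auto simp: eventually_at_filter flat_def)
    from filterlim_split_at[OF l r] 2 show ?thesis
      by (simp add: DERIV_def flat_def)
  next
    case 3
    have "((\<lambda>x. inverse x ^ n * exp (- inverse x)) has_real_derivative (flat (n + 2) x - real n * flat (n + 1) x)) (at x)"
    proof -
      have "((\<lambda>x. inverse x ^ n * exp (- inverse x)) has_real_derivative
          (real n * (- (inverse x * inverse x) * inverse x ^ (n - 1))) * exp (- inverse x) +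
          (exp (- inverse x) * (inverse x * inverse x)) * inverse x ^ n) (at x)"
        using 3 by (auto intro!: derivative_eq_intros)
      \<comment> \<open>For \<open>n = 0\<close> the truncated exponent \<open>n - 1\<close> is
        harmless, since it comes with the factor \<open>real n\<close>.\<close>
      moreover have "(real n * (- (inverse x * inverse x) * inverse x ^ (n - 1))) * exp (- inverse x) +
          (exp (- inverse x) * (inverse x * inverse x)) * inverse x ^ n = flat (n + 2) x - real n * flat (n + 1) x"
        using 3 by (cases n) (simp_all add: flat_def algebra_simps)
      ultimately show ?thesis by (rule DERIV_cong)
    qed
    then show ?thesis
      by (rule has_field_derivative_transform_within_open[of _ _ _ "{0<..}"]) (use 3 in \<open>auto simp: flat_def\<close>)
  qed
qed

lemma Ck_on_flat: "Ck_on k UNIV (flat n)"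
proof (induction k arbitrary: n)
  case 0
  have "isCont (flat n) x" for x using flat_has_derivative DERIV_isCont by blast
  then show ?case by (auto intro: continuous_at_imp_continuous_on)
next
  case (Suc k)
  have d: "(flat n has_derivative (\<lambda>v. (flat (n + 2) x - real n * flat (n + 1) x) * v)) (at x)" for x
    using flat_has_derivative unfolding has_field_derivative_def by simp
  have e: "frechet_derivative (flat n) (at x) v = v * flat (n + 2) x + (v * - real n) * flat (n + 1) x" for x v
    by (subst frechet_derivative_at[OF d, symmetric]) (simp add: algebra_simps)
  have "Ck_on k UNIV (\<lambda>x. frechet_derivative (flat n) (at x) v)" for v
    unfolding e using Suc.IH
    by (intro Ck_on_add Ck_on_linear_comp[of UNIV "\<lambda>z. v * z"] Ck_on_linear_comp[of UNIV "\<lambda>z. (v * - real n) * z"]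
        open_UNIV bounded_linear_mult_right)
  moreover have "flat n differentiable (at x)" for x using d unfolding differentiable_def by blast
  ultimately show ?case by simp
qed

lemma smooth_pt_flat: "smooth_pt (flat n) x"
  unfolding smooth_pt_def smooth_on_def using Ck_on_flat by blast

text \<open>The inner \<open>flat 0\<close> saturates at \<open>a\<close>, so that the bump is constant near the centre.\<close>

lemma euclidean_bump:
  fixes c :: "'a::euclidean_space"
  assumes "r > 0"
  obtains b :: "'a \<Rightarrow> real" where "\<And>x. smooth_pt b x" "\<And>x. dist c x < r / 2 \<Longrightarrow> b x = 1" "\<And>x. dist c x \<ge> r \<Longrightarrow> b x = 0"
proof -
  define s where "s = flat 0"
  \<comment> \<open>On the ball of half the radius the inner argument exceeds three quarters of the
    squared radius, so the level taken at one half of it is reached there.\<close>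
  define a where "a = s (r\<^sup>2 / 2)"
  define b where "b = (\<lambda>x. inverse (s a) * (s a - s (a - s (r\<^sup>2 - (x - c) \<bullet> (x - c)))))"
  have pos: "s t > 0" if "t > 0" for t using that by (simp add: s_def flat_def)
  have mono: "s t \<le> s u" if "t \<le> u" for t u using that by (auto simp: s_def flat_def le_imp_inverse_le)
  have a: "s a > 0" using pos assms by (simp add: a_def)
  have "smooth_pt b x" for x
    unfolding b_def s_def
    by (intro smooth_pt_mult smooth_pt_diff smooth_pt_const smooth_pt_compose[OF smooth_pt_flat] smooth_pt_inner smooth_pt_ident)
  moreover have "b x = 1" if "dist c x < r / 2" for x
  proof -
    have "(dist c x)\<^sup>2 \<le> (r / 2)\<^sup>2" using that by (intro power_mono) auto
    then have "(x - c) \<bullet> (x - c) \<le> r\<^sup>2 / 4"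
      by (simp add: power2_norm_eq_inner[symmetric] dist_norm norm_minus_commute power2_eq_square)
    then have "a \<le> s (r\<^sup>2 - (x - c) \<bullet> (x - c))"
      unfolding a_def using zero_le_power2[of r] by (intro mono) linarith
    then have "s (a - s (r\<^sup>2 - (x - c) \<bullet> (x - c))) = 0" by (simp add: s_def flat_def)
    with a show ?thesis by (simp add: b_def)
  qed
  moreover have "b x = 0" if "dist c x \<ge> r" for x
  proof -
    have "r\<^sup>2 \<le> (dist c x)\<^sup>2" using that assms by (intro power_mono) auto
    then have "r\<^sup>2 - (x - c) \<bullet> (x - c) \<le> 0"
      by (simp add: power2_norm_eq_inner[symmetric] dist_norm norm_minus_commute)
    then have "s (r\<^sup>2 - (x - c) \<bullet> (x - c)) = 0" by (simp add: s_def flat_def)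
    with a show ?thesis by (simp add: b_def)
  qed
  ultimately show ?thesis using that by blast
qed

section \<open>Hadamard's lemma\<close>

lemma line_derivative:
  fixes f :: "'a::euclidean_space \<Rightarrow> real"
  assumes "smooth_pt f (y + s *\<^sub>R w)"
  shows "((\<lambda>s. f (y + s *\<^sub>R w)) has_real_derivative frechet_derivative f (at (y + s *\<^sub>R w)) w) (at s)"
proof -
  have l: "linear (frechet_derivative f (at (y + s *\<^sub>R w)))"
    using assms by (intro linear_frechet_derivative smooth_pt_differentiable)
  have "((\<lambda>s. f (y + s *\<^sub>R w)) has_derivative (\<lambda>t. frechet_derivative f (at (y + s *\<^sub>R w)) (t *\<^sub>R w))) (at s)"
    by (rule has_derivative_compose[of "\<lambda>s. y + s *\<^sub>R w" _ s UNIV f])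
       (auto intro!: derivative_eq_intros smooth_pt_has_derivative assms)
  moreover have "(\<lambda>t. frechet_derivative f (at (y + s *\<^sub>R w)) (t *\<^sub>R w)) = (*) (frechet_derivative f (at (y + s *\<^sub>R w)) w)"
    by (simp add: linear_scale[OF l] mult.commute fun_eq_iff)
  ultimately show ?thesis by (simp add: has_field_derivative_def)
qed

text \<open>The power \<open>t ^ n\<close> makes the induction close: differentiating in
  \<open>x\<close> under the integral multiplies the integrand by \<open>t\<close>. The ball is
  centred at \<open>c\<close> because the segments from \<open>c\<close> must stay inside.\<close>

lemma Ck_on_integral_scaled:
  fixes h :: "'a::euclidean_space \<Rightarrow> real"
  assumes "Ck_on k (ball c r) h"
  shows "Ck_on k (ball c r) (\<lambda>x. integral {0..1} (\<lambda>t. t ^ n * h (c + t *\<^sub>R (x - c))))"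
  using assms
proof (induction k arbitrary: h n)
  have in_ball: "c + t *\<^sub>R (x - c) \<in> ball c r" if "x \<in> ball c r" "t \<in> {0..1}" for x t
  proof -
    have "\<bar>t\<bar> * norm (x - c) \<le> 1 * norm (x - c)" using that by (intro mult_right_mono) auto
    then show ?thesis using that by (simp add: dist_norm norm_minus_commute)
  qed
  have cont: "continuous_on (ball c r \<times> cbox 0 1) (\<lambda>(x, t). t ^ n * h (c + t *\<^sub>R (x - c)))"
    if "continuous_on (ball c r) h" for h :: "'a \<Rightarrow> real" and n
    unfolding split_beta
    by (intro continuous_intros continuous_on_compose2[OF that]) (use in_ball in auto)
  {
    case 0
    then have "continuous_on (ball c r) h" by simp
    from integral_continuous_on_param[OF cont[OF this, of n]] show ?case by simp
  next
    case (Suc k)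
    have hc: "continuous_on (ball c r) h" using Suc.prems by (rule Ck_on_continuous)
    \<comment> \<open>The derivative of the integrand in \<open>x\<close> as a covector, written in
      the dual basis so that its joint continuity reduces to that of the partial derivatives of
      \<open>h\<close>.\<close>
    define D where "D = (\<lambda>x t. \<Sum>i\<in>Basis. (t ^ Suc n * frechet_derivative h (at (c + t *\<^sub>R (x - c))) i) *\<^sub>R
      (blinfun_inner_left i :: 'a \<Rightarrow>\<^sub>L real))"
    have "((\<lambda>x. t ^ n * h (c + t *\<^sub>R (x - c))) has_derivative blinfun_apply (D x t)) (at x within ball c r)"
      if "x \<in> ball c r" "t \<in> cbox 0 1" for x t
    proof -
      have y: "c + t *\<^sub>R (x - c) \<in> ball c r" using in_ball that by auto
      then have hd: "h differentiable (at (c + t *\<^sub>R (x - c)))" using Suc.prems by auto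
      have "((\<lambda>x. h (c + t *\<^sub>R (x - c))) has_derivative (\<lambda>v. frechet_derivative h (at (c + t *\<^sub>R (x - c))) (t *\<^sub>R v))) (at x)"
        by (rule has_derivative_compose[of "\<lambda>x. c + t *\<^sub>R (x - c)" _ x UNIV h])
           (auto intro!: derivative_eq_intros simp: frechet_derivative_works[symmetric] hd)
      then have "((\<lambda>x. t ^ n * h (c + t *\<^sub>R (x - c))) has_derivative
          (\<lambda>v. t ^ n * frechet_derivative h (at (c + t *\<^sub>R (x - c))) (t *\<^sub>R v))) (at x)"
        by (rule has_derivative_mult_right)
      moreover have "t ^ n * frechet_derivative h (at (c + t *\<^sub>R (x - c))) (t *\<^sub>R v) = blinfun_apply (D x t) v" for v
      proof -
        note l = linear_frechet_derivative[OF hd]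
        have "frechet_derivative h (at (c + t *\<^sub>R (x - c))) (t *\<^sub>R v) =
          t * (\<Sum>i\<in>Basis. (v \<bullet> i) * frechet_derivative h (at (c + t *\<^sub>R (x - c))) i)"
          using linear_scale[OF l, of t v] linear_Basis_sum[OF l, of v] by simp
        then show ?thesis
          unfolding D_def blinfun.sum_left blinfun.scaleR_left
          by (simp add: sum_distrib_left mult.assoc mult.left_commute mult.commute inner_commute)
      qed
      ultimately show ?thesis
        by (simp add: has_derivative_at_withinI)
    qed
    moreover have "(\<lambda>t. t ^ n * h (c + t *\<^sub>R (x - c))) integrable_on cbox 0 1" if "x \<in> ball c r" for x
      by (intro integrable_continuous continuous_intros continuous_on_compose2[OF hc]) (use in_ball that in auto)
    moreover have dcont: "continuous_on (ball c r) (\<lambda>x. frechet_derivative h (at x) i)" for i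
    proof -
      have "Ck_on k (ball c r) (\<lambda>x. frechet_derivative h (at x) i)" using Suc.prems by simp
      then show ?thesis by (rule Ck_on_continuous)
    qed
    have "continuous_on (ball c r \<times> cbox 0 1) (\<lambda>(x, t). D x t)"
      unfolding D_def split_beta
      by (intro continuous_intros continuous_on_compose2[OF dcont]) (use in_ball in auto)
    ultimately have d: "((\<lambda>x. integral (cbox 0 1) (\<lambda>t. t ^ n * h (c + t *\<^sub>R (x - c)))) has_derivative
        integral (cbox 0 1) (D x)) (at x within ball c r)" if "x \<in> ball c r" for x
      using that by (intro leibniz_rule) auto
    then have d: "((\<lambda>x. integral {0..1} (\<lambda>t. t ^ n * h (c + t *\<^sub>R (x - c)))) has_derivative
        integral {0..1} (D x)) (at x)" if "x \<in> ball c r" for x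
      using that by (auto simp: at_within_open[OF _ open_ball])
    have iD: "D x integrable_on {0..1}" if "x \<in> ball c r" for x
      unfolding D_def using that
      by (intro integrable_continuous_interval continuous_intros continuous_on_compose2[OF dcont]) (use in_ball in auto)
    have e: "frechet_derivative (\<lambda>x. integral {0..1} (\<lambda>t. t ^ n * h (c + t *\<^sub>R (x - c)))) (at x) v =
        (\<Sum>i\<in>Basis. (v \<bullet> i) *\<^sub>R integral {0..1} (\<lambda>t. t ^ Suc n * frechet_derivative h (at (c + t *\<^sub>R (x - c))) i))"
      if "x \<in> ball c r" for x v
    proof -
      have ii: "(\<lambda>t. t ^ Suc n * frechet_derivative h (at (c + t *\<^sub>R (x - c))) i) integrable_on {0..1}" for i
        by (intro integrable_continuous_interval continuous_intros continuous_on_compose2[OF dcont]) (use in_ball that in auto)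
      have "integral {0..1} (D x) v = integral {0..1} (\<lambda>t. D x t v)"
        using integral_linear[OF iD[OF that], of "\<lambda>f. blinfun_apply f v"]
        by (simp add: o_def bounded_linear_blinfun_apply bounded_bilinear.bounded_linear_left[OF bounded_bilinear_blinfun_apply])
      also have "\<dots> = integral {0..1} (\<lambda>t. \<Sum>i\<in>Basis. (v \<bullet> i) *\<^sub>R (t ^ Suc n * frechet_derivative h (at (c + t *\<^sub>R (x - c))) i))"
        unfolding D_def blinfun.sum_left blinfun.scaleR_left
        by (simp add: mult.assoc mult.left_commute mult.commute inner_commute)
      also have "\<dots> = (\<Sum>i\<in>Basis. (v \<bullet> i) *\<^sub>R integral {0..1} (\<lambda>t. t ^ Suc n * frechet_derivative h (at (c + t *\<^sub>R (x - c))) i))"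
        by (subst integral_sum) (simp_all only: integral_cmul finite_Basis integrable_cmul[OF ii])
      finally show ?thesis by (simp add: frechet_derivative_at[OF d[OF that], symmetric])
    qed
    have "Ck_on k (ball c r) (\<lambda>x. \<Sum>i\<in>Basis. (v \<bullet> i) *\<^sub>R
        integral {0..1} (\<lambda>t. t ^ Suc n * frechet_derivative h (at (c + t *\<^sub>R (x - c))) i))" for v
    proof (intro Ck_on_sum open_ball Ck_on_linear_comp[OF open_ball bounded_linear_scaleR_right] Suc.IH)
      fix i show "Ck_on k (ball c r) (\<lambda>a. frechet_derivative h (at a) i)" using Suc.prems by simp
    qed
    then have "Ck_on k (ball c r) (\<lambda>x. frechet_derivative (\<lambda>x. integral {0..1} (\<lambda>t. t ^ n * h (c + t *\<^sub>R (x - c)))) (at x) v)" for v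
      using Ck_on_cong[OF open_ball, of c r "\<lambda>x. frechet_derivative (\<lambda>x. integral {0..1} (\<lambda>t. t ^ n * h (c + t *\<^sub>R (x - c)))) (at x) v"] e
      by (auto simp del: power_Suc)
    moreover have "(\<lambda>x. integral {0..1} (\<lambda>t. t ^ n * h (c + t *\<^sub>R (x - c)))) differentiable (at x)" if "x \<in> ball c r" for x
      using d[OF that] unfolding differentiable_def by blast
    ultimately show ?case by simp
  }
qed

text \<open>Integrating the derivative along the segment from \<open>c\<close> to \<open>x\<close>
  and expanding its direction in the basis leaves averaged partial derivatives as
  coefficients.\<close>

lemma hadamard:
  fixes f :: "'a::euclidean_space \<Rightarrow> real"
  assumes f: "\<And>x. x \<in> ball c r \<Longrightarrow> smooth_pt f x" and r: "r > 0"
  obtains g :: "'a \<Rightarrow> 'a \<Rightarrow> real" where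
    "\<And>i x. x \<in> ball c r \<Longrightarrow> smooth_pt (g i) x"
    "\<And>i. g i c = frechet_derivative f (at c) i"
    "\<And>x. x \<in> ball c r \<Longrightarrow> f x = f c + (\<Sum>i\<in>Basis. ((x - c) \<bullet> i) * g i x)"
proof -
  \<comment> \<open>The factor \<open>t ^ 0\<close> is there to match
    \<open>Ck_on_integral_scaled\<close>.\<close>
  define g where "g = (\<lambda>i x. integral {0..1} (\<lambda>t. t ^ 0 * frechet_derivative f (at (c + t *\<^sub>R (x - c))) i))"
  have sf: "smooth_on (ball c r) f" using f by (simp add: smooth_on_iff)
  then have k: "Ck_on k (ball c r) (\<lambda>x. frechet_derivative f (at x) i)" for k i
    unfolding smooth_on_def by (metis Ck_on.simps(2))
  have "Ck_on k (ball c r) (g i)" for i k unfolding g_def by (intro Ck_on_integral_scaled k)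
  then have "smooth_pt (g i) x" if "x \<in> ball c r" for i x
    using that unfolding smooth_pt_def smooth_on_def by blast
  moreover have "g i c = frechet_derivative f (at c) i" for i by (simp add: g_def)
  moreover have "f x = f c + (\<Sum>i\<in>Basis. ((x - c) \<bullet> i) * g i x)" if x: "x \<in> ball c r" for x
  proof -
    have in_ball: "c + t *\<^sub>R (x - c) \<in> ball c r" if "t \<in> {0..1}" for t
    proof -
      have "\<bar>t\<bar> * norm (x - c) \<le> 1 * norm (x - c)" using that by (intro mult_right_mono) auto
      then show ?thesis using x by (simp add: dist_norm norm_minus_commute)
    qed
    have "((\<lambda>t. frechet_derivative f (at (c + t *\<^sub>R (x - c))) (x - c)) has_integral
        f (c + 1 *\<^sub>R (x - c)) - f (c + 0 *\<^sub>R (x - c))) {0..1}"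
      by (rule fundamental_theorem_of_calculus)
         (auto simp: has_real_derivative_iff_has_vector_derivative[symmetric]
           intro!: has_field_derivative_at_within line_derivative f in_ball)
    then have "f x - f c = integral {0..1} (\<lambda>t. frechet_derivative f (at (c + t *\<^sub>R (x - c))) (x - c))"
      by (simp add: integral_unique)
    also have "\<dots> = integral {0..1} (\<lambda>t. \<Sum>i\<in>Basis. ((x - c) \<bullet> i) *\<^sub>R frechet_derivative f (at (c + t *\<^sub>R (x - c))) i)"
      by (intro integral_cong linear_Basis_sum linear_frechet_derivative smooth_pt_differentiable f in_ball)
    also have "\<dots> = (\<Sum>i\<in>Basis. ((x - c) \<bullet> i) *\<^sub>R integral {0..1} (\<lambda>t. frechet_derivative f (at (c + t *\<^sub>R (x - c))) i))"
    proof (subst integral_sum)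
      fix i
      have "continuous_on (ball c r) (\<lambda>x. frechet_derivative f (at x) i)" using k[of 0] by simp
      moreover have "continuous_on {0..1} (\<lambda>t. c + t *\<^sub>R (x - c))" by (intro continuous_intros)
      ultimately have "continuous_on {0..1} (\<lambda>t. frechet_derivative f (at (c + t *\<^sub>R (x - c))) i)"
        by (rule continuous_on_compose2) (use in_ball in auto)
      then show "(\<lambda>t. ((x - c) \<bullet> i) *\<^sub>R frechet_derivative f (at (c + t *\<^sub>R (x - c))) i) integrable_on {0..1}"
        by (intro integrable_cmul integrable_continuous_interval)
    qed simp_all
    finally show ?thesis by (simp add: g_def)
  qed
  ultimately show ?thesis using that by blast
qed

section \<open>Symmetry of second derivatives\<close>

text \<open>The mean value theorem is used twice: on \<open>g\<close>, the increment in direction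
  \<open>v\<close>, as a function of the step along \<open>u\<close>; then on the derivative in
  direction \<open>u\<close>, along \<open>v\<close>.\<close>

lemma second_difference_mean_value:
  fixes f :: "'a::euclidean_space \<Rightarrow> real"
  assumes f: "\<And>y. y \<in> ball x d \<Longrightarrow> smooth_pt f y" and h: "h > 0" "h * (norm u + norm v) < d"
  obtains y where "norm (y - x) \<le> h * (norm u + norm v)"
    "f (x + h *\<^sub>R u + h *\<^sub>R v) - f (x + h *\<^sub>R u) - f (x + h *\<^sub>R v) + f x =
     h * h * frechet_derivative (\<lambda>z. frechet_derivative f (at z) u) (at y) v"
proof -
  have bd: "norm (s *\<^sub>R u + t *\<^sub>R v) \<le> h * (norm u + norm v)" if "0 \<le> s" "s \<le> h" "0 \<le> t" "t \<le> h" for s t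
  proof -
    have "norm (s *\<^sub>R u + t *\<^sub>R v) \<le> s * norm u + t * norm v"
      using that norm_triangle_ineq[of "s *\<^sub>R u" "t *\<^sub>R v"] by simp
    also have "\<dots> \<le> h * norm u + h * norm v" using that by (intro add_mono mult_right_mono) auto
    finally show ?thesis by (simp add: algebra_simps)
  qed
  have inb: "x + s *\<^sub>R u + t *\<^sub>R v \<in> ball x d" if "0 \<le> s" "s \<le> h" "0 \<le> t" "t \<le> h" for s t
    using bd[OF that] h(2) norm_minus_cancel[of "s *\<^sub>R u + t *\<^sub>R v"]
    by (auto simp: dist_norm algebra_simps)
  define g where "g = (\<lambda>s. f (x + h *\<^sub>R v + s *\<^sub>R u) - f (x + s *\<^sub>R u))"
  have "(g has_real_derivative
      (frechet_derivative f (at (x + h *\<^sub>R v + s *\<^sub>R u)) u - frechet_derivative f (at (x + s *\<^sub>R u)) u)) (at s)"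
    if "0 \<le> s" "s \<le> h" for s
    unfolding g_def using inb[of s h] inb[of s 0] that h
    by (intro DERIV_diff line_derivative f) (auto simp: add_ac)
  from MVT2[OF h(1) this] obtain s where s: "0 < s" "s < h" "g h - g 0 = (h - 0) *
      (frechet_derivative f (at (x + h *\<^sub>R v + s *\<^sub>R u)) u - frechet_derivative f (at (x + s *\<^sub>R u)) u)" by blast
  have "((\<lambda>t. frechet_derivative f (at (x + s *\<^sub>R u + t *\<^sub>R v)) u) has_real_derivative
      frechet_derivative (\<lambda>z. frechet_derivative f (at z) u) (at (x + s *\<^sub>R u + t *\<^sub>R v)) v) (at t)"
    if "0 \<le> t" "t \<le> h" for t
    using inb[of s t] that s by (intro line_derivative smooth_pt_derivative f) auto
  from MVT2[OF h(1) this] obtain t where t: "0 < t" "t < h"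
    "frechet_derivative f (at (x + s *\<^sub>R u + h *\<^sub>R v)) u - frechet_derivative f (at (x + s *\<^sub>R u + 0 *\<^sub>R v)) u =
     (h - 0) * frechet_derivative (\<lambda>z. frechet_derivative f (at z) u) (at (x + s *\<^sub>R u + t *\<^sub>R v)) v" by blast
  show ?thesis
  proof (rule that)
    show "norm (x + s *\<^sub>R u + t *\<^sub>R v - x) \<le> h * (norm u + norm v)"
      using bd[of s t] s t by (simp add: add.assoc)
    show "f (x + h *\<^sub>R u + h *\<^sub>R v) - f (x + h *\<^sub>R u) - f (x + h *\<^sub>R v) + f x =
      h * h * frechet_derivative (\<lambda>z. frechet_derivative f (at z) u) (at (x + s *\<^sub>R u + t *\<^sub>R v)) v"
      using s(3) t(3) by (simp add: g_def add_ac)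
  qed
qed

text \<open>The second difference is symmetric in the two directions, so the two mixed derivatives
  take a common value at two nearby points; by continuity this contradicts a gap at
  \<open>x\<close>.\<close>

lemma second_derivative_symmetric:
  fixes f :: "'a::euclidean_space \<Rightarrow> real"
  assumes "smooth_pt f x"
  shows "frechet_derivative (\<lambda>z. frechet_derivative f (at z) u) (at x) v =
         frechet_derivative (\<lambda>z. frechet_derivative f (at z) v) (at x) u" (is "?A u v x = ?A v u x")
proof (rule ccontr)
  assume ne: "?A u v x \<noteq> ?A v u x"
  define e where "e = \<bar>?A u v x - ?A v u x\<bar> / 2"
  have e: "e > 0" using ne by (simp add: e_def)
  obtain d0 where d0: "d0 > 0" "\<And>y. y \<in> ball x d0 \<Longrightarrow> smooth_pt f y"
    using smooth_pt_eventually[OF assms] unfolding eventually_nhds_metric by (auto simp: dist_commute)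
  have cont: "isCont (?A u v) x" for u v
    by (intro smooth_pt_isCont smooth_pt_derivative assms)
  obtain d1 where d1: "d1 > 0" "\<And>y. dist y x < d1 \<Longrightarrow> dist (?A u v y) (?A u v x) < e"
    using cont[of u v] e unfolding continuous_at_eps_delta by blast
  obtain d2 where d2: "d2 > 0" "\<And>y. dist y x < d2 \<Longrightarrow> dist (?A v u y) (?A v u x) < e"
    using cont[of v u] e unfolding continuous_at_eps_delta by blast
  define d where "d = min d0 (min d1 d2)"
  \<comment> \<open>The added 1 keeps the denominator positive when both directions vanish and makes
    the bound by \<open>d\<close> strict.\<close>
  define h where "h = d / (norm u + norm v + 1)"
  have d: "d > 0" using d0 d1 d2 by (simp add: d_def)
  have h: "h > 0" "h * (norm u + norm v) < d"
    using d by (auto simp: h_def field_simps add_pos_nonneg intro!: divide_pos_pos add_nonneg_pos)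
  have sm: "smooth_pt f y" if "y \<in> ball x d" for y using d0(2) that by (simp add: d_def)
  obtain y where y: "norm (y - x) \<le> h * (norm u + norm v)"
    "f (x + h *\<^sub>R u + h *\<^sub>R v) - f (x + h *\<^sub>R u) - f (x + h *\<^sub>R v) + f x = h * h * ?A u v y"
    using second_difference_mean_value[OF sm h] by blast
  have h': "h * (norm v + norm u) < d" using h by (simp add: add.commute)
  obtain y' where y': "norm (y' - x) \<le> h * (norm v + norm u)"
    "f (x + h *\<^sub>R v + h *\<^sub>R u) - f (x + h *\<^sub>R v) - f (x + h *\<^sub>R u) + f x = h * h * ?A v u y'"
    using second_difference_mean_value[OF sm h(1) h'] by blast
  have "h * h * ?A u v y = h * h * ?A v u y'" using y(2) y'(2) by (simp add: algebra_simps)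
  then have eq: "?A u v y = ?A v u y'" using h by simp
  have "dist (?A u v y) (?A u v x) < e" using y(1) h by (intro d1) (auto simp: dist_norm d_def)
  moreover have "dist (?A v u y') (?A v u x) < e" using y'(1) h' by (intro d2) (auto simp: dist_norm d_def)
  moreover have False if "dist p a < \<bar>a - b\<bar> / 2" "dist p b < \<bar>a - b\<bar> / 2" for p a b :: real
    using that unfolding dist_real_def by (simp add: abs_if split: if_splits)
  ultimately show False unfolding eq e_def by blast
qed

section \<open>Local flow of a smooth vector field\<close>

text \<open>A fixed point of the integral equation on the Banach space of bounded continuous
  functions on the whole line. For a contraction there, the field is precomposed with the projection
  onto a compact ball, which makes it globally Lipschitz and bounded, and time is clamped to
  \<open>{-e..e}\<close>. The fixed point never leaves the ball, so it solves the original equation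
  for small times.\<close>

lemma local_flow:
  fixes X :: "'a::euclidean_space \<Rightarrow> 'a"
  assumes W: "open W" "x0 \<in> W" and X: "\<And>x. x \<in> W \<Longrightarrow> smooth_pt X x"
  obtains e c where "e > 0" "c 0 = x0" "\<And>t. \<bar>t\<bar> < e \<Longrightarrow> c t \<in> W"
    "\<And>t. \<bar>t\<bar> < e \<Longrightarrow> (c has_vector_derivative X (c t)) (at t)" "\<And>t. \<bar>t\<bar> < e \<Longrightarrow> smooth_pt c t"
proof -
  obtain r where r: "r > 0" "cball x0 r \<subseteq> W" using W open_contains_cball by metis
  define S where "S = cball x0 r"
  have S: "convex S" "closed S" "compact S" "S \<noteq> {}" "S \<subseteq> W" using r by (auto simp: S_def)
  have XS: "smooth_pt X x" if "x \<in> S" for x using that S X by auto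
  have "\<exists>B. \<forall>x\<in>S. norm (frechet_derivative X (at x) i) \<le> B" for i
  proof -
    have "continuous_on S (\<lambda>x. frechet_derivative X (at x) i)"
      by (intro continuous_at_imp_continuous_on ballI smooth_pt_isCont smooth_pt_derivative XS)
    then have "bounded ((\<lambda>x. frechet_derivative X (at x) i) ` S)"
      using S compact_continuous_image compact_imp_bounded by blast
    then show ?thesis by (auto simp: bounded_iff)
  qed
  then obtain B where B: "\<And>x i. x \<in> S \<Longrightarrow> norm (frechet_derivative X (at x) i) \<le> B i" by metis
  define L where "L = (\<Sum>i\<in>Basis. \<bar>B i\<bar>) + 1"
  have L: "L > 0" by (auto simp: L_def intro: add_nonneg_pos sum_nonneg)
  have "norm (frechet_derivative X (at x) v) \<le> L * norm v" if x: "x \<in> S" for x v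
  proof -
    have "norm (frechet_derivative X (at x) v) \<le> (\<Sum>i\<in>Basis. norm ((v \<bullet> i) *\<^sub>R frechet_derivative X (at x) i))"
      by (subst linear_Basis_sum[OF linear_frechet_derivative[OF smooth_pt_differentiable[OF XS[OF x]]]]) (rule norm_sum)
    also have "\<dots> \<le> (\<Sum>i\<in>Basis. norm v * \<bar>B i\<bar>)"
      using B[OF x] Basis_le_norm[of _ v] by (intro sum_mono) (auto intro!: mult_mono intro: order_trans[OF _ abs_ge_self])
    also have "\<dots> \<le> L * norm v" by (simp add: L_def sum_distrib_left[symmetric] algebra_simps)
    finally show ?thesis .
  qed
  then have lip: "norm (X x - X y) \<le> L * norm (x - y)" if "x \<in> S" "y \<in> S" for x y
    using that S
    by (intro differentiable_bound[of S X "\<lambda>x. frechet_derivative X (at x)"])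
       (auto intro!: onorm_le has_derivative_at_withinI smooth_pt_has_derivative XS)
  have Xc: "continuous_on S X"
    by (intro continuous_at_imp_continuous_on ballI smooth_pt_isCont XS)
  then have "bounded (X ` S)"
    using S compact_continuous_image compact_imp_bounded by blast
  then obtain M where M: "M > 0" "\<And>x. x \<in> S \<Longrightarrow> norm (X x) \<le> M" by (auto simp: bounded_pos)
  define Y where "Y = (\<lambda>x. X (closest_point S x))"
  have YM: "norm (Y x) \<le> M" for x unfolding Y_def using S by (intro M closest_point_in_set)
  have YL: "norm (Y x - Y y) \<le> L * norm (x - y)" for x y
  proof -
    have "norm (Y x - Y y) \<le> L * norm (closest_point S x - closest_point S y)"
      unfolding Y_def using S by (intro lip closest_point_in_set)
    also have "\<dots> \<le> L * norm (x - y)"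
      using closest_point_lipschitz[of S x y] S L by (auto simp: dist_norm)
    finally show ?thesis .
  qed
  have Yc: "continuous_on UNIV Y"
    unfolding Y_def
    by (rule continuous_on_compose2[OF Xc continuous_on_closest_point]) (use S closest_point_in_set in auto)
  \<comment> \<open>Every value of the iterate contains two integrals, each over an interval of
    length at most \<open>2 * e\<close>. The first bound makes the Lipschitz constant
    \<open>4 * e * L\<close> at most one half, the second keeps the iterate inside the ball.\<close>
  define e where "e = min (1 / (8 * L)) (r / (4 * (M + 1)))"
  have e: "e > 0" using L M r by (simp add: e_def)
  have eL: "4 * e * L \<le> 1 / 2"
  proof -
    have "e \<le> 1 / (8 * L)" by (simp add: e_def)
    then show ?thesis using L by (simp add: field_simps)
  qed
  have eM: "4 * e * M < r"
  proof -
    have "e \<le> r / (4 * (M + 1))" by (simp add: e_def)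
    then have "4 * e * (M + 1) \<le> r" using M by (simp add: field_simps)
    then show ?thesis using e by (simp add: algebra_simps)
  qed
  \<comment> \<open>Integrals start at \<open>-e\<close> because an interval with reversed endpoints
    is empty; the value at \<open>0\<close> is subtracted afterwards to move the initial time to
    \<open>0\<close>.\<close>
  define I where "I = (\<lambda>(c :: real \<Rightarrow>\<^sub>C 'a) \<tau>. integral {-e..\<tau>} (\<lambda>s. Y (apply_bcontfun c s)))"
  define cl where "cl = (\<lambda>t. max (-e) (min e t))"
  have cl: "cl t \<in> {-e..e}" "\<bar>t\<bar> < e \<Longrightarrow> cl t = t" for t using e by (auto simp: cl_def)
  define F where "F = (\<lambda>c t. x0 + (I c (cl t) - I c 0))"
  have Ycc: "continuous_on T (\<lambda>s. Y (apply_bcontfun c s))" for c :: "real \<Rightarrow>\<^sub>C 'a" and T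
    by (rule continuous_on_compose2[OF Yc]) (auto intro: continuous_intros)
  have int: "(\<lambda>s. Y (apply_bcontfun c s)) integrable_on {-e..\<tau>}" for c :: "real \<Rightarrow>\<^sub>C 'a" and \<tau>
    by (rule integrable_continuous_interval) (rule Ycc)
  have bnd: "norm (integral {-e..\<tau>} f) \<le> 2 * e * K"
    if "\<tau> \<in> {-e..e}" "continuous_on {-e..\<tau>} f" "\<And>t. norm (f t) \<le> K" for f :: "real \<Rightarrow> 'a" and \<tau> K
  proof -
    have "0 \<le> K" using that(3)[of 0] norm_ge_zero order_trans by blast
    have "norm (integral {-e..\<tau>} f) \<le> K * (\<tau> - (-e))"
      using that by (intro integral_bound) auto
    also have "\<dots> \<le> K * (2 * e)" using that(1) \<open>0 \<le> K\<close> by (intro mult_left_mono) auto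
    finally show ?thesis by (simp add: mult_ac)
  qed
  have z: "0 \<in> {-e..e}" using e by simp
  have IM: "norm (I c \<tau>) \<le> 2 * e * M" if "\<tau> \<in> {-e..e}" for c \<tau>
    unfolding I_def by (rule bnd[OF that Ycc YM])
  have FM: "norm (F c t - x0) < r" for c t
  proof -
    have "norm (I c (cl t) - I c 0) \<le> 2 * e * M + 2 * e * M"
      using norm_triangle_ineq4 IM[OF cl(1)] IM[OF z] by (meson add_mono order_trans)
    also have "\<dots> = 4 * e * M" by simp
    finally show ?thesis using eM by (simp add: F_def)
  qed
  have Fb: "F c \<in> bcontfun" for c
  proof (rule bcontfun_normI)
    have "continuous_on {-e..e} (I c)"
      unfolding I_def by (rule indefinite_integral_continuous_1) (rule int)
    then have "continuous_on UNIV (\<lambda>t. I c (cl t))"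
      by (rule continuous_on_compose2) (use cl in \<open>auto simp: cl_def intro!: continuous_intros\<close>)
    then show "continuous_on UNIV (F c)" unfolding F_def by (intro continuous_intros)
    show "norm (F c t) \<le> norm x0 + r" for t
      using FM[of c t] norm_triangle_sub[of "F c t" x0] by simp
  qed
  have ID: "norm (I c \<tau> - I d \<tau>) \<le> 2 * e * (L * dist c d)" if "\<tau> \<in> {-e..e}" for c d \<tau>
  proof -
    have "I c \<tau> - I d \<tau> = integral {-e..\<tau>} (\<lambda>s. Y (apply_bcontfun c s) - Y (apply_bcontfun d s))"
      unfolding I_def by (intro integral_diff[symmetric] int)
    moreover have "norm (Y (apply_bcontfun c s) - Y (apply_bcontfun d s)) \<le> L * dist c d" for s
      using YL[of "apply_bcontfun c s" "apply_bcontfun d s"] dist_bounded[of c s d] L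
      by (smt (verit) dist_norm mult_left_mono)
    ultimately show ?thesis using bnd[OF that continuous_on_diff[OF Ycc Ycc]] by metis
  qed
  have "dist (Bcontfun (F c)) (Bcontfun (F d)) \<le> 1 / 2 * dist c d" for c d
  proof (rule dist_bound)
    fix t
    have "dist (F c t) (F d t) = norm ((I c (cl t) - I d (cl t)) - (I c 0 - I d 0))"
      by (simp add: F_def dist_norm algebra_simps)
    also have "\<dots> \<le> 2 * e * (L * dist c d) + 2 * e * (L * dist c d)"
      using norm_triangle_ineq4 ID[OF cl(1)] ID[OF z] by (meson add_mono order_trans)
    also have "\<dots> = (4 * e * L) * dist c d" by simp
    also have "\<dots> \<le> 1 / 2 * dist c d" by (rule mult_right_mono[OF eL]) simp
    finally show "dist (apply_bcontfun (Bcontfun (F c)) t) (apply_bcontfun (Bcontfun (F d)) t) \<le> 1 / 2 * dist c d"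
      by (simp add: Bcontfun_inverse[OF Fb])
  qed
  then have "\<exists>!c. Bcontfun (F c) = c" by (intro banach_fix_type[of "1/2"]) auto
  then obtain c0 where c0: "Bcontfun (F c0) = c0" by blast
  define c where "c = apply_bcontfun c0"
  have cF: "c = F c0" unfolding c_def using c0 Bcontfun_inverse[OF Fb] by metis
  have cS: "c t \<in> S" for t
    using FM[of c0 t] by (simp add: cF S_def dist_norm norm_minus_commute)
  have der: "(c has_vector_derivative X (c t)) (at t)" if t: "\<bar>t\<bar> < e" for t
  proof -
    have t': "t \<in> {-e<..<e}" using t by auto
    have "(I c0 has_vector_derivative Y (c t)) (at t within {-e..e})"
      unfolding I_def c_def by (rule integral_has_vector_derivative[OF Ycc]) (use t in auto)
    then have "(I c0 has_vector_derivative Y (c t)) (at t)"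
      using t' at_within_interior[of t "{-e..e}"] by (simp add: interior_atLeastAtMost_real)
    then have "((\<lambda>t. x0 + (I c0 t - I c0 0)) has_vector_derivative Y (c t)) (at t)"
      by (auto intro!: derivative_eq_intros)
    moreover have "Y (c t) = X (c t)" unfolding Y_def using cS by (simp add: closest_point_self)
    ultimately have "((\<lambda>t. x0 + (I c0 t - I c0 0)) has_vector_derivative X (c t)) (at t)" by simp
    then show ?thesis
      by (rule has_vector_derivative_transform_within_open[of _ _ _ "{-e<..<e}"])
         (use t' cl in \<open>auto simp: cF F_def\<close>)
  qed
  \<comment> \<open>Bootstrapping: the equation makes the derivative of \<open>c\<close> as regular
    as \<open>c\<close> itself.\<close>
  have "Ck_on k {-e<..<e} c" for k
  proof (induction k)
    case 0
    have "isCont c t" if "\<bar>t\<bar> < e" for t using der[OF that] has_vector_derivative_continuous by blast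
    then show ?case by (auto intro!: continuous_at_imp_continuous_on)
  next
    case (Suc k)
    have d: "(c has_derivative (\<lambda>v. v *\<^sub>R X (c t))) (at t)" if "t \<in> {-e<..<e}" for t
      using der[of t] that by (auto simp: has_vector_derivative_def)
    have fd: "frechet_derivative c (at t) v = v *\<^sub>R X (c t)" if "t \<in> {-e<..<e}" for t v
      by (subst frechet_derivative_at[OF d[OF that], symmetric]) simp
    have "smooth_on W X" using X W by (simp add: smooth_on_iff)
    then have XW: "Ck_on k W X" by (simp add: smooth_on_def)
    have "Ck_on k {-e<..<e} (\<lambda>t. X (c t))"
      by (rule Ck_on_compose[OF _ W(1) _ Suc.IH XW]) (use cS S in auto)
    then have "Ck_on k {-e<..<e} (\<lambda>t. v *\<^sub>R X (c t))" for v
      by (intro Ck_on_linear_comp[OF _ bounded_linear_scaleR_right]) auto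
    then have "Ck_on k {-e<..<e} (\<lambda>t. frechet_derivative c (at t) v)" for v
      using Ck_on_cong[of "{-e<..<e}" "\<lambda>t. frechet_derivative c (at t) v" "\<lambda>t. v *\<^sub>R X (c t)" k] fd by auto
    moreover have "c differentiable (at t)" if "t \<in> {-e<..<e}" for t
      using d[OF that] unfolding differentiable_def by blast
    ultimately show ?case by simp
  qed
  then have "smooth_pt c t" if "\<bar>t\<bar> < e" for t
    using that unfolding smooth_pt_def smooth_on_def by (intro exI[of _ "{-e<..<e}"]) auto
  moreover have "c 0 = x0" using e by (simp add: cF F_def cl_def)
  ultimately show ?thesis using that[OF e _ _ der] cS S by blast
qed

section \<open>Smooth maps between manifolds\<close>

lemma eventually_nhds_compose:
  assumes "isCont f x" "eventually P (nhds (f x))"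
  shows "\<forall>\<^sub>F z in nhds x. P (f z)"
  using assms unfolding isCont_def tendsto_at_iff_tendsto_nhds by (rule eventually_compose_filterlim[rotated])

lemma isCont_cong_nhds:
  assumes "\<forall>\<^sub>F y in nhds x. f y = g y" "isCont f x"
  shows "isCont g x"
proof -
  have "f x = g x" using assms(1) by (rule eventually_nhds_x_imp_x)
  moreover have "filterlim f (nhds (f x)) (nhds x)"
    using assms(2) unfolding isCont_def tendsto_at_iff_tendsto_nhds .
  ultimately have "filterlim g (nhds (g x)) (nhds x)"
    using filterlim_cong[OF refl refl assms(1)] by metis
  then show ?thesis unfolding isCont_def tendsto_at_iff_tendsto_nhds .
qed

lemma smooth_atlasD:
  assumes "smooth_atlas A" "(U, \<phi>) \<in> A"
  shows "open U" "open (\<phi> ` U)" "continuous_on U \<phi>" "continuous_on (\<phi> ` U) (inv_into U \<phi>)"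
    "\<And>p. p \<in> U \<Longrightarrow> inv_into U \<phi> (\<phi> p) = p" "inj_on \<phi> U"
proof -
  have h: "open U" "open (\<phi> ` U)" "homeomorphism U (\<phi> ` U) \<phi> (inv_into U \<phi>)"
    using assms unfolding smooth_atlas_def by auto
  then show "open U" "open (\<phi> ` U)" "continuous_on U \<phi>" "continuous_on (\<phi> ` U) (inv_into U \<phi>)"
    and *: "\<And>p. p \<in> U \<Longrightarrow> inv_into U \<phi> (\<phi> p) = p"
    unfolding homeomorphism_def by auto
  show "inj_on \<phi> U" by (rule inj_on_inverseI) (rule *)
qed

lemma chart_isCont:
  assumes "smooth_atlas A" "(U, \<phi>) \<in> A" "p \<in> U"
  shows "isCont \<phi> p" "isCont (inv_into U \<phi>) (\<phi> p)"
    "\<forall>\<^sub>F q in nhds p. q \<in> U" "\<forall>\<^sub>F x in nhds (\<phi> p). x \<in> \<phi> ` U" "\<forall>\<^sub>F x in nhds (\<phi> p). inv_into U \<phi> x \<in> U"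
proof -
  note a = smooth_atlasD[OF assms(1,2)]
  show "isCont \<phi> p" "isCont (inv_into U \<phi>) (\<phi> p)"
    using a assms(3) by (auto simp: continuous_on_eq_continuous_at)
  show "\<forall>\<^sub>F q in nhds p. q \<in> U" "\<forall>\<^sub>F x in nhds (\<phi> p). x \<in> \<phi> ` U"
    using a assms(3) by (auto intro: eventually_nhds_in_open)
  then show "\<forall>\<^sub>F x in nhds (\<phi> p). inv_into U \<phi> x \<in> U"
    by (auto elim!: eventually_mono intro: inv_into_into)
qed

lemma transition_smooth:
  assumes "smooth_atlas A" "(U, \<phi>) \<in> A" "(V, \<psi>) \<in> A" "p \<in> U" "p \<in> V"
  shows "smooth_pt (\<lambda>x. \<psi> (inv_into U \<phi> x)) (\<phi> p)"
proof -
  have "smooth_on (\<phi> ` (U \<inter> V)) (\<psi> \<circ> inv_into U \<phi>)"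
    using assms unfolding smooth_atlas_def by fast
  then show ?thesis using assms by (auto simp: smooth_on_iff o_def)
qed

section \<open>Maps smooth at a point\<close>

text \<open>One pair of charts is enough, since \<open>msmooth_at_chart\<close> passes to any other
  pair. Continuity is a separate clause because the coordinate expression says nothing about values
  of \<open>F\<close> outside the target chart.\<close>

definition msmooth_at :: "('m::t2_space, 'e::euclidean_space) chart set \<Rightarrow>
    ('n::t2_space, 'f::euclidean_space) chart set \<Rightarrow> ('m \<Rightarrow> 'n) \<Rightarrow> 'm \<Rightarrow> bool" where
  "msmooth_at A B F p \<longleftrightarrow> isCont F p \<and> (\<exists>U \<phi> V \<psi>. (U, \<phi>) \<in> A \<and> (V, \<psi>) \<in> B \<and> p \<in> U \<and> F p \<in> V \<and>
     smooth_pt (\<lambda>x. \<psi> (F (inv_into U \<phi> x))) (\<phi> p))"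

lemma msmooth_atI:
  assumes "isCont F p" "(U, \<phi>) \<in> A" "(V, \<psi>) \<in> B" "p \<in> U" "F p \<in> V" "smooth_pt (\<lambda>x. \<psi> (F (inv_into U \<phi> x))) (\<phi> p)"
  shows "msmooth_at A B F p"
  using assms unfolding msmooth_at_def by blast

lemma msmooth_at_isCont: "msmooth_at A B F p \<Longrightarrow> isCont F p"
  by (simp add: msmooth_at_def)

text \<open>The new coordinate expression is the old one between two transition maps, but only near
  \<open>p\<close>: continuity of \<open>F\<close> and of the inverse chart keeps the intermediate
  points inside the chart domains.\<close>

lemma msmooth_at_chart:
  assumes A: "smooth_atlas A" and B: "smooth_atlas B" and F: "msmooth_at A B F p"
    and U: "(U, \<phi>) \<in> A" "p \<in> U" and V: "(V, \<psi>) \<in> B" "F p \<in> V"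
  shows "smooth_pt (\<lambda>x. \<psi> (F (inv_into U \<phi> x))) (\<phi> p)"
proof -
  obtain U0 \<phi>0 V0 \<psi>0 where c: "(U0, \<phi>0) \<in> A" "(V0, \<psi>0) \<in> B" "p \<in> U0" "F p \<in> V0"
    "smooth_pt (\<lambda>x. \<psi>0 (F (inv_into U0 \<phi>0 x))) (\<phi>0 p)" "isCont F p"
    using F unfolding msmooth_at_def by blast
  note inv = smooth_atlasD(5)[OF A U(1)] smooth_atlasD(5)[OF A c(1)] smooth_atlasD(5)[OF B c(2)]
  have 1: "smooth_pt (\<lambda>x. \<phi>0 (inv_into U \<phi> x)) (\<phi> p)"
    by (rule transition_smooth[OF A U(1) c(1) U(2) c(3)])
  have 2: "smooth_pt (\<lambda>x. \<psi>0 (F (inv_into U0 \<phi>0 (\<phi>0 (inv_into U \<phi> x))))) (\<phi> p)"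
    by (rule smooth_pt_compose[of "\<lambda>x. \<psi>0 (F (inv_into U0 \<phi>0 x))"]) (use 1 c(5) U(2) in \<open>simp_all add: inv\<close>)
  have 3: "smooth_pt (\<lambda>y. \<psi> (inv_into V0 \<psi>0 y)) (\<psi>0 (F p))"
    by (rule transition_smooth[OF B c(2) V(1) c(4) V(2)])
  have 4: "smooth_pt (\<lambda>x. \<psi> (inv_into V0 \<psi>0 (\<psi>0 (F (inv_into U0 \<phi>0 (\<phi>0 (inv_into U \<phi> x))))))) (\<phi> p)"
    by (rule smooth_pt_compose[of "\<lambda>y. \<psi> (inv_into V0 \<psi>0 y)"]) (use 2 3 U(2) c(3) in \<open>simp_all add: inv\<close>)
  have "\<forall>\<^sub>F q in nhds p. q \<in> U0 \<and> F q \<in> V0"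
    using chart_isCont(3)[OF A c(1,3)] eventually_nhds_compose[OF c(6) chart_isCont(3)[OF B c(2,4)]]
    by (rule eventually_conj)
  then have "\<forall>\<^sub>F q in nhds (inv_into U \<phi> (\<phi> p)). q \<in> U0 \<and> F q \<in> V0" using U(2) by (simp add: inv)
  from eventually_nhds_compose[OF chart_isCont(2)[OF A U] this]
  have "\<forall>\<^sub>F x in nhds (\<phi> p). \<psi> (inv_into V0 \<psi>0 (\<psi>0 (F (inv_into U0 \<phi>0 (\<phi>0 (inv_into U \<phi> x)))))) = \<psi> (F (inv_into U \<phi> x))"
    by (rule eventually_mono) (simp add: inv)
  from smooth_pt_cong[OF this 4] show ?thesis .
qed

abbreviation chart_dom :: "('m, 'e) chart set \<Rightarrow> 'm \<Rightarrow> 'm set" where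
  "chart_dom A p \<equiv> fst (chart_at A p)"

abbreviation chart_fun :: "('m, 'e) chart set \<Rightarrow> 'm \<Rightarrow> 'm \<Rightarrow> 'e" where
  "chart_fun A p \<equiv> snd (chart_at A p)"

abbreviation chart_inv :: "('m, 'e) chart set \<Rightarrow> 'm \<Rightarrow> 'e \<Rightarrow> 'm" where
  "chart_inv A p \<equiv> inv_into (chart_dom A p) (chart_fun A p)"

lemma chart_at_mem:
  assumes "smooth_atlas A"
  shows "(chart_dom A p, chart_fun A p) \<in> A" "p \<in> chart_dom A p"
proof -
  have "\<exists>c. c \<in> A \<and> p \<in> fst c"
    using assms unfolding smooth_atlas_def by (metis (no_types, lifting) UNIV_I UN_E case_prod_beta)
  then have "chart_at A p \<in> A \<and> p \<in> fst (chart_at A p)" unfolding chart_at_def by (rule someI_ex)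
  then show "(chart_dom A p, chart_fun A p) \<in> A" "p \<in> chart_dom A p" by auto
qed

lemma chart_inv_self [simp]: "smooth_atlas A \<Longrightarrow> chart_inv A p (chart_fun A p p) = p"
  using smooth_atlasD(5) chart_at_mem by metis

lemma msmooth_at_iff:
  assumes "smooth_atlas A" "smooth_atlas B"
  shows "msmooth_at A B F p \<longleftrightarrow>
    isCont F p \<and> smooth_pt (\<lambda>x. chart_fun B (F p) (F (chart_inv A p x))) (chart_fun A p p)"
  using msmooth_at_chart[OF assms _ chart_at_mem(1,2)[OF assms(1)] chart_at_mem(1,2)[OF assms(2)]]
    msmooth_at_isCont msmooth_atI[OF _ chart_at_mem(1)[OF assms(1)] chart_at_mem(1)[OF assms(2)] chart_at_mem(2)[OF assms(1)] chart_at_mem(2)[OF assms(2)]]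
  by blast

lemma msmooth_at_compose:
  assumes A: "smooth_atlas A" and B: "smooth_atlas B" and C: "smooth_atlas C"
    and H: "msmooth_at B C H (F p)" and F: "msmooth_at A B F p"
  shows "msmooth_at A C (\<lambda>q. H (F q)) p"
proof -
  note iff = msmooth_at_iff[OF A B] msmooth_at_iff[OF B C] msmooth_at_iff[OF A C]
  have cont: "isCont (\<lambda>q. H (F q)) p"
    using isCont_o2[OF msmooth_at_isCont[OF F] msmooth_at_isCont[OF H]] .
  note invB = smooth_atlasD(5)[OF B chart_at_mem(1)[OF B]]
  have "smooth_pt (\<lambda>x. chart_fun C (H (F p)) (H (chart_inv B (F p) (chart_fun B (F p) (F (chart_inv A p x)))))) (chart_fun A p p)"
    by (rule smooth_pt_compose[of "\<lambda>y. chart_fun C (H (F p)) (H (chart_inv B (F p) y))"])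
       (use F H A in \<open>simp_all add: iff\<close>)
  moreover have "\<forall>\<^sub>F q in nhds (chart_inv A p (chart_fun A p p)). F q \<in> chart_dom B (F p)"
    using eventually_nhds_compose[OF msmooth_at_isCont[OF F] chart_isCont(3)[OF B chart_at_mem[OF B]]] A by simp
  then have "\<forall>\<^sub>F x in nhds (chart_fun A p p). F (chart_inv A p x) \<in> chart_dom B (F p)"
    using eventually_nhds_compose[OF chart_isCont(2)[OF A chart_at_mem[OF A]]] by blast
  then have "\<forall>\<^sub>F x in nhds (chart_fun A p p). chart_fun C (H (F p)) (H (chart_inv B (F p) (chart_fun B (F p) (F (chart_inv A p x))))) =
      chart_fun C (H (F p)) (H (F (chart_inv A p x)))"
    by (rule eventually_mono) (simp add: invB)
  ultimately have "smooth_pt (\<lambda>x. chart_fun C (H (F p)) (H (F (chart_inv A p x)))) (chart_fun A p p)"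
    by (rule smooth_pt_cong[rotated])
  with cont show ?thesis unfolding iff by blast
qed

lemma msmooth_at_cong:
  assumes "smooth_atlas A" "smooth_atlas B" "\<forall>\<^sub>F q in nhds p. F q = H q" "msmooth_at A B F p"
  shows "msmooth_at A B H p"
proof -
  note iff = msmooth_at_iff[OF assms(1,2)]
  have e: "F p = H p" using assms(3) by (rule eventually_nhds_x_imp_x)
  have "\<forall>\<^sub>F q in nhds (chart_inv A p (chart_fun A p p)). F q = H q" using assms by simp
  from eventually_nhds_compose[OF chart_isCont(2)[OF assms(1) chart_at_mem[OF assms(1)]] this]
  have "\<forall>\<^sub>F x in nhds (chart_fun A p p). chart_fun B (F p) (F (chart_inv A p x)) = chart_fun B (H p) (H (chart_inv A p x))"
    by (rule eventually_mono) (simp add: e)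
  from smooth_pt_cong[OF this] isCont_cong_nhds[OF assms(3)] assms(4) show ?thesis unfolding iff by blast
qed

lemma msmooth_at_id: "smooth_atlas A \<Longrightarrow> msmooth_at A A (\<lambda>q. q) p"
  unfolding msmooth_at_iff using transition_smooth chart_at_mem by (metis continuous_ident)

lemma msmooth_at_const: "smooth_atlas A \<Longrightarrow> smooth_atlas B \<Longrightarrow> msmooth_at A B (\<lambda>q. c) p"
  unfolding msmooth_at_iff by simp

lemma smooth_map_iff:
  assumes "smooth_atlas A" "smooth_atlas B"
  shows "smooth_map A B F \<longleftrightarrow> (\<forall>p. msmooth_at A B F p)"
proof
  assume F: "smooth_map A B F"
  show "\<forall>p. msmooth_at A B F p"
  proof
    fix p
    have "smooth_on (chart_fun A p ` (chart_dom A p \<inter> F -` chart_dom B (F p))) (chart_fun B (F p) \<circ> F \<circ> chart_inv A p)"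
      using F chart_at_mem(1)[OF assms(1), of p] chart_at_mem(1)[OF assms(2), of "F p"] unfolding smooth_map_def by fast
    then have "smooth_pt (\<lambda>x. chart_fun B (F p) (F (chart_inv A p x))) (chart_fun A p p)"
      using chart_at_mem(2)[OF assms(1), of p] chart_at_mem(2)[OF assms(2), of "F p"]
      by (auto simp: smooth_on_iff o_def)
    moreover have "isCont F p"
      using F unfolding smooth_map_def by (simp add: continuous_on_eq_continuous_at)
    ultimately show "msmooth_at A B F p" by (simp add: msmooth_at_iff assms)
  qed
next
  assume F: "\<forall>p. msmooth_at A B F p"
  then have c: "continuous_on UNIV F"
    by (intro continuous_at_imp_continuous_on ballI msmooth_at_isCont) blast
  have "smooth_on (\<phi> ` (U \<inter> F -` V)) (\<psi> \<circ> F \<circ> inv_into U \<phi>)" if U: "(U, \<phi>) \<in> A" and V: "(V, \<psi>) \<in> B" for U \<phi> V \<psi>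
    unfolding smooth_on_iff
  proof (intro conjI ballI)
    have "open (F -` V)" using c smooth_atlasD(1)[OF assms(2) V] by (simp add: continuous_on_open_vimage)
    moreover have "\<phi> ` (U \<inter> F -` V) = \<phi> ` U \<inter> inv_into U \<phi> -` (F -` V)"
      using smooth_atlasD(5)[OF assms(1) U] by force
    ultimately show "open (\<phi> ` (U \<inter> F -` V))"
      using smooth_atlasD(2,4)[OF assms(1) U] by (simp add: continuous_open_preimage)
  next
    fix x assume "x \<in> \<phi> ` (U \<inter> F -` V)"
    then obtain p where "x = \<phi> p" "p \<in> U" "F p \<in> V" by blast
    then show "smooth_pt (\<psi> \<circ> F \<circ> inv_into U \<phi>) x"
      using msmooth_at_chart[OF assms _ U _ V, of F p] F by (simp add: o_def)
  qed
  then show "smooth_map A B F" using c unfolding smooth_map_def by blast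
qed

lemma smooth_atlas_model [simp]: "smooth_atlas model_atlas"
  unfolding smooth_atlas_def model_atlas_def
  by (auto simp: inv_id homeomorphism_def smooth_on_iff id_def o_def)

lemma chart_at_model [simp]: "chart_at model_atlas x = (UNIV, id)"
proof -
  have "(SOME c. c = (UNIV, id) \<and> x \<in> fst c) = (UNIV, id)" by (rule some_equality) auto
  then show ?thesis by (simp add: chart_at_def model_atlas_def)
qed

lemma msmooth_at_model_iff:
  assumes "smooth_atlas A"
  shows "msmooth_at A model_atlas f p \<longleftrightarrow> smooth_pt (\<lambda>x. f (chart_inv A p x)) (chart_fun A p p)"
proof -
  note m = chart_at_mem[OF assms, of p]
  have "isCont f p" if s: "smooth_pt (\<lambda>x. f (chart_inv A p x)) (chart_fun A p p)"
  proof -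
    have "isCont (\<lambda>q. f (chart_inv A p (chart_fun A p q))) p"
      using isCont_o2[OF chart_isCont(1)[OF assms m] smooth_pt_isCont[OF s]] by simp
    moreover have "\<forall>\<^sub>F q in nhds p. f (chart_inv A p (chart_fun A p q)) = f q"
      using chart_isCont(3)[OF assms m] by (rule eventually_mono) (simp add: smooth_atlasD(5)[OF assms m(1)])
    ultimately show ?thesis by (rule isCont_cong_nhds[rotated])
  qed
  then show ?thesis by (auto simp: msmooth_at_iff assms)
qed

lemma msmooth_at_model_model [simp]: "msmooth_at model_atlas model_atlas f x \<longleftrightarrow> smooth_pt f x"
  by (simp add: msmooth_at_model_iff)

lemma msmooth_at_from_model_iff:
  assumes "smooth_atlas B"
  shows "msmooth_at model_atlas B c t \<longleftrightarrow> isCont c t \<and> smooth_pt (\<lambda>t'. chart_fun B (c t) (c t')) t"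
  by (simp add: msmooth_at_iff assms)

lemma chart_msmooth:
  assumes "smooth_atlas A" "(U, \<phi>) \<in> A" "p \<in> U"
  shows "msmooth_at A model_atlas \<phi> p" "msmooth_at model_atlas A (inv_into U \<phi>) (\<phi> p)"
proof -
  have "(UNIV, id) \<in> (model_atlas :: ('b, 'b) chart set)" by (simp add: model_atlas_def)
  from msmooth_atI[OF chart_isCont(1)[OF assms] assms(2) this assms(3)] msmooth_atI[OF chart_isCont(2)[OF assms] this assms(2)]
    transition_smooth[OF assms(1,2,2,3,3)]
  show "msmooth_at A model_atlas \<phi> p" "msmooth_at model_atlas A (inv_into U \<phi>) (\<phi> p)"
    by (simp_all add: smooth_atlasD(5)[OF assms(1,2)] assms(3))
qed

section \<open>Products of manifolds\<close>

text \<open>Confined to the image, since \<open>inv_into\<close> is unspecified elsewhere; later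
  uses therefore restrict to an open product of chart images.\<close>

lemma prod_atlas_inv:
  assumes "smooth_atlas A" "smooth_atlas B" "(U, \<phi>) \<in> A" "(V, \<psi>) \<in> B" "z \<in> (\<phi> ` U) \<times> (\<psi> ` V)"
  shows "inv_into (U \<times> V) (map_prod \<phi> \<psi>) z = (inv_into U \<phi> (fst z), inv_into V \<psi> (snd z))"
proof (rule inv_into_f_eq)
  show "inj_on (map_prod \<phi> \<psi>) (U \<times> V)"
    by (intro map_prod_inj_on smooth_atlasD(6)[OF assms(1,3)] smooth_atlasD(6)[OF assms(2,4)])
qed (use assms(5) in \<open>auto simp: f_inv_into_f inv_into_into\<close>)

lemma smooth_atlas_prod:
  assumes A: "smooth_atlas A" and B: "smooth_atlas B"
  shows "smooth_atlas (prod_atlas A B)"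
  unfolding smooth_atlas_def
proof (intro conjI)
  show "(\<Union>(U, \<phi>)\<in>prod_atlas A B. U) = UNIV"
  proof -
    have "(p, q) \<in> (\<Union>(U, \<phi>)\<in>prod_atlas A B. U)" for p q
      using chart_at_mem[OF A, of p] chart_at_mem[OF B, of q] unfolding prod_atlas_def by fast
    then show ?thesis by auto
  qed
next
  have "open (U \<times> V) \<and> open (map_prod \<phi> \<psi> ` (U \<times> V)) \<and>
      homeomorphism (U \<times> V) (map_prod \<phi> \<psi> ` (U \<times> V)) (map_prod \<phi> \<psi>) (inv_into (U \<times> V) (map_prod \<phi> \<psi>))"
    if U: "(U, \<phi>) \<in> A" and V: "(V, \<psi>) \<in> B" for U \<phi> V \<psi>
  proof -
    note a = smooth_atlasD[OF A U] and b = smooth_atlasD[OF B V]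
    have im: "map_prod \<phi> \<psi> ` (U \<times> V) = (\<phi> ` U) \<times> (\<psi> ` V)" by (rule map_prod_surj_on[OF refl refl])
    have inj: "inj_on (map_prod \<phi> \<psi>) (U \<times> V)" by (intro map_prod_inj_on a b)
    have "continuous_on (U \<times> V) (map_prod \<phi> \<psi>)"
      unfolding map_prod_def split_beta
      by (intro continuous_on_Pair continuous_on_compose2[OF a(3)] continuous_on_compose2[OF b(3)] continuous_intros) auto
    moreover have "continuous_on ((\<phi> ` U) \<times> (\<psi> ` V)) (\<lambda>z. (inv_into U \<phi> (fst z), inv_into V \<psi> (snd z)))"
      by (intro continuous_on_Pair continuous_on_compose2[OF a(4)] continuous_on_compose2[OF b(4)] continuous_intros) auto
    then have "continuous_on ((\<phi> ` U) \<times> (\<psi> ` V)) (inv_into (U \<times> V) (map_prod \<phi> \<psi>))"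
      by (rule continuous_on_eq) (rule prod_atlas_inv[OF A B U V, symmetric])
    ultimately have "homeomorphism (U \<times> V) (map_prod \<phi> \<psi> ` (U \<times> V)) (map_prod \<phi> \<psi>) (inv_into (U \<times> V) (map_prod \<phi> \<psi>))"
      using inj unfolding homeomorphism_def im[symmetric]
      by (simp add: inv_into_image_cancel f_inv_into_f inv_into_f_f)
    moreover have "open (map_prod \<phi> \<psi> ` (U \<times> V))" unfolding im by (intro open_Times a b)
    moreover have "open (U \<times> V)" by (intro open_Times a b)
    ultimately show ?thesis by blast
  qed
  then show "\<forall>(U, \<phi>)\<in>prod_atlas A B. open U \<and> open (\<phi> ` U) \<and> homeomorphism U (\<phi> ` U) \<phi> (inv_into U \<phi>)"
    unfolding prod_atlas_def by blast
next
  have "smooth_on (map_prod \<phi> \<psi> ` (U \<times> V \<inter> U' \<times> V')) (map_prod \<phi>' \<psi>' \<circ> inv_into (U \<times> V) (map_prod \<phi> \<psi>))"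
    if U: "(U, \<phi>) \<in> A" and V: "(V, \<psi>) \<in> B" and U': "(U', \<phi>') \<in> A" and V': "(V', \<psi>') \<in> B" for U \<phi> V \<psi> U' \<phi>' V' \<psi>'
    unfolding smooth_on_iff
  proof (intro conjI ballI)
    have im: "map_prod \<phi> \<psi> ` (U \<times> V \<inter> U' \<times> V') = (\<phi> ` (U \<inter> U')) \<times> (\<psi> ` (V \<inter> V'))"
      unfolding Times_Int_Times by (rule map_prod_surj_on[OF refl refl])
    have "smooth_on (\<phi> ` (U \<inter> U')) (\<phi>' \<circ> inv_into U \<phi>)" "smooth_on (\<psi> ` (V \<inter> V')) (\<psi>' \<circ> inv_into V \<psi>)"
      using A B U U' V V' unfolding smooth_atlas_def by fast+
    then show "open (map_prod \<phi> \<psi> ` (U \<times> V \<inter> U' \<times> V'))"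
      unfolding im smooth_on_def by (intro open_Times) auto
    fix z assume "z \<in> map_prod \<phi> \<psi> ` (U \<times> V \<inter> U' \<times> V')"
    then obtain p q where z: "z = (\<phi> p, \<psi> q)" "p \<in> U" "p \<in> U'" "q \<in> V" "q \<in> V'" by auto
    have "smooth_pt (\<lambda>z. (\<phi>' (inv_into U \<phi> (fst z)), \<psi>' (inv_into V \<psi> (snd z)))) z"
      using z transition_smooth[OF A U U', of p] transition_smooth[OF B V V', of q]
      by (intro smooth_pt_Pair smooth_pt_compose[OF _ smooth_pt_fst] smooth_pt_compose[OF _ smooth_pt_snd]) auto
    moreover have "\<forall>\<^sub>F z in nhds z. z \<in> (\<phi> ` U) \<times> (\<psi> ` V)"
      using z smooth_atlasD(2)[OF A U] smooth_atlasD(2)[OF B V] by (intro eventually_nhds_in_open open_Times) auto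
    then have "\<forall>\<^sub>F z in nhds z. (\<phi>' (inv_into U \<phi> (fst z)), \<psi>' (inv_into V \<psi> (snd z))) =
        (map_prod \<phi>' \<psi>' \<circ> inv_into (U \<times> V) (map_prod \<phi> \<psi>)) z"
      by (rule eventually_mono) (simp add: prod_atlas_inv[OF A B U V])
    ultimately show "smooth_pt (map_prod \<phi>' \<psi>' \<circ> inv_into (U \<times> V) (map_prod \<phi> \<psi>)) z"
      by (rule smooth_pt_cong[rotated])
  qed
  then show "\<forall>(U, \<phi>)\<in>prod_atlas A B. \<forall>(V, \<psi>)\<in>prod_atlas A B. smooth_on (\<phi> ` (U \<inter> V)) (\<psi> \<circ> inv_into U \<phi>)"
    unfolding prod_atlas_def by blast
qed

lemma prod_atlas_mem: "(U, \<phi>) \<in> A \<Longrightarrow> (V, \<psi>) \<in> B \<Longrightarrow> (U \<times> V, map_prod \<phi> \<psi>) \<in> prod_atlas A B"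
  unfolding prod_atlas_def by blast

lemma msmooth_at_Pair:
  assumes A: "smooth_atlas A" and B: "smooth_atlas B" and C: "smooth_atlas C"
    and F: "msmooth_at A B F p" and H: "msmooth_at A C H p"
  shows "msmooth_at A (prod_atlas B C) (\<lambda>q. (F q, H q)) p"
proof (rule msmooth_atI)
  show "isCont (\<lambda>q. (F q, H q)) p"
    using msmooth_at_isCont[OF F] msmooth_at_isCont[OF H] by (rule isCont_Pair)
  show "(chart_dom A p, chart_fun A p) \<in> A" "p \<in> chart_dom A p" by (rule chart_at_mem[OF A])+
  show "(chart_dom B (F p) \<times> chart_dom C (H p), map_prod (chart_fun B (F p)) (chart_fun C (H p))) \<in> prod_atlas B C"
    by (intro prod_atlas_mem chart_at_mem B C)
  show "(F p, H p) \<in> chart_dom B (F p) \<times> chart_dom C (H p)" using chart_at_mem(2)[OF B] chart_at_mem(2)[OF C] by blast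
  show "smooth_pt (\<lambda>x. map_prod (chart_fun B (F p)) (chart_fun C (H p)) (F (chart_inv A p x), H (chart_inv A p x))) (chart_fun A p p)"
    using F H by (simp add: msmooth_at_iff A B C smooth_pt_Pair)
qed

lemma msmooth_at_fst:
  assumes A: "smooth_atlas A" and B: "smooth_atlas B"
  shows "msmooth_at (prod_atlas A B) A fst z" "msmooth_at (prod_atlas A B) B snd z"
proof -
  obtain p q where z: "z = (p, q)" by (cases z)
  note a = chart_at_mem[OF A, of p] and b = chart_at_mem[OF B, of q]
  let ?i = "inv_into (chart_dom A p \<times> chart_dom B q) (map_prod (chart_fun A p) (chart_fun B q))"
  have ev: "\<forall>\<^sub>F x in nhds (chart_fun A p p, chart_fun B q q). x \<in> (chart_fun A p ` chart_dom A p) \<times> (chart_fun B q ` chart_dom B q)"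
    using smooth_atlasD(2)[OF A a(1)] smooth_atlasD(2)[OF B b(1)] a b by (intro eventually_nhds_in_open open_Times) auto
  have ev1: "\<forall>\<^sub>F x in nhds (chart_fun A p p, chart_fun B q q). fst x = chart_fun A p (fst (?i x))"
    "\<forall>\<^sub>F x in nhds (chart_fun A p p, chart_fun B q q). snd x = chart_fun B q (snd (?i x))"
    using ev by (rule eventually_mono; auto simp: prod_atlas_inv[OF A B a(1) b(1)] f_inv_into_f)+
  have sm: "smooth_pt (\<lambda>x. chart_fun A p (fst (?i x))) (chart_fun A p p, chart_fun B q q)"
    "smooth_pt (\<lambda>x. chart_fun B q (snd (?i x))) (chart_fun A p p, chart_fun B q q)"
    using smooth_pt_cong[OF ev1(1) smooth_pt_fst] smooth_pt_cong[OF ev1(2) smooth_pt_snd] .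
  show "msmooth_at (prod_atlas A B) A fst z"
    by (rule msmooth_atI[OF _ prod_atlas_mem[OF a(1) b(1)] a(1)]) (use a b sm z in \<open>auto intro!: continuous_intros\<close>)
  show "msmooth_at (prod_atlas A B) B snd z"
    by (rule msmooth_atI[OF _ prod_atlas_mem[OF a(1) b(1)] b(1)]) (use a b sm z in \<open>auto intro!: continuous_intros\<close>)
qed

section \<open>Tangent maps\<close>

lemma chart_inv_eventually:
  fixes A :: "('m::t2_space, 'e::euclidean_space) chart set"
  assumes A: "smooth_atlas A" and P: "\<forall>\<^sub>F q in nhds p. P q"
  shows "\<forall>\<^sub>F x in nhds (chart_fun A p p). P (chart_inv A p x)"
proof -
  have "\<forall>\<^sub>F q in nhds (chart_inv A p (chart_fun A p p)). P q" using A P by simp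
  from eventually_nhds_compose[OF chart_isCont(2)[OF A chart_at_mem[OF A]] this] show ?thesis .
qed

lemma has_derivative_cong_nhds:
  assumes "\<forall>\<^sub>F y in nhds x. f y = g y" "(f has_derivative D) (at x)"
  shows "(g has_derivative D) (at x)"
proof -
  obtain T where "open T" "x \<in> T" "\<And>y. y \<in> T \<Longrightarrow> f y = g y"
    using assms(1) by (auto simp: eventually_nhds)
  from has_derivative_transform_within_open[OF assms(2) this] show ?thesis .
qed

lemma tangent_map_alt:
  "tangent_map A B F p =
     Blinfun (frechet_derivative (\<lambda>x. chart_fun B (F p) (F (chart_inv A p x))) (at (chart_fun A p p)))"
  by (simp add: tangent_map_def Let_def case_prod_beta o_def)

lemma tangent_map_has_derivative:
  assumes "smooth_atlas A" "smooth_atlas B" "msmooth_at A B F p"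
  shows "((\<lambda>x. chart_fun B (F p) (F (chart_inv A p x))) has_derivative blinfun_apply (tangent_map A B F p)) (at (chart_fun A p p))"
proof -
  have d: "((\<lambda>x. chart_fun B (F p) (F (chart_inv A p x))) has_derivative
      frechet_derivative (\<lambda>x. chart_fun B (F p) (F (chart_inv A p x))) (at (chart_fun A p p))) (at (chart_fun A p p))"
    using assms by (auto simp: msmooth_at_iff intro: smooth_pt_has_derivative)
  show ?thesis
    unfolding tangent_map_alt bounded_linear_Blinfun_apply[OF has_derivative_bounded_linear[OF d]] by (rule d)
qed

lemma tangent_map_eqI:
  assumes "((\<lambda>x. chart_fun B (F p) (F (chart_inv A p x))) has_derivative blinfun_apply L) (at (chart_fun A p p))"
  shows "tangent_map A B F p = L"
  unfolding tangent_map_alt frechet_derivative_at[OF assms, symmetric] by (rule blinfun_apply_inverse)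

lemma tangent_map_compose:
  assumes A: "smooth_atlas A" and B: "smooth_atlas B" and C: "smooth_atlas C"
    and H: "msmooth_at B C H (F p)" and F: "msmooth_at A B F p"
  shows "tangent_map A C (\<lambda>q. H (F q)) p = tangent_map B C H (F p) o\<^sub>L tangent_map A B F p"
proof (rule tangent_map_eqI)
  have "((\<lambda>x. chart_fun C (H (F p)) (H (chart_inv B (F p) (chart_fun B (F p) (F (chart_inv A p x)))))) has_derivative
      (\<lambda>v. tangent_map B C H (F p) (tangent_map A B F p v))) (at (chart_fun A p p))"
    using tangent_map_has_derivative[OF A B F] tangent_map_has_derivative[OF B C H] A
    by (intro has_derivative_compose[of "\<lambda>x. chart_fun B (F p) (F (chart_inv A p x))" _ _ UNIV
         "\<lambda>y. chart_fun C (H (F p)) (H (chart_inv B (F p) y))"]) simp_all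
  moreover have "\<forall>\<^sub>F x in nhds (chart_fun A p p). chart_fun C (H (F p)) (H (chart_inv B (F p) (chart_fun B (F p) (F (chart_inv A p x))))) =
      chart_fun C (H (F p)) (H (F (chart_inv A p x)))"
    using chart_inv_eventually[OF A eventually_nhds_compose[OF msmooth_at_isCont[OF F] chart_isCont(3)[OF B chart_at_mem[OF B]]]]
    by (rule eventually_mono) (simp add: smooth_atlasD(5)[OF B chart_at_mem(1)[OF B]])
  ultimately have "((\<lambda>x. chart_fun C (H (F p)) (H (F (chart_inv A p x)))) has_derivative
      (\<lambda>v. tangent_map B C H (F p) (tangent_map A B F p v))) (at (chart_fun A p p))"
    by (rule has_derivative_cong_nhds[rotated])
  moreover have "(\<lambda>v. tangent_map B C H (F p) (tangent_map A B F p v)) =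
      blinfun_apply (tangent_map B C H (F p) o\<^sub>L tangent_map A B F p)" by (simp add: fun_eq_iff)
  ultimately show "((\<lambda>x. chart_fun C (H (F p)) (H (F (chart_inv A p x)))) has_derivative
      blinfun_apply (tangent_map B C H (F p) o\<^sub>L tangent_map A B F p)) (at (chart_fun A p p))" by simp
qed

lemma tangent_map_compose_apply:
  assumes "smooth_atlas A" "smooth_atlas B" "smooth_atlas C" "msmooth_at B C H (F p)" "msmooth_at A B F p"
  shows "tangent_map A C (\<lambda>q. H (F q)) p v = tangent_map B C H (F p) (tangent_map A B F p v)"
  using tangent_map_compose[OF assms] by simp

lemma tangent_map_cong:
  assumes A: "smooth_atlas A" and B: "smooth_atlas B" and e: "\<forall>\<^sub>F q in nhds p. F q = H q" and F: "msmooth_at A B F p"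
  shows "tangent_map A B H p = tangent_map A B F p"
proof (rule tangent_map_eqI)
  have p: "F p = H p" using e by (rule eventually_nhds_x_imp_x)
  have "\<forall>\<^sub>F x in nhds (chart_fun A p p). chart_fun B (F p) (F (chart_inv A p x)) = chart_fun B (H p) (H (chart_inv A p x))"
    using chart_inv_eventually[OF A e] by (rule eventually_mono) (simp add: p)
  from has_derivative_cong_nhds[OF this tangent_map_has_derivative[OF A B F]]
  show "((\<lambda>x. chart_fun B (H p) (H (chart_inv A p x))) has_derivative blinfun_apply (tangent_map A B F p)) (at (chart_fun A p p))" .
qed

lemma tangent_map_id:
  fixes A :: "('m::t2_space, 'e::euclidean_space) chart set"
  assumes A: "smooth_atlas A"
  shows "tangent_map A A (\<lambda>q. q) p = id_blinfun"
proof (rule tangent_map_eqI)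
  have "\<forall>\<^sub>F x in nhds (chart_fun A p p). x = chart_fun A p (chart_inv A p x)"
    using chart_isCont(4)[OF A chart_at_mem[OF A]] by (rule eventually_mono) (simp add: f_inv_into_f)
  from has_derivative_cong_nhds[OF this has_derivative_ident]
  show "((\<lambda>x. chart_fun A p (chart_inv A p x)) has_derivative blinfun_apply id_blinfun) (at (chart_fun A p p))" by simp
qed

lemma tangent_map_const: "tangent_map A B (\<lambda>q. c) p = 0"
  by (rule tangent_map_eqI) (simp add: zero_blinfun.rep_eq)

lemma tangent_map_model_apply:
  assumes "smooth_pt f x"
  shows "tangent_map model_atlas model_atlas f x v = frechet_derivative f (at x) v"
  using frechet_derivative_at[OF tangent_map_has_derivative[of model_atlas model_atlas f x]] assms by simp

lemma tangent_map_to_model: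
  assumes "smooth_atlas A" "msmooth_at A model_atlas f p"
  shows "((\<lambda>x. f (chart_inv A p x)) has_derivative blinfun_apply (tangent_map A model_atlas f p)) (at (chart_fun A p p))"
  using tangent_map_has_derivative[OF assms(1) _ assms(2)] by simp

lemma tangent_map_to_model_apply:
  assumes "smooth_atlas A" "msmooth_at A model_atlas f p"
  shows "tangent_map A model_atlas f p v = frechet_derivative (\<lambda>x. f (chart_inv A p x)) (at (chart_fun A p p)) v"
  using frechet_derivative_at[OF tangent_map_to_model[OF assms]] by simp

text \<open>The chart is the one that identifies the tangent space at \<open>p\<close> with the
  model space, so its own differential there is the identity. Composing with it makes a
  manifold-valued map vector-valued without changing the tangent map at that point.\<close>

lemma tangent_map_chart:
  fixes A :: "('m::t2_space, 'e::euclidean_space) chart set"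
  assumes A: "smooth_atlas A"
  shows "tangent_map A model_atlas (chart_fun A p) p = id_blinfun"
    "tangent_map model_atlas A (chart_inv A p) (chart_fun A p p) = id_blinfun"
proof -
  have "\<forall>\<^sub>F x in nhds (chart_fun A p p). x = chart_fun A p (chart_inv A p x)"
    using chart_isCont(4)[OF A chart_at_mem[OF A]] by (rule eventually_mono) (simp add: f_inv_into_f)
  from has_derivative_cong_nhds[OF this has_derivative_ident]
  show "tangent_map A model_atlas (chart_fun A p) p = id_blinfun"
    "tangent_map model_atlas A (chart_inv A p) (chart_fun A p p) = id_blinfun"
    by (auto intro!: tangent_map_eqI simp: A)
qed

lemma msmooth_at_bilinear:
  assumes "bounded_bilinear B" "smooth_atlas A" "msmooth_at A model_atlas f p" "msmooth_at A model_atlas g p"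
  shows "msmooth_at A model_atlas (\<lambda>q. B (f q) (g q)) p"
    "tangent_map A model_atlas (\<lambda>q. B (f q) (g q)) p v =
       B (f p) (tangent_map A model_atlas g p v) + B (tangent_map A model_atlas f p v) (g p)"
proof -
  show 1: "msmooth_at A model_atlas (\<lambda>q. B (f q) (g q)) p"
    using assms(3,4) unfolding msmooth_at_model_iff[OF assms(2)] by (rule smooth_pt_bilinear[OF assms(1)])
  have "((\<lambda>x. B (f (chart_inv A p x)) (g (chart_inv A p x))) has_derivative
      (\<lambda>v. B (f p) (tangent_map A model_atlas g p v) + B (tangent_map A model_atlas f p v) (g p))) (at (chart_fun A p p))"
    using bounded_bilinear.FDERIV[OF assms(1) tangent_map_to_model[OF assms(2,3)] tangent_map_to_model[OF assms(2,4)]]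
    by (simp add: assms(2))
  from frechet_derivative_at[OF this]
  show "tangent_map A model_atlas (\<lambda>q. B (f q) (g q)) p v =
       B (f p) (tangent_map A model_atlas g p v) + B (tangent_map A model_atlas f p v) (g p)"
    by (simp add: tangent_map_to_model_apply[OF assms(2) 1] fun_eq_iff)
qed

lemmas msmooth_at_mult = msmooth_at_bilinear(1)[OF bounded_bilinear_mult]
  and tangent_map_mult = msmooth_at_bilinear(2)[OF bounded_bilinear_mult]

lemma msmooth_at_add:
  assumes "smooth_atlas A" "msmooth_at A model_atlas f p" "msmooth_at A model_atlas g p"
  shows "msmooth_at A model_atlas (\<lambda>q. f q + g q) p"
    "tangent_map A model_atlas (\<lambda>q. f q + g q) p = tangent_map A model_atlas f p + tangent_map A model_atlas g p"
proof -
  show "msmooth_at A model_atlas (\<lambda>q. f q + g q) p"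
    using assms by (simp add: msmooth_at_model_iff smooth_pt_add)
  show "tangent_map A model_atlas (\<lambda>q. f q + g q) p = tangent_map A model_atlas f p + tangent_map A model_atlas g p"
    using has_derivative_add[OF tangent_map_to_model[OF assms(1,2)] tangent_map_to_model[OF assms(1,3)]]
    by (intro tangent_map_eqI) (simp add: blinfun.add_left[abs_def])
qed

lemma msmooth_at_linear:
  assumes "bounded_linear L" "smooth_atlas A" "msmooth_at A model_atlas f p"
  shows "msmooth_at A model_atlas (\<lambda>q. L (f q)) p"
    "tangent_map A model_atlas (\<lambda>q. L (f q)) p v = L (tangent_map A model_atlas f p v)"
proof -
  show 1: "msmooth_at A model_atlas (\<lambda>q. L (f q)) p"
    using assms(3) unfolding msmooth_at_model_iff[OF assms(2)] by (rule smooth_pt_linear_comp[OF assms(1)])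
  from frechet_derivative_at[OF bounded_linear.has_derivative[OF assms(1) tangent_map_to_model[OF assms(2,3)]]]
  show "tangent_map A model_atlas (\<lambda>q. L (f q)) p v = L (tangent_map A model_atlas f p v)"
    by (simp add: tangent_map_to_model_apply[OF assms(2) 1] fun_eq_iff)
qed

lemma msmooth_at_sum:
  assumes "smooth_atlas A" "\<And>i. i \<in> I \<Longrightarrow> msmooth_at A model_atlas (f i) p"
  shows "msmooth_at A model_atlas (\<lambda>q. \<Sum>i\<in>I. f i q) p \<and>
    tangent_map A model_atlas (\<lambda>q. \<Sum>i\<in>I. f i q) p = (\<Sum>i\<in>I. tangent_map A model_atlas (f i) p)"
  using assms(2)
  by (induction I rule: infinite_finite_induct)
     (simp_all add: msmooth_at_const assms(1) tangent_map_const msmooth_at_add)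

section \<open>Functions of two variables\<close>

text \<open>The chart that \<open>chart_at\<close> picks for the product atlas at
  \<open>(p, q)\<close> need not be the product of the charts picked at \<open>p\<close> and
  \<open>q\<close>; partial derivatives can be read off only from the expression in the
  latter.\<close>

lemma prod_rep_smooth:
  assumes A: "smooth_atlas A" and B: "smooth_atlas B" and C: "smooth_atlas C"
    and F: "msmooth_at (prod_atlas A B) C \<Phi> (p, q)"
  shows "smooth_pt (\<lambda>z. chart_fun C (\<Phi> (p, q)) (\<Phi> (chart_inv A p (fst z), chart_inv B q (snd z)))) (chart_fun A p p, chart_fun B q q)"
proof -
  have "msmooth_at model_atlas (prod_atlas A B) (\<lambda>z. (chart_inv A p (fst z), chart_inv B q (snd z))) (chart_fun A p p, chart_fun B q q)"
    using msmooth_at_compose[OF smooth_atlas_model smooth_atlas_model A, of "chart_inv A p" fst "(chart_fun A p p, chart_fun B q q)"]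
      msmooth_at_compose[OF smooth_atlas_model smooth_atlas_model B, of "chart_inv B q" snd "(chart_fun A p p, chart_fun B q q)"]
      chart_msmooth(2)[OF A chart_at_mem[OF A]] chart_msmooth(2)[OF B chart_at_mem[OF B]]
    by (intro msmooth_at_Pair smooth_atlas_model A B) simp_all
  then have "msmooth_at model_atlas C (\<lambda>z. \<Phi> (chart_inv A p (fst z), chart_inv B q (snd z))) (chart_fun A p p, chart_fun B q q)"
    using F by (intro msmooth_at_compose[OF smooth_atlas_model smooth_atlas_prod[OF A B] C, of \<Phi>]) (simp_all add: A B)
  then show ?thesis by (simp add: msmooth_at_from_model_iff A B C)
qed

text \<open>In coordinates this is the full derivative of \<open>R\<close> in the fixed direction
  \<open>(0, v)\<close>, evaluated along the graph of \<open>s\<close>. The base point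
  \<open>s p'\<close> may move with the parameter, as is needed to trivialise the tangent
  bundle.\<close>

lemma param_derivative_smooth:
  fixes \<Phi> :: "'m::t2_space \<times> 'b::euclidean_space \<Rightarrow> 'c::euclidean_space"
  assumes A: "smooth_atlas A" and F: "msmooth_at (prod_atlas A model_atlas) model_atlas \<Phi> (p, s p)"
    and s: "msmooth_at A model_atlas s p"
  shows "msmooth_at A model_atlas (\<lambda>p'. frechet_derivative (\<lambda>y. \<Phi> (p', y)) (at (s p')) v) p"
proof -
  define R where "R = (\<lambda>z. \<Phi> (chart_inv A p (fst z), snd z))"
  have R: "smooth_pt R (chart_fun A p p, s p)"
    using prod_rep_smooth[OF A smooth_atlas_model smooth_atlas_model F] by (simp add: R_def)
  have sx: "smooth_pt (\<lambda>x. (x, s (chart_inv A p x))) (chart_fun A p p)"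
    using s by (intro smooth_pt_Pair) (simp_all add: msmooth_at_model_iff A)
  have "smooth_pt (\<lambda>x. frechet_derivative R (at (x, s (chart_inv A p x))) (0, v)) (chart_fun A p p)"
    by (rule smooth_pt_compose[OF _ sx, of "\<lambda>z. frechet_derivative R (at z) (0, v)"])
       (use smooth_pt_derivative[OF R] A in simp)
  moreover have "\<forall>\<^sub>F x in nhds (chart_fun A p p). smooth_pt R (x, s (chart_inv A p x))"
    by (rule eventually_nhds_compose[OF smooth_pt_isCont[OF sx]]) (use smooth_pt_eventually[OF R] A in simp)
  then have "\<forall>\<^sub>F x in nhds (chart_fun A p p). frechet_derivative R (at (x, s (chart_inv A p x))) (0, v) =
      frechet_derivative (\<lambda>y. \<Phi> (chart_inv A p x, y)) (at (s (chart_inv A p x))) v"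
    by (rule eventually_mono) (simp add: smooth_pt_partial_snd(2)[symmetric], simp add: R_def)
  ultimately have "smooth_pt (\<lambda>x. frechet_derivative (\<lambda>y. \<Phi> (chart_inv A p x, y)) (at (s (chart_inv A p x))) v) (chart_fun A p p)"
    by (rule smooth_pt_cong[rotated])
  then show ?thesis by (simp add: msmooth_at_model_iff A)
qed

text \<open>The total derivative in product coordinates splits along
  \<open>(a, b) = (a, 0) + (0, b)\<close>. With the multiplication as \<Phi> it is the product rule
  for group-valued maps.\<close>

lemma tangent_map_two_variables:
  assumes M: "smooth_atlas M" and A: "smooth_atlas A" and B: "smooth_atlas B" and C: "smooth_atlas C"
    and \<Phi>: "msmooth_at (prod_atlas A B) C \<Phi> (F m, H m)"
    and F: "msmooth_at M A F m" and H: "msmooth_at M B H m"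
  shows "tangent_map M C (\<lambda>x. \<Phi> (F x, H x)) m v =
    tangent_map A C (\<lambda>a. \<Phi> (a, H m)) (F m) (tangent_map M A F m v) +
    tangent_map B C (\<lambda>b. \<Phi> (F m, b)) (H m) (tangent_map M B H m v)"
proof -
  define R where "R = (\<lambda>z. chart_fun C (\<Phi> (F m, H m)) (\<Phi> (chart_inv A (F m) (fst z), chart_inv B (H m) (snd z))))"
  define a b where "a = chart_fun A (F m) (F m)" and "b = chart_fun B (H m) (H m)"
  have R: "smooth_pt R (a, b)" unfolding R_def a_def b_def by (rule prod_rep_smooth[OF A B C \<Phi>])
  have R1: "((\<lambda>x. R (x, b)) has_derivative (\<lambda>v. frechet_derivative R (at (a, b)) (v, 0))) (at a)"
    and R2: "((\<lambda>x. R (a, x)) has_derivative (\<lambda>v. frechet_derivative R (at (a, b)) (0, v))) (at b)"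
    using R by (rule smooth_pt_partial_fst smooth_pt_partial_snd)+
  have l: "linear (frechet_derivative R (at (a, b)))"
    using R by (intro linear_frechet_derivative smooth_pt_differentiable)
  have bl: "bounded_linear (frechet_derivative R (at (a, b)))"
    using smooth_pt_has_derivative[OF R] by (rule has_derivative_bounded_linear)
  have b1: "tangent_map A C (\<lambda>a. \<Phi> (a, H m)) (F m) = Blinfun (\<lambda>v. frechet_derivative R (at (a, b)) (v, 0))"
    by (rule tangent_map_eqI)
       (use R1 has_derivative_bounded_linear[OF R1] B in \<open>simp add: R_def a_def b_def bounded_linear_Blinfun_apply\<close>)
  have b2: "tangent_map B C (\<lambda>b. \<Phi> (F m, b)) (H m) = Blinfun (\<lambda>v. frechet_derivative R (at (a, b)) (0, v))"
    by (rule tangent_map_eqI)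
       (use R2 has_derivative_bounded_linear[OF R2] A in \<open>simp add: R_def a_def b_def bounded_linear_Blinfun_apply\<close>)
  define f h where "f = (\<lambda>x. chart_fun A (F m) (F (chart_inv M m x)))" and "h = (\<lambda>x. chart_fun B (H m) (H (chart_inv M m x)))"
  have fh: "(f has_derivative blinfun_apply (tangent_map M A F m)) (at (chart_fun M m m))"
    "(h has_derivative blinfun_apply (tangent_map M B H m)) (at (chart_fun M m m))"
    unfolding f_def h_def by (intro tangent_map_has_derivative M A B F H)+
  have "((\<lambda>x. R (f x, h x)) has_derivative
      (\<lambda>v. frechet_derivative R (at (a, b)) (tangent_map M A F m v, tangent_map M B H m v))) (at (chart_fun M m m))"
    by (rule has_derivative_compose[of "\<lambda>x. (f x, h x)" _ _ UNIV R, OF has_derivative_Pair[OF fh]])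
       (use smooth_pt_has_derivative[OF R] M in \<open>simp add: f_def h_def a_def b_def\<close>)
  moreover have "\<forall>\<^sub>F x in nhds (chart_fun M m m). R (f x, h x) = chart_fun C (\<Phi> (F m, H m)) (\<Phi> (F (chart_inv M m x), H (chart_inv M m x)))"
  proof -
    have "\<forall>\<^sub>F x in nhds m. F x \<in> chart_dom A (F m) \<and> H x \<in> chart_dom B (H m)"
      using eventually_nhds_compose[OF msmooth_at_isCont[OF F] chart_isCont(3)[OF A chart_at_mem[OF A]]]
        eventually_nhds_compose[OF msmooth_at_isCont[OF H] chart_isCont(3)[OF B chart_at_mem[OF B]]]
      by (rule eventually_conj)
    from chart_inv_eventually[OF M this] show ?thesis
      by (rule eventually_mono)
        (simp add: R_def f_def h_def smooth_atlasD(5)[OF A chart_at_mem(1)[OF A]] smooth_atlasD(5)[OF B chart_at_mem(1)[OF B]])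
  qed
  ultimately have d: "((\<lambda>x. chart_fun C (\<Phi> (F m, H m)) (\<Phi> (F (chart_inv M m x), H (chart_inv M m x)))) has_derivative
      (\<lambda>v. frechet_derivative R (at (a, b)) (tangent_map M A F m v, tangent_map M B H m v))) (at (chart_fun M m m))"
    by (rule has_derivative_cong_nhds[rotated])
  have "tangent_map M C (\<lambda>x. \<Phi> (F x, H x)) m =
      Blinfun (\<lambda>v. frechet_derivative R (at (a, b)) (tangent_map M A F m v, tangent_map M B H m v))"
    by (rule tangent_map_eqI) (use d has_derivative_bounded_linear[OF d] in \<open>simp add: bounded_linear_Blinfun_apply\<close>)
  then have "tangent_map M C (\<lambda>x. \<Phi> (F x, H x)) m v =
      frechet_derivative R (at (a, b)) (tangent_map M A F m v, tangent_map M B H m v)"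
    by (simp add: bounded_linear_Blinfun_apply[OF has_derivative_bounded_linear[OF d]])
  also have "\<dots> = frechet_derivative R (at (a, b)) ((tangent_map M A F m v, 0) + (0, tangent_map M B H m v))" by simp
  also have "\<dots> = frechet_derivative R (at (a, b)) (tangent_map M A F m v, 0) + frechet_derivative R (at (a, b)) (0, tangent_map M B H m v)"
    by (rule linear_add[OF l])
  finally show ?thesis
    by (simp add: b1 b2 bounded_linear_Blinfun_apply[OF has_derivative_bounded_linear[OF R1]]
       bounded_linear_Blinfun_apply[OF has_derivative_bounded_linear[OF R2]])
qed

text \<open>Read in fixed charts, the derivative vanishes on a whole ball and not just at its
  centre, so the map is constant on that ball; connectedness does the rest.\<close>

lemma tangent_map_zero_constant:
  assumes A: "smooth_atlas A" and B: "smooth_atlas B" and S: "open S" "connected S"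
    and F: "\<And>p. p \<in> S \<Longrightarrow> msmooth_at A B F p" "\<And>p. p \<in> S \<Longrightarrow> tangent_map A B F p = 0"
    and pq: "p \<in> S" "q \<in> S"
  shows "F p = F q"
proof (rule connected_local_const[OF S(2) pq], intro ballI)
  fix p assume p: "p \<in> S"
  define \<phi> \<psi> where "\<phi> = chart_fun A p" and "\<psi> = chart_fun B (F p)"
  note a = chart_at_mem[OF A, of p] and b = chart_at_mem[OF B, of "F p"]
  have "\<forall>\<^sub>F q in nhds p. q \<in> S \<and> F q \<in> chart_dom B (F p)"
    using eventually_nhds_in_open[OF S(1) p]
      eventually_nhds_compose[OF msmooth_at_isCont[OF F(1)[OF p]] chart_isCont(3)[OF B b]]
    by (rule eventually_conj)
  from eventually_conj[OF chart_isCont(4)[OF A a] chart_inv_eventually[OF A this]]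
  obtain r where r: "r > 0" "\<And>x. x \<in> ball (\<phi> p) r \<Longrightarrow> x \<in> \<phi> ` chart_dom A p \<and> chart_inv A p x \<in> S \<and>
      F (chart_inv A p x) \<in> chart_dom B (F p)"
    unfolding eventually_nhds_metric \<phi>_def by (auto simp: dist_commute)
  define g where "g = (\<lambda>x. \<psi> (F (chart_inv A p x)))"
  \<comment> \<open>Away from the centre the differential of \<open>F\<close> may refer to other
    reference charts; the chain rule absorbs the difference, as zero composed with anything is
    zero.\<close>
  have g0: "(g has_derivative (\<lambda>h. 0)) (at x)" if xb: "x \<in> ball (\<phi> p) r" for x
  proof -
    obtain q where q: "q \<in> chart_dom A p" "x = \<phi> q" using r(2)[OF xb] by blast
    have qi: "chart_inv A p x = q" using q smooth_atlasD(5)[OF A a(1)] by (simp add: \<phi>_def)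
    have S: "q \<in> S" "F q \<in> chart_dom B (F p)" using r(2)[OF xb] qi by auto
    have 1: "msmooth_at model_atlas A (chart_inv A p) x"
      using chart_msmooth(2)[OF A a(1) q(1)] q by (simp add: \<phi>_def)
    have 2: "msmooth_at model_atlas B (\<lambda>x. F (chart_inv A p x)) x"
      by (rule msmooth_at_compose[OF smooth_atlas_model A B _ 1]) (use F(1) S qi in simp)
    have 3: "msmooth_at B model_atlas \<psi> (F (chart_inv A p x))"
      using chart_msmooth(1)[OF B b(1)] S qi by (simp add: \<psi>_def)
    have 4: "msmooth_at model_atlas model_atlas g x"
      unfolding g_def by (rule msmooth_at_compose[OF smooth_atlas_model B smooth_atlas_model 3 2])
    have "tangent_map model_atlas B (\<lambda>x. F (chart_inv A p x)) x = 0"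
      using tangent_map_compose[OF smooth_atlas_model A B _ 1, of F] F S qi by (simp add: blinfun_eqI)
    then have "tangent_map model_atlas model_atlas g x = 0"
      unfolding g_def using tangent_map_compose[OF smooth_atlas_model B smooth_atlas_model 3 2] by (simp add: blinfun_eqI)
    then show ?thesis using tangent_map_to_model[OF smooth_atlas_model 4] by (simp add: zero_blinfun.rep_eq)
  qed
  have "g x = g (\<phi> p)" if "x \<in> ball (\<phi> p) r" for x
    using has_derivative_zero_unique[OF convex_ball has_derivative_at_withinI[OF g0] that, of "\<phi> p"] r(1) by simp
  then have e: "F (chart_inv A p x) = F p" if "x \<in> ball (\<phi> p) r" for x
    using r(2)[OF that] r(2)[of "\<phi> p"] smooth_atlasD(5)[OF B b(1)] that r(1)
    unfolding g_def \<phi>_def \<psi>_def using A by (metis centre_in_ball chart_inv_self)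
  have "\<forall>\<^sub>F q in nhds p. q \<in> chart_dom A p \<and> \<phi> q \<in> ball (\<phi> p) r"
    using chart_isCont(3)[OF A a] eventually_nhds_compose[OF chart_isCont(1)[OF A a] eventually_nhds_in_open[OF open_ball]] r(1)
    unfolding \<phi>_def by (simp add: eventually_conj_iff)
  then have "\<forall>\<^sub>F q in nhds p. F p = F q"
    by (rule eventually_mono) (metis e \<phi>_def smooth_atlasD(5)[OF A a(1)])
  then show "\<forall>\<^sub>F q in at p within S. F p = F q"
    by (simp add: eventually_at_topological eventually_nhds) blast
qed

section \<open>Global functions and point derivations\<close>

lemma C_inf_iff: "smooth_atlas A \<Longrightarrow> f \<in> C_inf A \<longleftrightarrow> (\<forall>q. msmooth_at A model_atlas f q)"
  by (simp add: C_inf_def smooth_map_iff)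

text \<open>A Euclidean bump transported by the chart and extended by zero. \<open>K\<close> is
  compact as a continuous image of a closed ball, hence closed because the manifold is Hausdorff,
  and so the extension is smooth also at points outside the chart domain.\<close>

lemma manifold_bump:
  assumes A: "smooth_atlas A" and W: "open W" "p \<in> W"
  obtains \<eta> K where "\<And>q. msmooth_at A model_atlas \<eta> q" "\<forall>\<^sub>F q in nhds p. \<eta> q = (1::real)"
    "closed K" "K \<subseteq> W" "\<And>q. q \<notin> K \<Longrightarrow> \<eta> q = 0"
proof -
  note a = chart_at_mem[OF A, of p]
  note d = smooth_atlasD[OF A a(1)]
  define \<phi> where "\<phi> = chart_fun A p"
  have "\<forall>\<^sub>F x in nhds (\<phi> p). x \<in> \<phi> ` chart_dom A p \<and> chart_inv A p x \<in> W"
    using eventually_conj[OF chart_isCont(4)[OF A a] chart_inv_eventually[OF A eventually_nhds_in_open[OF W]]] by (simp add: \<phi>_def)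
  then obtain r0 where r0: "r0 > 0" "\<And>x. dist x (\<phi> p) < r0 \<Longrightarrow> x \<in> \<phi> ` chart_dom A p \<and> chart_inv A p x \<in> W"
    unfolding eventually_nhds_metric by blast
  \<comment> \<open>Half the radius, so that the closed ball also lies in the open ball provided by
    \<open>r0\<close>.\<close>
  define r where "r = r0 / 2"
  have r: "r > 0" "cball (\<phi> p) r \<subseteq> \<phi> ` chart_dom A p" "\<And>x. x \<in> cball (\<phi> p) r \<Longrightarrow> chart_inv A p x \<in> W"
    using r0 by (auto simp: r_def dist_commute)
  obtain b :: "_ \<Rightarrow> real" where b: "\<And>x. smooth_pt b x" "\<And>x. dist (\<phi> p) x < r / 2 \<Longrightarrow> b x = 1" "\<And>x. dist (\<phi> p) x \<ge> r \<Longrightarrow> b x = 0"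
    using euclidean_bump[OF r(1)] by metis
  define \<eta> where "\<eta> = (\<lambda>q. if q \<in> chart_dom A p then b (\<phi> q) else 0)"
  define K where "K = chart_inv A p ` cball (\<phi> p) r"
  have "compact K" unfolding K_def
    using d(4) r(2) by (intro compact_continuous_image compact_cball) (auto simp: \<phi>_def intro: continuous_on_subset)
  then have K: "closed K" by (rule compact_imp_closed)
  have K0: "\<eta> q = 0" if "q \<notin> K" for q
  proof (cases "q \<in> chart_dom A p")
    case True
    then have "\<phi> q \<notin> cball (\<phi> p) r" using that d(5) unfolding K_def \<phi>_def by (metis imageI)
    with b(3) True show ?thesis by (simp add: \<eta>_def)
  qed (simp add: \<eta>_def)
  have KU: "K \<subseteq> chart_dom A p" using r(2) unfolding K_def \<phi>_def by (auto intro: inv_into_into)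
  have "msmooth_at A model_atlas \<eta> q" for q
  proof (cases "q \<in> chart_dom A p")
    case True
    have "msmooth_at A model_atlas (\<lambda>q. b (\<phi> q)) q"
      by (rule msmooth_at_compose[OF A smooth_atlas_model smooth_atlas_model, of b])
         (use b(1) chart_msmooth(1)[OF A a(1) True] in \<open>simp_all add: \<phi>_def\<close>)
    moreover have "\<forall>\<^sub>F q in nhds q. b (\<phi> q) = \<eta> q"
      using chart_isCont(3)[OF A a(1) True] by (rule eventually_mono) (simp add: \<eta>_def)
    ultimately show ?thesis by (rule msmooth_at_cong[OF A smooth_atlas_model, rotated])
  next
    case False
    then have "\<forall>\<^sub>F q in nhds q. q \<in> - K" using K KU by (intro eventually_nhds_in_open) auto
    then have "\<forall>\<^sub>F q in nhds q. 0 = \<eta> q" by (rule eventually_mono) (simp add: K0)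
    from msmooth_at_cong[OF A smooth_atlas_model this msmooth_at_const[OF A smooth_atlas_model]] show ?thesis .
  qed
  moreover have "\<forall>\<^sub>F q in nhds p. \<eta> q = 1"
  proof -
    have "\<forall>\<^sub>F q in nhds p. \<phi> q \<in> ball (\<phi> p) (r / 2)"
      unfolding \<phi>_def by (rule eventually_nhds_compose[OF chart_isCont(1)[OF A a]])
        (use r(1) in \<open>auto intro!: eventually_nhds_in_open simp del: mem_ball\<close>)
    with chart_isCont(3)[OF A a] have "\<forall>\<^sub>F q in nhds p. q \<in> chart_dom A p \<and> \<phi> q \<in> ball (\<phi> p) (r / 2)"
      by (rule eventually_conj)
    then show ?thesis by (rule eventually_mono) (simp add: \<eta>_def b(2))
  qed
  moreover have "K \<subseteq> W" using r(3) by (auto simp: K_def)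
  ultimately show ?thesis using that K K0 by blast
qed

lemma bump_extend:
  assumes A: "smooth_atlas A" and \<eta>: "\<And>q. msmooth_at A model_atlas \<eta> q" "closed K" "K \<subseteq> W" "\<And>q. q \<notin> K \<Longrightarrow> \<eta> q = (0::real)"
    and f: "\<And>q. q \<in> W \<Longrightarrow> msmooth_at A model_atlas f q"
  shows "(\<lambda>q. \<eta> q * f q) \<in> C_inf A"
  unfolding C_inf_iff[OF A]
proof
  fix q
  show "msmooth_at A model_atlas (\<lambda>q. \<eta> q * f q) q"
  proof (cases "q \<in> W")
    case True
    then show ?thesis by (intro msmooth_at_mult A \<eta>(1) f)
  next
    case False
    then have "\<forall>\<^sub>F q in nhds q. q \<in> - K" using \<eta> by (intro eventually_nhds_in_open) auto
    then have "\<forall>\<^sub>F q in nhds q. 0 = \<eta> q * f q" by (rule eventually_mono) (simp add: \<eta>)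
    from msmooth_at_cong[OF A smooth_atlas_model this msmooth_at_const[OF A smooth_atlas_model]] show ?thesis .
  qed
qed

text \<open>A tangent vector as it acts on global smooth functions. Locality is not demanded: it
  follows from the product rule with cut-off functions.\<close>

definition derivation_at :: "('m::t2_space, 'e::euclidean_space) chart set \<Rightarrow> 'm \<Rightarrow> (('m \<Rightarrow> real) \<Rightarrow> real) \<Rightarrow> bool" where
  "derivation_at A p W \<longleftrightarrow> (\<forall>f\<in>C_inf A. \<forall>g\<in>C_inf A. \<forall>r.
     W (\<lambda>q. r * f q + g q) = r * W f + W g \<and> W (\<lambda>q. f q * g q) = f p * W g + g p * W f)"

text \<open>Near \<open>p\<close>, Hadamard's lemma writes \<open>f - f p\<close> as a sum of
  products of a coordinate vanishing at \<open>p\<close> with a smooth function. A cut-off makes all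
  factors global, and the product rule then evaluates any derivation on \<open>f\<close> from its
  values on the cut-off coordinates.\<close>

lemma coordinate_functions:
  fixes A :: "('m::t2_space, 'e::euclidean_space) chart set"
  assumes A: "smooth_atlas A"
  obtains u :: "'e \<Rightarrow> 'm \<Rightarrow> real" where
    "\<And>i. u i \<in> C_inf A"
    "\<And>i. \<forall>\<^sub>F q in nhds p. u i q = (chart_fun A p q - chart_fun A p p) \<bullet> i"
    "\<And>W f. derivation_at A p W \<Longrightarrow> f \<in> C_inf A \<Longrightarrow> W f = (\<Sum>i\<in>Basis. differential A f p i * W (u i))"
proof -
  note a = chart_at_mem[OF A, of p]
  note d = smooth_atlasD[OF A a(1)]
  define \<phi> where "\<phi> = chart_fun A p"
  obtain r where r: "r > 0" "ball (\<phi> p) r \<subseteq> \<phi> ` chart_dom A p"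
    using d(2) a(2) unfolding \<phi>_def open_contains_ball by blast
  define O' where "O' = chart_dom A p \<inter> \<phi> -` ball (\<phi> p) r"
  have O': "open O'" "p \<in> O'"
    using continuous_open_preimage[OF d(3,1) open_ball] a r by (auto simp: O'_def \<phi>_def)
  obtain \<eta> K where \<eta>: "\<And>q. msmooth_at A model_atlas \<eta> q" "\<forall>\<^sub>F q in nhds p. \<eta> q = (1::real)"
    "closed K" "K \<subseteq> O'" "\<And>q. q \<notin> K \<Longrightarrow> \<eta> q = 0"
    using manifold_bump[OF A O'] by metis
  have \<eta>p: "\<eta> p = 1" using \<eta>(2) by (rule eventually_nhds_x_imp_x)
  define u where "u = (\<lambda>i q. \<eta> q * ((\<phi> q - \<phi> p) \<bullet> i))"
  have \<phi>s: "msmooth_at A model_atlas (\<lambda>q. h (\<phi> q)) q" if "q \<in> O'" "smooth_pt h (\<phi> q)" for q and h :: "'e \<Rightarrow> real"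
    using that chart_msmooth(1)[OF A a(1), of q]
    by (intro msmooth_at_compose[OF A smooth_atlas_model smooth_atlas_model, of h \<phi>]) (auto simp: O'_def \<phi>_def)
  have u: "u i \<in> C_inf A" for i
    unfolding u_def
    by (rule bump_extend[OF A \<eta>(1,3,4,5)])
       (auto intro!: \<phi>s[of _ "\<lambda>x. (x - \<phi> p) \<bullet> i"] smooth_pt_inner smooth_pt_diff)
  moreover have "\<forall>\<^sub>F q in nhds p. u i q = (\<phi> q - \<phi> p) \<bullet> i" for i
    using \<eta>(2) by (rule eventually_mono) (simp add: u_def)
  moreover have "W f = (\<Sum>i\<in>Basis. differential A f p i * W (u i))" if W: "derivation_at A p W" and f: "f \<in> C_inf A" for W f
  proof -
    have W1: "W (\<lambda>q. r * f q + g q) = r * W f + W g" and W2: "W (\<lambda>q. f q * g q) = f p * W g + g p * W f"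
      if "f \<in> C_inf A" "g \<in> C_inf A" for f g r
      using W that unfolding derivation_at_def by blast+
    have c: "(\<lambda>q. c) \<in> C_inf A" for c :: real by (simp add: C_inf_iff A msmooth_at_const)
    have Wc: "W (\<lambda>q. c) = 0" for c
    proof -
      have "W (\<lambda>q. 1) = 0" using W2[OF c[of 1] c[of 1]] by simp
      moreover have "W (\<lambda>q. 0) = 0" using W1[OF c[of 0] c[of 0], of 1] by simp
      ultimately show ?thesis using W1[OF c[of 1] c[of 0], of c] by simp
    qed
    have Csum: "(\<lambda>q. \<Sum>i\<in>I. h i q) \<in> C_inf A \<and> W (\<lambda>q. \<Sum>i\<in>I. h i q) = (\<Sum>i\<in>I. W (h i))"
      if "finite I" "\<And>i. i \<in> I \<Longrightarrow> h i \<in> C_inf A" for I :: "'e set" and h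
      using that
    proof (induction I)
      case (insert i I)
      have "W (\<lambda>q. 1 * h i q + (\<Sum>i\<in>I. h i q)) = 1 * W (h i) + W (\<lambda>q. \<Sum>i\<in>I. h i q)"
        using insert by (intro W1) auto
      moreover have "(\<lambda>q. h i q + (\<Sum>i\<in>I. h i q)) \<in> C_inf A"
        using insert by (auto simp: C_inf_iff A intro!: msmooth_at_add(1))
      ultimately show ?case using insert by simp
    qed (simp add: Wc c)
    define F where "F = (\<lambda>x. f (chart_inv A p x))"
    have fs: "msmooth_at A model_atlas f q" for q using f by (simp add: C_inf_iff A)
    have Fs: "smooth_pt F x" if x: "x \<in> ball (\<phi> p) r" for x
    proof -
      obtain q where q: "q \<in> chart_dom A p" "x = \<phi> q" using x r by blast
      then have "msmooth_at model_atlas A (chart_inv A p) x"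
        using chart_msmooth(2)[OF A a(1) q(1)] by (simp add: \<phi>_def)
      from msmooth_at_compose[OF smooth_atlas_model A smooth_atlas_model fs this] show ?thesis by (simp add: F_def)
    qed
    obtain g where g: "\<And>i x. x \<in> ball (\<phi> p) r \<Longrightarrow> smooth_pt (g i) x"
      "\<And>i. g i (\<phi> p) = frechet_derivative F (at (\<phi> p)) i"
      "\<And>x. x \<in> ball (\<phi> p) r \<Longrightarrow> F x = F (\<phi> p) + (\<Sum>i\<in>Basis. ((x - \<phi> p) \<bullet> i) * g i x)"
      using hadamard[OF Fs r(1)] by blast
    define G where "G = (\<lambda>i q. \<eta> q * g i (\<phi> q))"
    have G: "G i \<in> C_inf A" for i
      unfolding G_def by (rule bump_extend[OF A \<eta>(1,3,4,5)]) (auto intro!: \<phi>s g simp: O'_def)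
    define f0 where "f0 = (\<lambda>q. f q - f p)"
    have f0: "f0 \<in> C_inf A"
    proof -
      have "(\<lambda>q. f q + (- f p)) \<in> C_inf A"
        unfolding C_inf_iff[OF A] by (intro allI msmooth_at_add(1) A fs msmooth_at_const smooth_atlas_model)
      then show ?thesis by (simp add: f0_def)
    qed
    have "W (\<lambda>q. (\<lambda>q. 1) q * f q + (\<lambda>q. - f p) q) = W f"
      using W1[OF f c[of "- f p"], of 1] by (simp add: Wc)
    then have Wf0: "W f0 = W f" by (simp add: f0_def)
    \<comment> \<open>The cut-off appears squared because each summand has two factors to be made
      global, the coordinate and the Hadamard coefficient.\<close>
    have e: "\<eta> q * \<eta> q * f0 q = (\<Sum>i\<in>Basis. u i q * G i q)" for q
    proof (cases "q \<in> K")
      case True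
      then have q: "\<phi> q \<in> ball (\<phi> p) r" "q \<in> chart_dom A p" using \<eta>(4) by (auto simp: O'_def)
      have "f q - f p = (\<Sum>i\<in>Basis. ((\<phi> q - \<phi> p) \<bullet> i) * g i (\<phi> q))"
        using g(3)[OF q(1)] d(5)[OF q(2)] d(5)[OF a(2)] by (simp add: F_def \<phi>_def)
      then show ?thesis by (simp add: f0_def u_def G_def sum_distrib_left mult_ac)
    qed (simp add: \<eta>(5) u_def)
    have uG: "(\<lambda>q. u i q * G i q) \<in> C_inf A" for i
      using u G by (auto simp: C_inf_iff A intro!: msmooth_at_mult)
    have \<eta>2: "(\<lambda>q. 1 - \<eta> q * \<eta> q) \<in> C_inf A"
    proof -
      have "(\<lambda>q. 1 + (- \<eta> q) * \<eta> q) \<in> C_inf A"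
        unfolding C_inf_iff[OF A]
        by (intro allI msmooth_at_add(1) msmooth_at_mult msmooth_at_linear(1)[OF bounded_linear_minus[OF bounded_linear_ident]]
          A \<eta>(1) msmooth_at_const smooth_atlas_model)
      then show ?thesis by simp
    qed
    \<comment> \<open>The remainder is a product of two functions that both vanish at
      \<open>p\<close>, so every derivation kills it.\<close>
    have "f0 = (\<lambda>q. 1 * (\<Sum>i\<in>Basis. u i q * G i q) + (1 - \<eta> q * \<eta> q) * f0 q)"
      unfolding e[symmetric] by (simp add: algebra_simps fun_eq_iff)
    then have "W f0 = W (\<lambda>q. 1 * (\<Sum>i\<in>Basis. u i q * G i q) + (1 - \<eta> q * \<eta> q) * f0 q)" by simp
    also have "\<dots> = 1 * W (\<lambda>q. \<Sum>i\<in>Basis. u i q * G i q) + W (\<lambda>q. (1 - \<eta> q * \<eta> q) * f0 q)"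
    proof (rule W1)
      show "(\<lambda>q. \<Sum>i\<in>Basis. u i q * G i q) \<in> C_inf A" using Csum[OF finite_Basis uG] by simp
      show "(\<lambda>q. (1 - \<eta> q * \<eta> q) * f0 q) \<in> C_inf A"
        using \<eta>2 f0 by (auto simp: C_inf_iff A intro!: msmooth_at_mult)
    qed
    also have "W (\<lambda>q. (1 - \<eta> q * \<eta> q) * f0 q) = 0"
      using W2[OF \<eta>2 f0] by (simp add: \<eta>p f0_def)
    also have "W (\<lambda>q. \<Sum>i\<in>Basis. u i q * G i q) = (\<Sum>i\<in>Basis. W (\<lambda>q. u i q * G i q))"
      using Csum[OF finite_Basis uG] by simp
    also have "\<dots> = (\<Sum>i\<in>Basis. differential A f p i * W (u i))"
    proof (rule sum.cong[OF refl])
      fix i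
      have "differential A f p i = g i (\<phi> p)"
        using tangent_map_to_model_apply[OF A fs] g(2) by (simp add: F_def \<phi>_def)
      then show "W (\<lambda>q. u i q * G i q) = differential A f p i * W (u i)"
        using W2[OF u G] by (simp add: u_def G_def \<eta>p)
    qed
    finally show ?thesis using Wf0 by simp
  qed
  ultimately show ?thesis using that unfolding \<phi>_def by blast
qed

section \<open>Lie groups\<close>

lemma frechet_derivative_cong_nhds:
  assumes "\<forall>\<^sub>F y in nhds x. f y = g y"
  shows "frechet_derivative f (at x) = frechet_derivative g (at x)"
proof -
  have "\<forall>\<^sub>F y in nhds x. g y = f y" using assms by (rule eventually_mono) simp
  with assms have "(f has_derivative D) (at x) \<longleftrightarrow> (g has_derivative D) (at x)" for D
    using has_derivative_cong_nhds by blast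
  then show ?thesis unfolding frechet_derivative_def by simp
qed

section \<open>Tangent vectors as derivations\<close>

text \<open>The first claim holds on a neighbourhood, in the fixed chart at \<open>p\<close>, and
  serves the smoothness of the Poisson tensor. At \<open>p\<close> itself that chart is the
  reference chart, so the second claim reads off coordinates.\<close>

lemma differential_coordinate:
  fixes A :: "('m::t2_space, 'e::euclidean_space) chart set"
  assumes A: "smooth_atlas A" and u: "\<forall>\<^sub>F q in nhds p. u q = (chart_fun A p q - chart_fun A p p) \<bullet> i"
  shows "\<forall>\<^sub>F q in nhds p. \<forall>v. differential A u q v = tangent_map A model_atlas (chart_fun A p) q v \<bullet> i"
    "differential A u p v = v \<bullet> i"
proof -
  obtain T where T: "open T" "p \<in> T" "\<And>q. q \<in> T \<Longrightarrow> u q = (chart_fun A p q - chart_fun A p p) \<bullet> i"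
    using u by (auto simp: eventually_nhds)
  have *: "differential A u q v = tangent_map A model_atlas (chart_fun A p) q v \<bullet> i"
    if q: "q \<in> T" "q \<in> chart_dom A p" for q v
  proof -
    note c = chart_msmooth(1)[OF A chart_at_mem(1)[OF A] q(2)]
    have s: "msmooth_at A model_atlas (\<lambda>q. chart_fun A p q + - chart_fun A p p) q"
      and d: "tangent_map A model_atlas (\<lambda>q. chart_fun A p q + - chart_fun A p p) q = tangent_map A model_atlas (chart_fun A p) q"
      using msmooth_at_add[OF A c msmooth_at_const[OF A smooth_atlas_model, of "- chart_fun A p p"]]
      unfolding tangent_map_const add_0_right by blast+
    note l = msmooth_at_linear[OF bounded_linear_inner_left A s, of i]
    have "\<forall>\<^sub>F q in nhds q. (chart_fun A p q + - chart_fun A p p) \<bullet> i = u q"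
      using eventually_nhds_in_open[OF T(1) q(1)] by (rule eventually_mono) (simp add: T(3))
    from tangent_map_cong[OF A smooth_atlas_model this l(1)] l(2)[of v] d show ?thesis by simp
  qed
  show "\<forall>\<^sub>F q in nhds p. \<forall>v. differential A u q v = tangent_map A model_atlas (chart_fun A p) q v \<bullet> i"
    using eventually_conj[OF eventually_nhds_in_open[OF T(1,2)] chart_isCont(3)[OF A chart_at_mem[OF A]]]
    by (rule eventually_mono) (use * in blast)
  show "differential A u p v = v \<bullet> i"
    using *[OF T(2) chart_at_mem(2)[OF A]] tangent_map_chart(1)[OF A] by simp
qed

lemma differentials_separate:
  fixes A :: "('m::t2_space, 'e::euclidean_space) chart set"
  assumes A: "smooth_atlas A" and e: "\<And>f. f \<in> C_inf A \<Longrightarrow> differential A f p v = differential A f p w"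
  shows "v = w"
proof -
  obtain u :: "'e \<Rightarrow> 'm \<Rightarrow> real" where u: "\<And>i. u i \<in> C_inf A"
    "\<And>i. \<forall>\<^sub>F q in nhds p. u i q = (chart_fun A p q - chart_fun A p p) \<bullet> i"
    using coordinate_functions[OF A, of p] by metis
  show ?thesis
    by (rule euclidean_eqI) (use e[OF u(1)] differential_coordinate(2)[OF A u(2)] in simp)
qed

text \<open>Gives existence for the definite description in \<open>lie_bracket\<close>;
  \<open>differentials_separate\<close> gives uniqueness.\<close>

lemma derivation_is_vector:
  assumes A: "smooth_atlas A" and W: "derivation_at A p W"
  obtains z where "\<And>f. f \<in> C_inf A \<Longrightarrow> W f = differential A f p z"
proof -
  obtain u where u: "\<And>f. f \<in> C_inf A \<Longrightarrow> W f = (\<Sum>i\<in>Basis. differential A f p i * W (u i))"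
    using coordinate_functions[OF A, of p] W by metis
  have "W f = differential A f p (\<Sum>i\<in>Basis. W (u i) *\<^sub>R i)" if "f \<in> C_inf A" for f
    using u[OF that] by (simp add: blinfun.sum_right blinfun.scaleR_right mult.commute)
  then show ?thesis by (rule that)
qed

section \<open>Group operations as smooth maps\<close>

locale lie_grp =
  fixes G :: "('g::{t2_space,second_countable_topology}, 'e::euclidean_space, 'z) lie_data_scheme"
  assumes lie: "lie_group G"
begin

abbreviation atl where "atl \<equiv> atlas G"
abbreviation mul (infixl "\<odot>" 70) where "g \<odot> h \<equiv> g \<otimes>\<^bsub>G\<^esub> h"
abbreviation ginv where "ginv g \<equiv> inv\<^bsub>G\<^esub> g"
abbreviation eG where "eG \<equiv> \<one>\<^bsub>G\<^esub>"
abbreviation LF where "LF x \<equiv> field_deriv atl (left_field G x)"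
abbreviation br where "br \<equiv> lie_bracket G"

sublocale group G using lie by (simp add: lie_group_def)

lemma carrier_UNIV [simp]: "carrier G = UNIV" using lie by (simp add: lie_group_def)

lemma smooth_atl [simp, intro]: "smooth_atlas atl" using lie by (simp add: lie_group_def)

lemma smooth_prod_atl [simp, intro]: "smooth_atlas (prod_atlas atl atl)" "smooth_atlas (prod_atlas atl model_atlas)"
  by (simp_all add: smooth_atlas_prod)

lemma mult_ginv_cancel [simp]: "ginv g \<odot> (g \<odot> h) = h" "g \<odot> (ginv g \<odot> h) = h"
  by (simp_all add: m_assoc[symmetric])

lemma ginv_mult: "ginv (g \<odot> h) = ginv h \<odot> ginv g"
  by (simp add: inv_mult_group)

lemma msmooth_mul:
  assumes "smooth_atlas M" "msmooth_at M atl F p" "msmooth_at M atl H p"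
  shows "msmooth_at M atl (\<lambda>q. F q \<odot> H q) p"
proof -
  have "smooth_map (prod_atlas atl atl) atl (\<lambda>(g, h). g \<odot> h)" using lie by (simp add: lie_group_def)
  then have "msmooth_at (prod_atlas atl atl) atl (\<lambda>(g, h). g \<odot> h) (F p, H p)" by (simp add: smooth_map_iff)
  from msmooth_at_compose[OF assms(1) _ _ this msmooth_at_Pair[OF assms(1) _ _ assms(2,3)]]
  show ?thesis by simp
qed

lemma msmooth_ginv:
  assumes "smooth_atlas M" "msmooth_at M atl F p"
  shows "msmooth_at M atl (\<lambda>q. ginv (F q)) p"
proof -
  have "smooth_map atl atl (\<lambda>g. ginv g)" using lie by (simp add: lie_group_def)
  then have "msmooth_at atl atl (\<lambda>g. ginv g) (F p)" by (simp add: smooth_map_iff)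
  from msmooth_at_compose[OF assms(1) _ _ this assms(2)] show ?thesis by simp
qed

lemma msmooth_id: "msmooth_at atl atl (\<lambda>g. g) p" by (simp add: msmooth_at_id)

lemma msmooth_const: "smooth_atlas M \<Longrightarrow> msmooth_at M atl (\<lambda>q. c) p" by (simp add: msmooth_at_const)

lemma msmooth_proj: "msmooth_at (prod_atlas atl atl) atl fst z" "msmooth_at (prod_atlas atl atl) atl snd z"
  by (simp_all add: msmooth_at_fst)

lemmas group_smooth = msmooth_mul msmooth_ginv msmooth_id msmooth_const msmooth_proj smooth_atl smooth_prod_atl

lemma C_infD: "f \<in> C_inf atl \<Longrightarrow> msmooth_at atl model_atlas f p"
  by (simp add: C_inf_iff)

lemma C_inf_comp:
  assumes "f \<in> C_inf atl" "smooth_atlas M" "msmooth_at M atl F p"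
  shows "msmooth_at M model_atlas (\<lambda>q. f (F q)) p"
  using msmooth_at_compose[OF assms(2) _ _ C_infD[OF assms(1)] assms(3)] by simp

lemma C_inf_translate:
  assumes "f \<in> C_inf atl"
  shows "(\<lambda>h. f (g \<odot> h)) \<in> C_inf atl" "(\<lambda>h. f (h \<odot> g)) \<in> C_inf atl" "(\<lambda>h. f (g \<odot> h \<odot> k)) \<in> C_inf atl"
  by (auto simp: C_inf_iff intro!: C_inf_comp[OF assms] group_smooth)

lemma C_inf_algebra:
  assumes "f \<in> C_inf atl" "g \<in> C_inf atl"
  shows "(\<lambda>q. f q + g q) \<in> C_inf atl" "(\<lambda>q. f q * g q) \<in> C_inf atl" "(\<lambda>q. c) \<in> C_inf atl"
    "(\<lambda>q. f q - g q) \<in> C_inf atl" "(\<lambda>q. r * f q) \<in> C_inf atl"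
proof -
  have 1: "(\<lambda>q. f q + g q) \<in> C_inf atl" "(\<lambda>q. f q * g q) \<in> C_inf atl"
    if "f \<in> C_inf atl" "g \<in> C_inf atl" for f g
    using that by (auto simp: C_inf_iff intro!: msmooth_at_add(1) msmooth_at_mult)
  then show "(\<lambda>q. f q + g q) \<in> C_inf atl" "(\<lambda>q. f q * g q) \<in> C_inf atl" using assms by auto
  show c: "(\<lambda>q. c) \<in> C_inf atl" for c by (simp add: C_inf_iff msmooth_at_const)
  have r: "(\<lambda>q. r * f q) \<in> C_inf atl" if "f \<in> C_inf atl" for r f using 1(2)[OF c that] .
  then show "(\<lambda>q. r * f q) \<in> C_inf atl" using assms by blast
  show "(\<lambda>q. f q - g q) \<in> C_inf atl" using 1(1)[OF assms(1) r[OF assms(2), of "-1"]] by simp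
qed

section \<open>Left-invariant fields and their commutator\<close>

text \<open>Moves the differentiation from the varying point \<open>g\<close> to the unit, where the
  reference chart does not depend on \<open>g\<close>.\<close>

lemma LF_alt:
  assumes "f \<in> C_inf atl"
  shows "LF x f g = differential atl (\<lambda>h. f (g \<odot> h)) eG x"
proof -
  have "msmooth_at atl atl (\<lambda>h. g \<odot> h) eG" by (intro group_smooth)
  from tangent_map_compose_apply[OF _ _ _ C_infD[OF assms] this, of x] show ?thesis
    by (simp add: field_deriv_def left_field_def)
qed

lemma LF_unit: "f \<in> C_inf atl \<Longrightarrow> LF x f eG = differential atl f eG x"
  by (simp add: LF_alt)

text \<open>Differentiation takes place at the unit, so one chart serves all \<open>g\<close> and
  \<open>param_derivative_smooth\<close> applies with a constant base point. The hypothesis is local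
  in \<open>g\<close>, which admits functions defined through a chart.\<close>

lemma param_derivative_unit:
  fixes \<Psi> :: "'g \<times> 'g \<Rightarrow> 'c::euclidean_space"
  assumes "\<forall>\<^sub>F g in nhds g0. msmooth_at (prod_atlas atl atl) model_atlas \<Psi> (g, eG)"
  shows "msmooth_at atl model_atlas (\<lambda>g. tangent_map atl model_atlas (\<lambda>h. \<Psi> (g, h)) eG x) g0"
proof -
  let ?o = "chart_fun atl eG eG"
  have s: "msmooth_at (prod_atlas atl model_atlas) model_atlas (\<lambda>z. \<Psi> (fst z, chart_inv atl eG (snd z))) (g, ?o)"
    if g: "msmooth_at (prod_atlas atl atl) model_atlas \<Psi> (g, eG)" for g
  proof -
    have 1: "msmooth_at (prod_atlas atl model_atlas) atl (\<lambda>z. chart_inv atl eG (snd z)) (g, ?o)"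
      by (rule msmooth_at_compose[of _ model_atlas])
        (use chart_msmooth(2)[OF smooth_atl chart_at_mem[OF smooth_atl]] in \<open>auto simp: msmooth_at_fst\<close>)
    show ?thesis
      by (rule msmooth_at_compose[of _ "prod_atlas atl atl" _ \<Psi>])
        (use 1 g in \<open>auto intro!: msmooth_at_Pair simp: msmooth_at_fst\<close>)
  qed
  have e: "msmooth_at atl model_atlas (\<lambda>g. frechet_derivative (\<lambda>y. \<Psi> (g, chart_inv atl eG y)) (at ?o) x) g0"
    using param_derivative_smooth[where s = "\<lambda>_. ?o" and v = x, OF smooth_atl s[OF eventually_nhds_x_imp_x[OF assms]]]
    by (simp add: msmooth_at_const)
  have "\<forall>\<^sub>F g in nhds g0. frechet_derivative (\<lambda>y. \<Psi> (g, chart_inv atl eG y)) (at ?o) x =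
      tangent_map atl model_atlas (\<lambda>h. \<Psi> (g, h)) eG x"
    using assms
  proof (rule eventually_mono)
    fix g assume \<Psi>: "msmooth_at (prod_atlas atl atl) model_atlas \<Psi> (g, eG)"
    have "msmooth_at atl (prod_atlas atl atl) (\<lambda>h. (g, h)) eG" by (intro msmooth_at_Pair group_smooth)
    from msmooth_at_compose[OF smooth_atl smooth_prod_atl(1) smooth_atlas_model \<Psi> this]
    have "msmooth_at atl model_atlas (\<lambda>h. \<Psi> (g, h)) eG" .
    from tangent_map_to_model_apply[OF smooth_atl this]
    show "frechet_derivative (\<lambda>y. \<Psi> (g, chart_inv atl eG y)) (at ?o) x =
      tangent_map atl model_atlas (\<lambda>h. \<Psi> (g, h)) eG x" by simp
  qed
  from msmooth_at_cong[OF smooth_atl smooth_atlas_model this e] show ?thesis .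
qed

lemma LF_smooth:
  assumes "f \<in> C_inf atl"
  shows "LF x f \<in> C_inf atl"
proof -
  have "msmooth_at atl model_atlas (\<lambda>g. tangent_map atl model_atlas (\<lambda>h. (\<lambda>z. f (fst z \<odot> snd z)) (g, h)) eG x) g" for g
    by (intro param_derivative_unit always_eventually allI C_inf_comp[OF assms] group_smooth)
  then have "(\<lambda>g. differential atl (\<lambda>h. f (g \<odot> h)) eG x) \<in> C_inf atl" by (simp add: C_inf_iff)
  moreover have "LF x f = (\<lambda>g. differential atl (\<lambda>h. f (g \<odot> h)) eG x)" using LF_alt[OF assms] by blast
  ultimately show ?thesis by simp
qed

lemma LF_linear_vec: "LF (r *\<^sub>R x + y) f g = r * LF x f g + LF y f g"
  by (simp add: field_deriv_def left_field_def blinfun.add_right blinfun.scaleR_right)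

lemma differential_algebra:
  assumes "f \<in> C_inf atl" "h \<in> C_inf atl"
  shows "differential atl (\<lambda>q. r * f q + h q) g v = r * differential atl f g v + differential atl h g v"
    "differential atl (\<lambda>q. f q * h q) g v = f g * differential atl h g v + h g * differential atl f g v"
    "differential atl (\<lambda>q. f q - h q) g v = differential atl f g v - differential atl h g v"
    "differential atl (\<lambda>q. f q + h q) g v = differential atl f g v + differential atl h g v"
proof -
  note fs = C_infD[OF assms(1), of g] and hs = C_infD[OF assms(2), of g]
  show 2: "differential atl (\<lambda>q. f q * h q) g v = f g * differential atl h g v + h g * differential atl f g v"
    using tangent_map_mult[OF smooth_atl fs hs] by (simp add: mult.commute)
  have r: "differential atl (\<lambda>q. r * f q) g v = r * differential atl f g v"
    "msmooth_at atl model_atlas (\<lambda>q. r * f q) g" if "msmooth_at atl model_atlas f g" for r f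
    using msmooth_at_linear[OF bounded_linear_mult_right smooth_atl that] by auto
  show "differential atl (\<lambda>q. r * f q + h q) g v = r * differential atl f g v + differential atl h g v"
    using msmooth_at_add(2)[OF smooth_atl r(2)[OF fs] hs] r[OF fs] by (simp add: blinfun.add_left)
  show "differential atl (\<lambda>q. f q - h q) g v = differential atl f g v - differential atl h g v"
    using msmooth_at_add(2)[OF smooth_atl fs r(2)[OF hs, of "-1"]] r(1)[OF hs, of "-1"] by (simp add: blinfun.add_left)
  show "differential atl (\<lambda>q. f q + h q) g v = differential atl f g v + differential atl h g v"
    using msmooth_at_add(2)[OF smooth_atl fs hs] by (simp add: blinfun.add_left)
qed

lemma LF_algebra:
  assumes "f \<in> C_inf atl" "h \<in> C_inf atl"
  shows "LF x (\<lambda>q. r * f q + h q) = (\<lambda>g. r * LF x f g + LF x h g)"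
    "LF x (\<lambda>q. f q * h q) = (\<lambda>g. f g * LF x h g + h g * LF x f g)"
    "LF x (\<lambda>q. f q - h q) = (\<lambda>g. LF x f g - LF x h g)"
    "LF x (\<lambda>q. f q + h q) = (\<lambda>g. LF x f g + LF x h g)"
  by (simp_all add: field_deriv_def differential_algebra assms)

lemma LF_translate: "f \<in> C_inf atl \<Longrightarrow> LF x (\<lambda>h. f (k \<odot> h)) g = LF x f (k \<odot> g)"
  by (simp add: LF_alt C_inf_translate m_assoc)

text \<open>The terms in which each field differentiates a different factor are symmetric in
  \<open>x\<close> and \<open>y\<close> and cancel.\<close>

lemma bracket_derivation: "derivation_at atl eG (\<lambda>f. LF x (LF y f) eG - LF y (LF x f) eG)"
  unfolding derivation_at_def
proof (intro ballI allI conjI)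
  fix f g :: "'g \<Rightarrow> real" and r assume fg: "f \<in> C_inf atl" "g \<in> C_inf atl"
  note s = LF_smooth[OF fg(1)] LF_smooth[OF fg(2)]
  show "LF x (LF y (\<lambda>q. r * f q + g q)) eG - LF y (LF x (\<lambda>q. r * f q + g q)) eG =
      r * (LF x (LF y f) eG - LF y (LF x f) eG) + (LF x (LF y g) eG - LF y (LF x g) eG)"
    by (simp add: LF_algebra fg s) (simp add: algebra_simps)
  show "LF x (LF y (\<lambda>q. f q * g q)) eG - LF y (LF x (\<lambda>q. f q * g q)) eG =
      f eG * (LF x (LF y g) eG - LF y (LF x g) eG) + g eG * (LF x (LF y f) eG - LF y (LF x f) eG)"
    by (simp add: LF_algebra fg s C_inf_algebra) (simp add: algebra_simps)
qed

text \<open>Left translations commute with left-invariant fields, so a commutator identity at the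
  unit spreads over the group.\<close>

lemma LF_commutator_translate:
  assumes z: "\<And>f. f \<in> C_inf atl \<Longrightarrow> differential atl f eG z = LF x (LF y f) eG - LF y (LF x f) eG"
    and f: "f \<in> C_inf atl"
  shows "LF z f g = LF x (LF y f) g - LF y (LF x f) g"
proof -
  have "LF z f g = LF z (\<lambda>h. f (g \<odot> h)) eG" by (simp add: LF_translate f)
  also have "\<dots> = LF x (LF y (\<lambda>h. f (g \<odot> h))) eG - LF y (LF x (\<lambda>h. f (g \<odot> h))) eG"
    using z C_inf_translate(1)[OF f] by (simp add: LF_unit)
  also have "LF y (\<lambda>h. f (g \<odot> h)) = (\<lambda>h. LF y f (g \<odot> h))" for y by (simp add: LF_translate f fun_eq_iff)
  then have "LF x (LF y (\<lambda>h. f (g \<odot> h))) eG - LF y (LF x (\<lambda>h. f (g \<odot> h))) eG = LF x (LF y f) g - LF y (LF x f) g"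
    by (simp add: LF_translate LF_smooth f)
  finally show ?thesis .
qed

text \<open>Discharges the definite description in \<open>lie_bracket\<close> and reduces its
  condition to the unit; the properties of the bracket are then checked on functions.\<close>

lemma bracket_unit_iff:
  "lie_bracket G x y = z \<longleftrightarrow> (\<forall>f\<in>C_inf atl. differential atl f eG z = LF x (LF y f) eG - LF y (LF x f) eG)"
proof -
  let ?P = "\<lambda>z. \<forall>f\<in>C_inf atl. LF z f = (\<lambda>g. LF x (LF y f) g - LF y (LF x f) g)"
  have iff: "?P z \<longleftrightarrow> (\<forall>f\<in>C_inf atl. differential atl f eG z = LF x (LF y f) eG - LF y (LF x f) eG)" for z
  proof
    assume r: "\<forall>f\<in>C_inf atl. differential atl f eG z = LF x (LF y f) eG - LF y (LF x f) eG"
    have "LF z f g = LF x (LF y f) g - LF y (LF x f) g" if "f \<in> C_inf atl" for f g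
      by (rule LF_commutator_translate[OF _ that]) (use r in blast)
    then show "?P z" by blast
  next
    assume "?P z"
    then show "\<forall>f\<in>C_inf atl. differential atl f eG z = LF x (LF y f) eG - LF y (LF x f) eG"
      by (metis (no_types, lifting) LF_unit)
  qed
  have uniq: "z = z'" if "?P z" "?P z'" for z z'
    using that unfolding iff by (intro differentials_separate[OF smooth_atl, of eG]) simp
  obtain z0 where "\<And>f. f \<in> C_inf atl \<Longrightarrow> LF x (LF y f) eG - LF y (LF x f) eG = differential atl f eG z0"
    using derivation_is_vector[OF smooth_atl bracket_derivation] by blast
  then have P0: "?P z0" unfolding iff by simp
  have "(THE z. ?P z) = z0"
    by (rule the_equality[where P = ?P, OF P0]) (rule uniq[OF _ P0])
  then have b: "lie_bracket G x y = z0" unfolding lie_bracket_def Let_def .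
  have "z0 = z \<longleftrightarrow> ?P z"
  proof
    assume "z0 = z"
    then show "?P z" using P0 by simp
  qed (rule uniq[OF P0])
  then show ?thesis unfolding b iff .
qed

lemma bracket_eqI:
  "(\<And>f. f \<in> C_inf atl \<Longrightarrow> differential atl f eG z = LF x (LF y f) eG - LF y (LF x f) eG) \<Longrightarrow> br x y = z"
  using bracket_unit_iff by blast

lemma bracket_unit: "f \<in> C_inf atl \<Longrightarrow> differential atl f eG (br x y) = LF x (LF y f) eG - LF y (LF x f) eG"
  using bracket_unit_iff by blast

lemma bracket_LF: "f \<in> C_inf atl \<Longrightarrow> LF (br x y) f g = LF x (LF y f) g - LF y (LF x f) g"
  by (rule LF_commutator_translate[OF bracket_unit])

lemma bracket_antisym: "br x y = - br y x"
  by (rule bracket_eqI) (simp add: blinfun.minus_right bracket_unit)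

lemma bracket_linear: "br (r *\<^sub>R x + x') y = r *\<^sub>R br x y + br x' y"
proof (rule bracket_eqI)
  fix f assume f: "f \<in> C_inf atl"
  have "LF (r *\<^sub>R x + x') f = (\<lambda>g. r * LF x f g + LF x' f g)" by (simp add: LF_linear_vec fun_eq_iff)
  then show "differential atl f eG (r *\<^sub>R br x y + br x' y) = LF (r *\<^sub>R x + x') (LF y f) eG - LF y (LF (r *\<^sub>R x + x') f) eG"
    by (simp add: LF_linear_vec LF_algebra LF_smooth f blinfun.add_right blinfun.scaleR_right bracket_unit)
       (simp add: algebra_simps)
qed

lemma bilinear_bracket: "bilinear br"
proof -
  have l: "linear (\<lambda>x. br x y)" for y
    using bracket_linear[of 1 _ _ y] bracket_linear[of 1 0 0 y] bracket_linear[of _ _ 0 y]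
    by (intro linearI) simp_all
  moreover have "linear (br x)" for x
    using linear_compose_neg[OF l[of x]] by (subst bracket_antisym[of x, abs_def])
  ultimately show ?thesis unfolding bilinear_def by blast
qed

lemma jacobi: "br (br x y) z = br x (br y z) - br y (br x z)"
proof (rule bracket_eqI)
  fix f assume f: "f \<in> C_inf atl"
  have L: "LF (br x y) f = (\<lambda>g. LF x (LF y f) g - LF y (LF x f) g)" if "f \<in> C_inf atl" for f x y
    using bracket_LF[OF that] by blast
  show "differential atl f eG (br x (br y z) - br y (br x z)) = LF (br x y) (LF z f) eG - LF z (LF (br x y) f) eG"
    by (simp add: blinfun.diff_right bracket_unit L LF_smooth LF_algebra f)
qed

section \<open>The adjoint action\<close>

text \<open>Composing with the chart at the unit makes conjugation vector-valued without changing
  its differential; smoothness in \<open>g\<close> then follows from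
  \<open>param_derivative_unit\<close>.\<close>

lemma Ad_apply:
  shows "Ad G g y = tangent_map atl model_atlas (\<lambda>h. chart_fun atl eG (g \<odot> h \<odot> ginv g)) eG y"
proof -
  have s: "msmooth_at atl atl (\<lambda>h. g \<odot> h \<odot> ginv g) eG" by (intro group_smooth)
  have "msmooth_at atl model_atlas (chart_fun atl eG) eG" using chart_msmooth(1)[OF smooth_atl chart_at_mem[OF smooth_atl]] .
  from tangent_map_compose_apply[OF smooth_atl smooth_atl smooth_atlas_model _ s, of "chart_fun atl eG" y] this
  show ?thesis by (simp add: Ad_def tangent_map_chart)
qed

lemma Ad_smooth: "msmooth_at atl model_atlas (\<lambda>g. Ad G g y) p"
proof -
  have "msmooth_at (prod_atlas atl atl) model_atlas (\<lambda>z. chart_fun atl eG (fst z \<odot> snd z \<odot> ginv (fst z))) (g, eG)" for g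
  proof (rule msmooth_at_compose[of _ atl])
    show "msmooth_at (prod_atlas atl atl) atl (\<lambda>z. fst z \<odot> snd z \<odot> ginv (fst z)) (g, eG)" by (intro group_smooth)
    show "msmooth_at atl model_atlas (chart_fun atl eG) (fst (g, eG) \<odot> snd (g, eG) \<odot> ginv (fst (g, eG)))"
      using chart_msmooth(1)[OF smooth_atl chart_at_mem[OF smooth_atl]] by simp
  qed auto
  then have "msmooth_at atl model_atlas (\<lambda>g. tangent_map atl model_atlas
      (\<lambda>h. (\<lambda>z. chart_fun atl eG (fst z \<odot> snd z \<odot> ginv (fst z))) (g, h)) eG y) p"
    by (intro param_derivative_unit always_eventually allI)
  then show ?thesis by (simp add: Ad_apply)
qed

lemma Ad_unit [simp]: "Ad G eG = id_blinfun"
  by (simp add: Ad_def tangent_map_id)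

lemma Ad_mult: "Ad G (g \<odot> h) = Ad G g o\<^sub>L Ad G h"
proof -
  have "msmooth_at atl atl (\<lambda>k. g \<odot> k \<odot> ginv g) (h \<odot> eG \<odot> ginv h)" "msmooth_at atl atl (\<lambda>k. h \<odot> k \<odot> ginv h) eG"
    by (intro group_smooth)+
  from tangent_map_compose[OF smooth_atl smooth_atl smooth_atl this] show ?thesis
    by (simp add: Ad_def m_assoc ginv_mult)
qed

lemma Ad_ginv [simp]: "Ad G g (Ad G (ginv g) x) = x" "Ad G (ginv g) (Ad G g x) = x"
  using arg_cong[OF Ad_mult[of g "ginv g"], of "\<lambda>T. T x"] arg_cong[OF Ad_mult[of "ginv g" g], of "\<lambda>T. T x"] by simp_all

lemma differential_Ad:
  assumes "f \<in> C_inf atl"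
  shows "differential atl f eG (Ad G g x) = differential atl (\<lambda>h. f (g \<odot> h \<odot> ginv g)) eG x"
proof -
  have "msmooth_at atl atl (\<lambda>h. g \<odot> h \<odot> ginv g) eG" by (intro group_smooth)
  from tangent_map_compose_apply[OF smooth_atl smooth_atl smooth_atlas_model C_infD[OF assms] this, of x]
  show ?thesis by (simp add: Ad_def)
qed

text \<open>Conjugation intertwines the left-invariant field of \<open>x\<close> with that of its
  image under \<open>Ad\<close>; applied twice, this transports the commutator.\<close>

lemma Ad_bracket: "br (Ad G g x) (Ad G g y) = Ad G g (br x y)"
proof (rule bracket_eqI)
  fix f assume f: "f \<in> C_inf atl"
  let ?C = "\<lambda>h. g \<odot> h \<odot> ginv g"
  have L: "LF x (\<lambda>h. f (?C h)) = (\<lambda>h. LF (Ad G g x) f (?C h))" if f: "f \<in> C_inf atl" for f x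
  proof
    fix h
    have "LF x (\<lambda>h. f (?C h)) h = differential atl (\<lambda>k. f (?C (h \<odot> k))) eG x"
      by (simp add: LF_alt C_inf_translate f)
    also have "(\<lambda>k. f (?C (h \<odot> k))) = (\<lambda>k. f (?C h \<odot> ?C k))" by (simp add: m_assoc)
    also have "differential atl (\<lambda>k. f (?C h \<odot> ?C k)) eG x = differential atl (\<lambda>k. f (?C h \<odot> k)) eG (Ad G g x)"
      by (subst differential_Ad) (simp_all add: C_inf_translate f)
    finally show "LF x (\<lambda>h. f (?C h)) h = LF (Ad G g x) f (?C h)" by (simp add: LF_alt f)
  qed
  show "differential atl f eG (Ad G g (br x y)) =
      LF (Ad G g x) (LF (Ad G g y) f) eG - LF (Ad G g y) (LF (Ad G g x) f) eG"
    using bracket_unit[OF C_inf_translate(3)[OF f], of g "ginv g" x y] L[OF f]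
      L[OF LF_smooth[OF f]] by (simp add: differential_Ad f)
qed

text \<open>Both sides are mixed second derivatives of \<open>R\<close>, the function
  \<open>f\<close> of a product in coordinates at the unit, in the two possible orders. This is the
  infinitesimal form of the commutation of left and right translations.\<close>

lemma left_right_swap:
  assumes f: "f \<in> C_inf atl"
  shows "differential atl (\<lambda>g. differential atl (\<lambda>k. f (k \<odot> g)) eG y) eG x = LF y (LF x f) eG"
proof -
  define o' where "o' = chart_fun atl eG eG"
  let ?c = "chart_inv atl eG"
  define R where "R = (\<lambda>z. f (?c (fst z) \<odot> ?c (snd z)))"
  have R: "smooth_pt R (o', o')"
    using prod_rep_smooth[OF smooth_atl smooth_atl smooth_atlas_model, of "\<lambda>z. f (fst z \<odot> snd z)" eG eG]
    by (simp add: R_def o'_def C_inf_comp[OF f] group_smooth)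
  have Q: "msmooth_at atl model_atlas (\<lambda>g. differential atl (\<lambda>k. f (k \<odot> g)) eG y) eG"
    using param_derivative_unit[where \<Psi> = "\<lambda>z. f (snd z \<odot> fst z)" and ?g0.0 = eG and x = y] by (simp add: C_inf_comp[OF f] group_smooth)
  have L: "msmooth_at atl model_atlas (LF x f) eG" using C_infD[OF LF_smooth[OF f]] .
  have cs: "smooth_pt (\<lambda>b. (o', b)) o'" "smooth_pt (\<lambda>b. (b, o')) o'" by (intro smooth_pt_Pair smooth_pt_const smooth_pt_ident)+
  have ev: "\<forall>\<^sub>F b in nhds o'. smooth_pt R (o', b)" "\<forall>\<^sub>F b in nhds o'. smooth_pt R (b, o')"
    using eventually_nhds_compose[OF smooth_pt_isCont[OF cs(1)] smooth_pt_eventually[OF R]]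
      eventually_nhds_compose[OF smooth_pt_isCont[OF cs(2)] smooth_pt_eventually[OF R]] .
  have fs: "(\<lambda>k. f (k \<odot> g)) \<in> C_inf atl" "(\<lambda>k. f (g \<odot> k)) \<in> C_inf atl" for g by (intro C_inf_translate f)+
  have 1: "differential atl (\<lambda>g. differential atl (\<lambda>k. f (k \<odot> g)) eG y) eG x =
      frechet_derivative (\<lambda>b. frechet_derivative (\<lambda>a. R (a, b)) (at o') y) (at o') x"
    unfolding tangent_map_to_model_apply[OF smooth_atl Q]
    by (simp add: tangent_map_to_model_apply[OF smooth_atl C_infD[OF fs(1)]] R_def o'_def)
  have "frechet_derivative (\<lambda>b. frechet_derivative (\<lambda>a. R (a, b)) (at o') y) (at o') =
      frechet_derivative (\<lambda>b. frechet_derivative R (at (o', b)) (y, 0)) (at o')"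
    by (rule frechet_derivative_cong_nhds) (use ev(1) in \<open>rule eventually_mono; simp add: smooth_pt_partial_fst(2)\<close>)
  then have 2: "differential atl (\<lambda>g. differential atl (\<lambda>k. f (k \<odot> g)) eG y) eG x =
      frechet_derivative (\<lambda>z. frechet_derivative R (at z) (y, 0)) (at (o', o')) (0, x)"
    unfolding 1 using smooth_pt_partial_snd(2)[OF smooth_pt_derivative[OF R, of "(y, 0)"]] by simp
  have 3: "LF y (LF x f) eG = frechet_derivative (\<lambda>a. frechet_derivative (\<lambda>b. R (a, b)) (at o') x) (at o') y"
    by (simp add: LF_unit LF_smooth f tangent_map_to_model_apply[OF smooth_atl L])
       (simp add: LF_alt f tangent_map_to_model_apply[OF smooth_atl C_infD[OF fs(2)]] R_def o'_def)
  have "frechet_derivative (\<lambda>a. frechet_derivative (\<lambda>b. R (a, b)) (at o') x) (at o') =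
      frechet_derivative (\<lambda>a. frechet_derivative R (at (a, o')) (0, x)) (at o')"
    by (rule frechet_derivative_cong_nhds) (use ev(2) in \<open>rule eventually_mono; simp add: smooth_pt_partial_snd(2)\<close>)
  then have 4: "LF y (LF x f) eG = frechet_derivative (\<lambda>z. frechet_derivative R (at z) (0, x)) (at (o', o')) (y, 0)"
    unfolding 3 using smooth_pt_partial_fst(2)[OF smooth_pt_derivative[OF R, of "(0, x)"]] by simp
  show ?thesis unfolding 2 4 by (rule second_derivative_symmetric[OF R])
qed

text \<open>The left-invariant field of \<open>y\<close> is, at \<open>g\<close>, the right-invariant field of \<open>Ad\<^sub>g y\<close>; since
  left-invariant fields commute with right-invariant ones, differentiating this in direction \<open>x\<close>
  leaves exactly the commutator.\<close>

lemma Ad_derivative: "tangent_map atl model_atlas (\<lambda>g. Ad G g y) eG x = br x y"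
proof (rule bracket_eqI[symmetric])
  fix f assume f: "f \<in> C_inf atl"
  define Q where "Q = (\<lambda>z g. differential atl (\<lambda>k. f (k \<odot> g)) eG z)"
  let ?T = "tangent_map atl model_atlas (\<lambda>g. Ad G g y) eG x"
  have Qs: "msmooth_at atl model_atlas (Q z) g" for z g
    unfolding Q_def using param_derivative_unit[where \<Psi> = "\<lambda>z. f (snd z \<odot> fst z)" and ?g0.0 = g and x = z] by (simp add: C_inf_comp[OF f] group_smooth)
  \<comment> \<open>\<open>Ad G g y\<close> varies with \<open>g\<close>; expanding it in the basis
    separates this dependence from that of the right-invariant derivatives \<open>Q i\<close>, so
    the product rule applies.\<close>
  have Qlin: "Q z g = (\<Sum>i\<in>Basis. (z \<bullet> i) * Q i g)" for z g
    unfolding Q_def real_scaleR_def[symmetric]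
    by (rule linear_Basis_sum[OF bounded_linear.linear[OF blinfun.bounded_linear_right]])
  have "LF y f g = (\<Sum>i\<in>Basis. (Ad G g y \<bullet> i) * Q i g)" for g
  proof -
    have "LF y f g = differential atl (\<lambda>h. (\<lambda>k. f (k \<odot> g)) (g \<odot> h \<odot> ginv g)) eG y"
      by (simp add: LF_alt f m_assoc)
    also have "\<dots> = Q (Ad G g y) g"
      unfolding Q_def by (rule differential_Ad[symmetric]) (intro C_inf_translate f)
    also have "\<dots> = (\<Sum>i\<in>Basis. (Ad G g y \<bullet> i) * Q i g)" by (rule Qlin)
    finally show ?thesis .
  qed
  then have e: "LF y f = (\<lambda>g. \<Sum>i\<in>Basis. (Ad G g y \<bullet> i) * Q i g)" by blast
  have As: "msmooth_at atl model_atlas (\<lambda>g. Ad G g y \<bullet> i) eG"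
    "differential atl (\<lambda>g. Ad G g y \<bullet> i) eG x = ?T \<bullet> i" for i
    using msmooth_at_linear[OF bounded_linear_inner_left smooth_atl Ad_smooth] by blast+
  have "LF x (LF y f) eG = differential atl (\<lambda>g. \<Sum>i\<in>Basis. (Ad G g y \<bullet> i) * Q i g) eG x"
    by (simp add: LF_unit LF_smooth f) (simp add: e)
  also have "\<dots> = (\<Sum>i\<in>Basis. differential atl (\<lambda>g. (Ad G g y \<bullet> i) * Q i g) eG x)"
    using msmooth_at_sum[OF smooth_atl, of Basis "\<lambda>i g. (Ad G g y \<bullet> i) * Q i g" eG] As(1) Qs
    by (simp add: msmooth_at_mult blinfun.sum_left)
  also have "\<dots> = (\<Sum>i\<in>Basis. (y \<bullet> i) * differential atl (Q i) eG x + (?T \<bullet> i) * Q i eG)"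
    by (simp add: tangent_map_mult[OF smooth_atl As(1) Qs] As(2))
  also have "\<dots> = (\<Sum>i\<in>Basis. (y \<bullet> i) * differential atl (Q i) eG x) + Q ?T eG"
    by (simp add: sum.distrib Qlin[of ?T])
  also have "(\<Sum>i\<in>Basis. (y \<bullet> i) * differential atl (Q i) eG x) = differential atl (Q y) eG x"
  proof -
    have "Q y = (\<lambda>g. \<Sum>i\<in>Basis. (y \<bullet> i) * Q i g)" by (rule ext) (rule Qlin)
    moreover have "msmooth_at atl model_atlas (\<lambda>g. (y \<bullet> i) * Q i g) eG"
      "differential atl (\<lambda>g. (y \<bullet> i) * Q i g) eG x = (y \<bullet> i) * differential atl (Q i) eG x" for i
      using msmooth_at_linear[OF bounded_linear_mult_right smooth_atl Qs] by auto
    ultimately show ?thesis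
      using msmooth_at_sum[OF smooth_atl, of Basis "\<lambda>i g. (y \<bullet> i) * Q i g" eG] by (simp add: blinfun.sum_left)
  qed
  also have "\<dots> = LF y (LF x f) eG" unfolding Q_def by (rule left_right_swap[OF f])
  finally show "differential atl f eG ?T = LF x (LF y f) eG - LF y (LF x f) eG" by (simp add: Q_def)
qed

end

section \<open>The exponential map\<close>

context lie_grp
begin

lemma left_field_mult: "left_field G x (g \<odot> h) = tangent_map atl atl (\<lambda>k. g \<odot> k) h (left_field G x h)"
proof -
  have "msmooth_at atl atl (\<lambda>k. g \<odot> k) (h \<odot> eG)" "msmooth_at atl atl (\<lambda>k. h \<odot> k) eG" by (intro group_smooth)+
  from tangent_map_compose_apply[OF smooth_atl smooth_atl smooth_atl this, of x]
  have "tangent_map atl atl (\<lambda>k. g \<odot> (h \<odot> k)) eG x = tangent_map atl atl (\<lambda>k. g \<odot> k) h (left_field G x h)"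
    by (simp add: left_field_def)
  moreover have "(\<lambda>k. g \<odot> (h \<odot> k)) = (\<lambda>k. g \<odot> h \<odot> k)" by (simp add: m_assoc fun_eq_iff)
  ultimately show ?thesis by (simp add: left_field_def)
qed

lemma left_field_unit [simp]: "left_field G x eG = x"
proof -
  have e: "(\<lambda>h. eG \<odot> h) = (\<lambda>h. h)" by (simp add: fun_eq_iff)
  show ?thesis unfolding left_field_def e by (simp add: tangent_map_id)
qed

text \<open>These are the components of a left-invariant field in one fixed chart, whereas the
  values of \<open>left_field\<close> refer to charts that change with the point.\<close>

lemma chart_translate_smooth:
  assumes c: "(U, \<phi>) \<in> atl" and g: "g \<in> U"
  shows "msmooth_at atl model_atlas (\<lambda>g. tangent_map atl model_atlas (\<lambda>h. \<phi> (g \<odot> h)) eG x) g"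
proof -
  have "\<forall>\<^sub>F g in nhds g. msmooth_at (prod_atlas atl atl) model_atlas (\<lambda>z. \<phi> (fst z \<odot> snd z)) (g, eG)"
    using chart_isCont(3)[OF smooth_atl c g]
  proof (rule eventually_mono)
    fix g assume "g \<in> U"
    show "msmooth_at (prod_atlas atl atl) model_atlas (\<lambda>z. \<phi> (fst z \<odot> snd z)) (g, eG)"
    proof (rule msmooth_at_compose[of _ atl])
      show "msmooth_at (prod_atlas atl atl) atl (\<lambda>z. fst z \<odot> snd z) (g, eG)" by (intro group_smooth)
      show "msmooth_at atl model_atlas \<phi> (fst (g, eG) \<odot> snd (g, eG))"
        using chart_msmooth(1)[OF smooth_atl c \<open>g \<in> U\<close>] by simp
    qed auto
  qed
  from param_derivative_unit[OF this, of x] show ?thesis by simp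
qed

lemma chart_left_field:
  assumes "(U, \<phi>) \<in> atl" "g \<in> U"
  shows "tangent_map atl model_atlas (\<lambda>h. \<phi> (g \<odot> h)) eG x = tangent_map atl model_atlas \<phi> g (left_field G x g)"
proof -
  have "msmooth_at atl atl (\<lambda>h. g \<odot> h) eG" by (intro group_smooth)
  from tangent_map_compose_apply[OF smooth_atl smooth_atl smooth_atlas_model _ this, of \<phi> x] show ?thesis
    using chart_msmooth(1)[OF smooth_atl assms] by (simp add: left_field_def)
qed

section \<open>Integral curves of left-invariant fields\<close>

text \<open>A condition at a single time, including smoothness there. It is stable under left
  translation and time shift, which is how local curves are continued.\<close>

definition integral_curve :: "'e \<Rightarrow> (real \<Rightarrow> 'g) \<Rightarrow> real \<Rightarrow> bool" where
  "integral_curve x c t \<longleftrightarrow> msmooth_at model_atlas atl c t \<and> tangent_map model_atlas atl c t 1 = left_field G x (c t)"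

lemma integral_curve_translate:
  assumes "integral_curve x c t"
  shows "integral_curve x (\<lambda>t. g \<odot> c t) t"
proof -
  have c: "msmooth_at model_atlas atl c t" using assms by (simp add: integral_curve_def)
  have "msmooth_at atl atl (\<lambda>k. g \<odot> k) (c t)" by (intro group_smooth)
  from tangent_map_compose_apply[OF _ smooth_atl smooth_atl this c, of 1] msmooth_at_compose[OF _ smooth_atl smooth_atl this c] assms
  show ?thesis by (simp add: integral_curve_def left_field_mult)
qed

lemma curve_reparam:
  assumes "msmooth_at model_atlas atl c (s + r * t)"
  shows "msmooth_at model_atlas atl (\<lambda>t. c (s + r * t)) t"
    "tangent_map model_atlas atl (\<lambda>t. c (s + r * t)) t 1 = r *\<^sub>R tangent_map model_atlas atl c (s + r * t) 1"
proof -
  have sp: "smooth_pt (\<lambda>t. s + r * t) t" by (intro smooth_pt_add smooth_pt_mult smooth_pt_const smooth_pt_ident)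
  then have s: "msmooth_at model_atlas model_atlas (\<lambda>t. s + r * t) t" by simp
  have "((\<lambda>t. s + r * t) has_derivative (\<lambda>v. r * v)) (at t)" by (auto intro!: derivative_eq_intros)
  from frechet_derivative_at[OF this] have "tangent_map model_atlas model_atlas (\<lambda>t. s + r * t) t 1 = r"
    using tangent_map_model_apply[OF sp, of 1] by (metis mult.right_neutral)
  moreover have "tangent_map model_atlas atl c (s + r * t) r = r *\<^sub>R tangent_map model_atlas atl c (s + r * t) 1"
    by (simp add: blinfun.scaleR_right[symmetric])
  ultimately show "tangent_map model_atlas atl (\<lambda>t. c (s + r * t)) t 1 = r *\<^sub>R tangent_map model_atlas atl c (s + r * t) 1"
    using tangent_map_compose_apply[OF _ _ smooth_atl assms s, of 1] by simp
  show "msmooth_at model_atlas atl (\<lambda>t. c (s + r * t)) t"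
    using msmooth_at_compose[OF _ _ smooth_atl assms s] by simp
qed

lemma integral_curve_shift:
  assumes "integral_curve x c (s + t)"
  shows "integral_curve x (\<lambda>t. c (s + t)) t"
  using curve_reparam[of c s 1 t] assms by (simp add: integral_curve_def)

lemma right_translation_inj:
  assumes "tangent_map atl atl (\<lambda>k. k \<odot> h) g v = 0"
  shows "v = 0"
proof -
  have "msmooth_at atl atl (\<lambda>k. k \<odot> ginv h) (g \<odot> h)" "msmooth_at atl atl (\<lambda>k. k \<odot> h) g" by (intro group_smooth)+
  from tangent_map_compose_apply[OF smooth_atl smooth_atl smooth_atl this, of v] assms show ?thesis
    by (simp add: m_assoc tangent_map_id)
qed

text \<open>The quotient \<open>w\<close> of the two curves is constant: when \<open>a = w b\<close>
  is differentiated, the part coming from \<open>b\<close> already equals the left-invariant field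
  along \<open>a\<close>, and right translations have injective differentials. No estimate for
  differential equations enters.\<close>

lemma integral_curves_agree:
  assumes S: "open S" "connected S" "0 \<in> S" "t \<in> S" and eq: "a 0 = b 0"
    and a: "\<And>t. t \<in> S \<Longrightarrow> integral_curve x a t" and b: "\<And>t. t \<in> S \<Longrightarrow> integral_curve x b t"
  shows "a t = b t"
proof -
  define w where "w = (\<lambda>t. a t \<odot> ginv (b t))"
  have ws: "msmooth_at model_atlas atl w t" if "t \<in> S" for t
    unfolding w_def using a[OF that] b[OF that] by (intro group_smooth smooth_atlas_model) (auto simp: integral_curve_def)
  have "tangent_map model_atlas atl w t = 0" if t: "t \<in> S" for t
  proof -
    have bs: "msmooth_at model_atlas atl b t" using b[OF t] by (simp add: integral_curve_def)
    have ms: "msmooth_at (prod_atlas atl atl) atl (\<lambda>z. fst z \<odot> snd z) (w t, b t)" by (intro group_smooth)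
    have "a t = w t \<odot> b t" for t by (simp add: w_def m_assoc)
    then have aw: "a = (\<lambda>t. w t \<odot> b t)" by blast
    have "tangent_map model_atlas atl a t 1 =
        tangent_map atl atl (\<lambda>k. k \<odot> b t) (w t) (tangent_map model_atlas atl w t 1) +
        tangent_map atl atl (\<lambda>k. w t \<odot> k) (b t) (tangent_map model_atlas atl b t 1)"
      using tangent_map_two_variables[OF smooth_atlas_model smooth_atl smooth_atl smooth_atl ms ws[OF t] bs, of 1] by (simp add: aw)
    moreover have "tangent_map atl atl (\<lambda>k. w t \<odot> k) (b t) (tangent_map model_atlas atl b t 1) = left_field G x (a t)"
      using b[OF t] by (simp add: integral_curve_def left_field_mult[symmetric] aw)
    ultimately have "tangent_map atl atl (\<lambda>k. k \<odot> b t) (w t) (tangent_map model_atlas atl w t 1) = 0"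
      using a[OF t] by (simp add: integral_curve_def)
    then have z: "tangent_map model_atlas atl w t 1 = 0" by (rule right_translation_inj)
    show ?thesis
    proof (rule blinfun_eqI)
      fix v
      have "tangent_map model_atlas atl w t v = v *\<^sub>R tangent_map model_atlas atl w t 1"
        by (simp add: blinfun.scaleR_right[symmetric])
      then show "tangent_map model_atlas atl w t v = blinfun_apply 0 v" unfolding z by simp
    qed
  qed
  then have "w t = w 0" using tangent_map_zero_constant[OF _ smooth_atl S(1,2) ws _ S(4,3)] by simp
  then have "a t \<odot> ginv (b t) = eG" using eq by (simp add: w_def)
  then have "a t \<odot> ginv (b t) \<odot> b t = eG \<odot> b t" by simp
  then show ?thesis by (simp add: m_assoc)
qed

lemma chart_tangent_inverse:
  assumes c: "(U, \<phi>) \<in> atl" and g: "g \<in> U"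
  shows "tangent_map model_atlas atl (inv_into U \<phi>) (\<phi> g) (tangent_map atl model_atlas \<phi> g v) = v"
proof -
  have "\<forall>\<^sub>F q in nhds g. q = inv_into U \<phi> (\<phi> q)"
    using chart_isCont(3)[OF smooth_atl c g] by (rule eventually_mono) (simp add: smooth_atlasD(5)[OF smooth_atl c])
  from tangent_map_cong[OF smooth_atl smooth_atl this msmooth_id]
    tangent_map_compose_apply[OF smooth_atl smooth_atlas_model smooth_atl chart_msmooth(2)[OF smooth_atl c g] chart_msmooth(1)[OF smooth_atl c g], of v]
  show ?thesis by (simp add: tangent_map_id)
qed

lemma integral_curve_exists:
  obtains e c where "e > 0" "c 0 = eG" "\<And>t. \<bar>t\<bar> < e \<Longrightarrow> integral_curve x c t"
proof -
  define U \<phi> where "U = chart_dom atl eG" and "\<phi> = chart_fun atl eG"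
  have c: "(U, \<phi>) \<in> atl" "eG \<in> U" unfolding U_def \<phi>_def by (rule chart_at_mem[OF smooth_atl])+
  note d = smooth_atlasD[OF smooth_atl c(1)]
  define X where "X = (\<lambda>q. tangent_map atl model_atlas (\<lambda>h. \<phi> (inv_into U \<phi> q \<odot> h)) eG x)"
  have X: "smooth_pt X (\<phi> g)" if g: "g \<in> U" for g
  proof -
    have "msmooth_at atl model_atlas (\<lambda>g. tangent_map atl model_atlas (\<lambda>h. \<phi> (g \<odot> h)) eG x) g"
      by (rule chart_translate_smooth[OF c(1) g])
    then have "msmooth_at model_atlas model_atlas X (\<phi> g)"
      unfolding X_def using chart_msmooth(2)[OF smooth_atl c(1) g] g d(5)
      by (intro msmooth_at_compose[of model_atlas atl model_atlas "\<lambda>g. tangent_map atl model_atlas (\<lambda>h. \<phi> (g \<odot> h)) eG x" "inv_into U \<phi>"])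
         auto
    then show ?thesis by simp
  qed
  have XW: "smooth_pt X q" if "q \<in> \<phi> ` U" for q using X that by blast
  have "\<phi> eG \<in> \<phi> ` U" using c(2) by blast
  from local_flow[OF d(2) this XW] obtain e b where b: "e > 0" "b 0 = \<phi> eG" "\<And>t. \<bar>t\<bar> < e \<Longrightarrow> b t \<in> \<phi> ` U"
    "\<And>t. \<bar>t\<bar> < e \<Longrightarrow> (b has_vector_derivative X (b t)) (at t)" "\<And>t. \<bar>t\<bar> < e \<Longrightarrow> smooth_pt b t" by blast
  define \<gamma> where "\<gamma> = (\<lambda>t. inv_into U \<phi> (b t))"
  have "integral_curve x \<gamma> t" if t: "\<bar>t\<bar> < e" for t
  proof -
    obtain g where g: "g \<in> U" "b t = \<phi> g" using b(3)[OF t] by blast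
    have \<gamma>g: "\<gamma> t = g" using g d(5) by (simp add: \<gamma>_def)
    have ins: "msmooth_at model_atlas atl (inv_into U \<phi>) (b t)" using chart_msmooth(2)[OF smooth_atl c(1) g(1)] g by simp
    have bs: "msmooth_at model_atlas model_atlas b t" using b(5)[OF t] by simp
    have "tangent_map model_atlas model_atlas b t 1 = X (b t)"
      using frechet_derivative_at[OF b(4)[OF t, unfolded has_vector_derivative_def]]
      by (simp add: tangent_map_model_apply b(5) t) (metis scaleR_one)
    moreover have "X (b t) = tangent_map atl model_atlas \<phi> g (left_field G x g)"
      using chart_left_field[OF c(1) g(1), of x] g d(5) by (simp add: X_def)
    moreover have "tangent_map model_atlas atl (inv_into U \<phi>) (\<phi> g) (tangent_map atl model_atlas \<phi> g v) = v" for v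
      by (rule chart_tangent_inverse[OF c(1) g(1)])
    ultimately have "tangent_map model_atlas atl \<gamma> t 1 = left_field G x g"
      using tangent_map_compose_apply[OF _ _ smooth_atl ins bs, of 1] g by (simp add: \<gamma>_def)
    moreover have "msmooth_at model_atlas atl \<gamma> t"
      unfolding \<gamma>_def using msmooth_at_compose[OF _ _ smooth_atl ins bs] by simp
    ultimately show ?thesis by (simp add: integral_curve_def \<gamma>g)
  qed
  moreover have "\<gamma> 0 = eG" using b(2) d(5) c(2) by (simp add: \<gamma>_def)
  ultimately show ?thesis using that b(1) by blast
qed

section \<open>One-parameter subgroups\<close>

lemma one_parameter_subgroup_iff:
  "one_parameter_subgroup G c \<longleftrightarrow> (\<forall>t. msmooth_at model_atlas atl c t) \<and> (\<forall>s t. c (s + t) = c s \<odot> c t)"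
  by (simp add: one_parameter_subgroup_def smooth_map_iff)

lemma one_parameter_subgroup_zero:
  assumes "one_parameter_subgroup G c"
  shows "c 0 = eG"
proof -
  have "c 0 = c 0 \<odot> c 0" using assms unfolding one_parameter_subgroup_iff by (metis add_0)
  then have "ginv (c 0) \<odot> c 0 = ginv (c 0) \<odot> (c 0 \<odot> c 0)" by simp
  then show ?thesis by simp
qed

lemma one_parameter_subgroup_integral_curve:
  assumes "one_parameter_subgroup G c" "tangent_map model_atlas atl c 0 1 = x"
  shows "integral_curve x c t"
proof -
  have "integral_curve x c 0"
    using assms one_parameter_subgroup_zero[OF assms(1)] by (simp add: integral_curve_def one_parameter_subgroup_iff)
  then have "integral_curve x c (- t + t)" by simp
  from integral_curve_translate[OF integral_curve_shift[OF this], of "c t"]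
  have "integral_curve x (\<lambda>s. c t \<odot> c (- t + s)) t" .
  moreover have "c t \<odot> c (- t + s) = c s" for s
    using assms(1) unfolding one_parameter_subgroup_iff by (metis add.left_commute add.right_inverse add_0_right)
  ultimately show ?thesis by simp
qed

lemma one_parameter_subgroup_unique:
  assumes "one_parameter_subgroup G a" "one_parameter_subgroup G b"
    "tangent_map model_atlas atl a 0 1 = tangent_map model_atlas atl b 0 1"
  shows "a = b"
proof
  fix t
  show "a t = b t"
    by (rule integral_curves_agree[of UNIV t a b "tangent_map model_atlas atl b 0 1"])
       (use assms in \<open>auto simp: one_parameter_subgroup_zero intro!: one_parameter_subgroup_integral_curve connected_UNIV\<close>)
qed

text \<open>A short integral curve is a local homomorphism by uniqueness, and its extension is
  forced: the value at \<open>t\<close> must be the \<open>n\<close>-th power of the value at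
  \<open>t / n\<close>. Since short values commute, the extension is a homomorphism.\<close>

lemma one_parameter_subgroup_exists:
  obtains c where "one_parameter_subgroup G c" "tangent_map model_atlas atl c 0 1 = x"
proof -
  obtain e \<gamma> where e: "e > 0" and \<gamma>0: "\<gamma> 0 = eG" and \<gamma>: "\<And>t. \<bar>t\<bar> < e \<Longrightarrow> integral_curve x \<gamma> t"
    using integral_curve_exists by blast
  \<comment> \<open>Half the existence time, so that the sum of two admissible times still lies
    within it.\<close>
  define d where "d = e / 2"
  have d: "d > 0" using e by (simp add: d_def)
  have add: "\<gamma> (s + t) = \<gamma> s \<odot> \<gamma> t" if "\<bar>s\<bar> < d" "\<bar>t\<bar> < d" for s t
    by (rule integral_curves_agree[of "{-d<..<d}" t _ _ x])
       (use that d in \<open>auto simp: \<gamma>0 d_def intro!: integral_curve_shift integral_curve_translate \<gamma>\<close>)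
  have pow: "\<gamma> (real k * s) = \<gamma> s [^]\<^bsub>G\<^esub> k" if "\<bar>real k * s\<bar> < d" "\<bar>s\<bar> < d" for k s
    using that
  proof (induction k)
    case (Suc k)
    have "\<bar>real k * s\<bar> \<le> \<bar>real (Suc k) * s\<bar>" unfolding abs_mult by (intro mult_right_mono) auto
    then have k: "\<bar>real k * s\<bar> < d" using Suc.prems by linarith
    have "\<gamma> (real (Suc k) * s) = \<gamma> (real k * s + s)" by (simp add: algebra_simps)
    also have "\<dots> = \<gamma> (real k * s) \<odot> \<gamma> s" using k Suc.prems by (intro add)
    finally show ?case using Suc.IH[OF k Suc.prems(2)] by simp
  qed (simp add: \<gamma>0)
  \<comment> \<open>Both powers are compared with a power at the common refinement
    \<open>t / (real n * real m)\<close>.\<close>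
  have wd: "\<gamma> (t / real n) [^]\<^bsub>G\<^esub> n = \<gamma> (t / real m) [^]\<^bsub>G\<^esub> m"
    if n: "n > 0" "\<bar>t / real n\<bar> < d" and m: "m > 0" "\<bar>t / real m\<bar> < d" for t n m
  proof -
    have small: "\<bar>t / (real n * real m)\<bar> < d"
    proof -
      have "\<bar>t / (real n * real m)\<bar> = \<bar>t / real n\<bar> / real m" by (simp add: abs_divide abs_mult)
      also have "\<dots> \<le> \<bar>t / real n\<bar>"
      proof -
        have y: "y / real m \<le> y" if "0 \<le> y" for y
          using that m(1) mult_left_mono[of 1 "real m" y] by (simp add: pos_divide_le_eq)
        show ?thesis by (rule y[OF abs_ge_zero])
      qed
      finally show ?thesis using n by linarith
    qed
    have 1: "\<gamma> (t / real n) = \<gamma> (t / (real n * real m)) [^]\<^bsub>G\<^esub> m"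
      using pow[of m "t / (real n * real m)"] small n m by simp
    have 2: "\<gamma> (t / real m) = \<gamma> (t / (real n * real m)) [^]\<^bsub>G\<^esub> n"
      using pow[of n "t / (real n * real m)"] small n m by simp
    show ?thesis unfolding 1 2 by (simp add: nat_pow_pow mult.commute)
  qed
  \<comment> \<open>The ceiling alone gives a weak inequality; the added 1 makes it strict, and
    \<open>n\<close> positive.\<close>
  define N where "N = (\<lambda>t. nat \<lceil>\<bar>t\<bar> / d\<rceil> + 1)"
  have N: "\<bar>t / real n\<bar> < d \<and> n > 0" if "n \<ge> N t" for t n
  proof -
    have "\<bar>t\<bar> / d < real n" using that unfolding N_def by linarith
    then show ?thesis using d that by (auto simp: N_def field_simps abs_divide)
  qed
  define c where "c = (\<lambda>t. \<gamma> (t / real (N t)) [^]\<^bsub>G\<^esub> N t)"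
  have ceq: "c t = \<gamma> (t / real n) [^]\<^bsub>G\<^esub> n" if "n > 0" "\<bar>t / real n\<bar> < d" for t n
    unfolding c_def using N[of t "N t"] that by (intro wd) auto
  have hom: "c (s + t) = c s \<odot> c t" for s t
  proof -
    define n where "n = N s + N t + N (s + t)"
    have n: "n > 0" "\<bar>s / real n\<bar> < d" "\<bar>t / real n\<bar> < d" "\<bar>(s + t) / real n\<bar> < d"
      using N[of s n] N[of t n] N[of "s + t" n] by (simp_all add: n_def)
    have "c (s + t) = (\<gamma> (s / real n) \<odot> \<gamma> (t / real n)) [^]\<^bsub>G\<^esub> n"
      using ceq[OF n(1,4)] add[OF n(2,3)] by (simp add: add_divide_distrib)
    also have "\<dots> = \<gamma> (s / real n) [^]\<^bsub>G\<^esub> n \<odot> \<gamma> (t / real n) [^]\<^bsub>G\<^esub> n"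
      using add[OF n(2,3)] add[OF n(3,2)] by (intro pow_mult_distrib) (simp_all add: add.commute)
    finally show ?thesis using ceq[OF n(1,2)] ceq[OF n(1,3)] by simp
  qed
  have c\<gamma>: "c t = \<gamma> t" if "\<bar>t\<bar> < d" for t using ceq[of 1 t] that by simp
  \<comment> \<open>Near \<open>t\<close> the extension is a left translate of the short curve, from
    which it inherits smoothness.\<close>
  have near: "\<forall>\<^sub>F s in nhds t. c t \<odot> \<gamma> (- t + s) = c s" for t
  proof -
    have "\<forall>\<^sub>F s in nhds t. s \<in> ball t d" using d by (intro eventually_nhds_in_open) auto
    then show ?thesis
    proof (rule eventually_mono)
      fix s assume "s \<in> ball t d"
      then have "\<bar>- t + s\<bar> < d" by (simp add: dist_real_def)
      then show "c t \<odot> \<gamma> (- t + s) = c s" using c\<gamma>[of "- t + s"] hom[of t "- t + s"] by simp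
    qed
  qed
  have ic: "integral_curve x (\<lambda>s. c t \<odot> \<gamma> (- t + s)) t" for t
    by (intro integral_curve_translate integral_curve_shift \<gamma>) (use e in simp)
  have smc: "msmooth_at model_atlas atl c t" for t
    using msmooth_at_cong[OF smooth_atlas_model smooth_atl near[of t]] ic[of t] by (simp add: integral_curve_def)
  have "tangent_map model_atlas atl c 0 1 = x"
    using tangent_map_cong[OF smooth_atlas_model smooth_atl near[of 0]] ic[of 0] c\<gamma>[of 0] d by (simp add: integral_curve_def \<gamma>0)
  moreover have "one_parameter_subgroup G c" using smc hom by (simp add: one_parameter_subgroup_iff)
  ultimately show ?thesis using that by blast
qed

text \<open>Scaling time by \<open>t\<close> turns the subgroup with velocity \<open>x\<close> into
  the one with velocity \<open>t *\<^sub>R x\<close>, so the definite descriptions in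
  \<open>lie_exp\<close>, evaluated at 1, trace out a single subgroup.\<close>

lemma lie_exp_curve:
  "one_parameter_subgroup G (\<lambda>t. lie_exp G (t *\<^sub>R x))"
  "tangent_map model_atlas atl (\<lambda>t. lie_exp G (t *\<^sub>R x)) 0 1 = x"
proof -
  obtain c where c: "one_parameter_subgroup G c" "tangent_map model_atlas atl c 0 1 = x"
    using one_parameter_subgroup_exists by blast
  have "lie_exp G (t *\<^sub>R x) = c t" for t
  proof -
    have cs: "msmooth_at model_atlas atl c s" for s using c(1) by (simp add: one_parameter_subgroup_iff)
    have 1: "one_parameter_subgroup G (\<lambda>s. c (t * s))"
      using curve_reparam(1)[of c 0 t] cs c(1) by (simp add: one_parameter_subgroup_iff distrib_left)
    have 2: "tangent_map model_atlas atl (\<lambda>s. c (t * s)) 0 1 = t *\<^sub>R x"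
      using curve_reparam(2)[of c 0 t 0] cs c(2) by simp
    have "(THE c. one_parameter_subgroup G c \<and> tangent_map model_atlas atl c 0 1 = t *\<^sub>R x) = (\<lambda>s. c (t * s))"
      by (rule the_equality) (use 1 2 one_parameter_subgroup_unique in auto)
    then show ?thesis by (simp add: lie_exp_def)
  qed
  then have "(\<lambda>t. lie_exp G (t *\<^sub>R x)) = c" by blast
  with c show "one_parameter_subgroup G (\<lambda>t. lie_exp G (t *\<^sub>R x))"
    "tangent_map model_atlas atl (\<lambda>t. lie_exp G (t *\<^sub>R x)) 0 1 = x" by simp_all
qed

lemma lie_exp_zero [simp]: "lie_exp G 0 = eG"
  using one_parameter_subgroup_zero[OF lie_exp_curve(1), of 0] by simp

lemma lie_exp_minus: "lie_exp G (- t *\<^sub>R x) = ginv (lie_exp G (t *\<^sub>R x))"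
proof -
  have "lie_exp G (t *\<^sub>R x) \<odot> lie_exp G (- t *\<^sub>R x) = lie_exp G ((t + - t) *\<^sub>R x)"
    using lie_exp_curve(1)[of x] unfolding one_parameter_subgroup_iff by metis
  then have "ginv (lie_exp G (t *\<^sub>R x)) \<odot> (lie_exp G (t *\<^sub>R x) \<odot> lie_exp G (- t *\<^sub>R x)) = ginv (lie_exp G (t *\<^sub>R x)) \<odot> eG"
    by simp
  then show ?thesis by simp
qed

end

section \<open>Poisson-Lie groups\<close>

lemma blinfun_compose_id_right [simp]: "f o\<^sub>L id_blinfun = f"
  by (rule blinfun_eqI) simp

lemma blinfun_compose_assoc: "(f o\<^sub>L g) o\<^sub>L h = f o\<^sub>L (g o\<^sub>L h)"
  by (rule blinfun_eqI) simp

lemma msmooth_at_double_sum: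
  assumes A: "smooth_atlas A" and f: "\<And>i j. i \<in> I \<Longrightarrow> j \<in> J \<Longrightarrow> msmooth_at A model_atlas (f i j) p"
  shows "msmooth_at A model_atlas (\<lambda>q. \<Sum>i\<in>I. \<Sum>j\<in>J. f i j q) p"
    "tangent_map A model_atlas (\<lambda>q. \<Sum>i\<in>I. \<Sum>j\<in>J. f i j q) p v =
      (\<Sum>i\<in>I. \<Sum>j\<in>J. tangent_map A model_atlas (f i j) p v)"
proof -
  have i: "msmooth_at A model_atlas (\<lambda>q. \<Sum>j\<in>J. f i j q) p \<and>
      tangent_map A model_atlas (\<lambda>q. \<Sum>j\<in>J. f i j q) p = (\<Sum>j\<in>J. tangent_map A model_atlas (f i j) p)" if "i \<in> I" for i
    by (rule msmooth_at_sum[OF A f[OF that]])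
  show "msmooth_at A model_atlas (\<lambda>q. \<Sum>i\<in>I. \<Sum>j\<in>J. f i j q) p"
    "tangent_map A model_atlas (\<lambda>q. \<Sum>i\<in>I. \<Sum>j\<in>J. f i j q) p v =
      (\<Sum>i\<in>I. \<Sum>j\<in>J. tangent_map A model_atlas (f i j) p v)"
    using msmooth_at_sum[OF A, of I "\<lambda>i q. \<Sum>j\<in>J. f i j q" p] i by (simp_all add: blinfun.sum_left)
qed

lemma dual_expansion: "(\<alpha> :: 'e::euclidean_space dual) = (\<Sum>i\<in>Basis. \<alpha> i *\<^sub>R dual_basis i)"
proof (rule blinfun_eqI)
  fix v
  show "\<alpha> v = blinfun_apply (\<Sum>i\<in>Basis. \<alpha> i *\<^sub>R dual_basis i) v"
    using linear_Basis_sum[OF bounded_linear.linear[OF blinfun.bounded_linear_right], of \<alpha> v]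
    by (simp add: blinfun.sum_left blinfun.scaleR_left mult.commute)
qed

lemma tensor_expansion:
  fixes t :: "'e::euclidean_space tensor2"
  shows "t \<alpha> \<beta> = (\<Sum>i\<in>Basis. \<Sum>j\<in>Basis. t (dual_basis i) (dual_basis j) * (\<alpha> i * \<beta> j))"
proof -
  have "t \<alpha> \<beta> = t (\<Sum>i\<in>Basis. \<alpha> i *\<^sub>R dual_basis i) (\<Sum>j\<in>Basis. \<beta> j *\<^sub>R dual_basis j)"
    by (simp add: dual_expansion[symmetric])
  also have "\<dots> = (\<Sum>i\<in>Basis. \<Sum>j\<in>Basis. t (dual_basis i) (dual_basis j) * (\<alpha> i * \<beta> j))"
    by (simp add: blinfun.sum_left blinfun.sum_right blinfun.scaleR_left blinfun.scaleR_right sum_distrib_left mult_ac)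
       (rule sum.swap)
  finally show ?thesis .
qed

definition tensor_of :: "('e::euclidean_space \<Rightarrow> 'e \<Rightarrow> real) \<Rightarrow> 'e tensor2" where
  "tensor_of c = Blinfun (\<lambda>\<alpha>. \<Sum>i\<in>Basis. \<Sum>j\<in>Basis. (c i j * blinfun_apply \<alpha> i) *\<^sub>R Blinfun (\<lambda>\<beta>. blinfun_apply \<beta> j))"

lemma tensor_of_apply: "tensor_of c \<alpha> \<beta> = (\<Sum>i\<in>Basis. \<Sum>j\<in>Basis. c i j * (\<alpha> i * \<beta> j))"
proof -
  have "bounded_linear (\<lambda>\<alpha> :: 'a dual. \<Sum>i\<in>Basis. \<Sum>j\<in>Basis. (c i j * blinfun_apply \<alpha> i) *\<^sub>R Blinfun (\<lambda>\<beta> :: 'a dual. blinfun_apply \<beta> j))"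
    by (intro bounded_linear_sum bounded_linear_scaleR_const bounded_linear_const_mult blinfun.bounded_linear_left)
  moreover have "Blinfun (\<lambda>\<beta>. blinfun_apply \<beta> j) \<beta> = \<beta> j" for \<beta> :: "'a dual" and j
    by (simp add: bounded_linear_Blinfun_apply blinfun.bounded_linear_left)
  ultimately show ?thesis
    by (simp add: tensor_of_def bounded_linear_Blinfun_apply blinfun.sum_left blinfun.scaleR_left mult.assoc)
qed

lemma tensor_push_apply: "tensor_push L t \<alpha> \<beta> = t (\<alpha> o\<^sub>L L) (\<beta> o\<^sub>L L)"
proof -
  have b: "bounded_linear (\<lambda>\<psi> :: 'a dual. \<psi> o\<^sub>L L)"
    by (rule bounded_bilinear.bounded_linear_left[OF bounded_bilinear_blinfun_compose])
  define K where "K = Blinfun (\<lambda>\<psi> :: 'a dual. \<psi> o\<^sub>L L)"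
  have K: "K \<psi> = \<psi> o\<^sub>L L" for \<psi> unfolding K_def using b by (simp add: bounded_linear_Blinfun_apply)
  have e: "Blinfun (\<lambda>\<psi>. t (\<phi> o\<^sub>L L) (\<psi> o\<^sub>L L)) = t (\<phi> o\<^sub>L L) o\<^sub>L K" for \<phi>
  proof -
    have "(\<lambda>\<psi>. t (\<phi> o\<^sub>L L) (\<psi> o\<^sub>L L)) = blinfun_apply (t (\<phi> o\<^sub>L L) o\<^sub>L K)" by (simp add: K fun_eq_iff)
    then show ?thesis by (simp add: blinfun_apply_inverse)
  qed
  have "bounded_linear (\<lambda>\<phi>. t (\<phi> o\<^sub>L L) o\<^sub>L K)"
    by (rule bounded_linear_compose[OF bounded_bilinear.bounded_linear_left[OF bounded_bilinear_blinfun_compose]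
          bounded_linear_compose[OF blinfun.bounded_linear_right b]])
  then show ?thesis by (simp add: tensor_push_def e bounded_linear_Blinfun_apply K)
qed

section \<open>The Poisson bivector\<close>

locale poisson_lie =
  fixes G :: "('g::{t2_space,second_countable_topology}, 'e::euclidean_space, 'z) poisson_data_scheme"
  assumes plg: "poisson_lie_group G"

sublocale poisson_lie \<subseteq> lie_grp G
  using plg by unfold_locales (simp add: poisson_lie_group_def)

context poisson_lie
begin

abbreviation PB where "PB \<equiv> pb G"

lemma pb_rules:
  assumes "f \<in> C_inf atl" "g \<in> C_inf atl" "h \<in> C_inf atl"
  shows pb_C: "PB f g \<in> C_inf atl"
    and pb_linear1: "PB (\<lambda>p. r * f p + g p) h = (\<lambda>p. r * PB f h p + PB g h p)"
    and pb_antisym: "PB f g = (\<lambda>p. - PB g f p)"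
    and pb_leibniz1: "PB (\<lambda>p. f p * g p) h = (\<lambda>p. f p * PB g h p + PB f h p * g p)"
proof -
  have "poisson_bracket atl PB" using plg by (simp add: poisson_lie_group_def)
  note * = this[unfolded poisson_bracket_def, rule_format, OF assms, of r]
  show "PB f g \<in> C_inf atl" "PB (\<lambda>p. r * f p + g p) h = (\<lambda>p. r * PB f h p + PB g h p)"
    "PB f g = (\<lambda>p. - PB g f p)" "PB (\<lambda>p. f p * g p) h = (\<lambda>p. f p * PB g h p + PB f h p * g p)"
    using * by blast+
qed

lemma pb_rules2:
  assumes "f \<in> C_inf atl" "g \<in> C_inf atl" "h \<in> C_inf atl"
  shows pb_linear2: "PB h (\<lambda>p. r * f p + g p) = (\<lambda>p. r * PB h f p + PB h g p)"
    and pb_leibniz2: "PB h (\<lambda>p. f p * g p) = (\<lambda>p. f p * PB h g p + PB h f p * g p)"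
proof -
  have "(\<lambda>p. r * f p + g p) \<in> C_inf atl" "(\<lambda>p. f p * g p) \<in> C_inf atl"
    using C_inf_algebra(1)[OF C_inf_algebra(5)[OF assms(1,1)] assms(2)] C_inf_algebra(2)[OF assms(1,2)] by auto
  then show "PB h (\<lambda>p. r * f p + g p) = (\<lambda>p. r * PB h f p + PB h g p)"
    "PB h (\<lambda>p. f p * g p) = (\<lambda>p. f p * PB h g p + PB h f p * g p)"
    using pb_antisym[OF assms(3) _ assms(3)] pb_linear1[OF assms] pb_leibniz1[OF assms] assms
    by (simp_all add: fun_eq_iff algebra_simps)
qed

lemma pb_derivation:
  assumes "h \<in> C_inf atl"
  shows "derivation_at atl p (\<lambda>f. PB f h p)" "derivation_at atl p (\<lambda>f. PB h f p)"
  unfolding derivation_at_def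
  using pb_linear1 pb_leibniz1 pb_linear2 pb_leibniz2 assms by (simp_all add: mult.commute)

text \<open>The bracket is a derivation in each argument; evaluating both in turn on the coordinate
  functions expresses it through the differentials.\<close>

lemma coordinates_pb:
  obtains u :: "'e \<Rightarrow> 'g \<Rightarrow> real" where "\<And>i. u i \<in> C_inf atl"
    "\<And>i. \<forall>\<^sub>F q in nhds p. u i q = (chart_fun atl p q - chart_fun atl p p) \<bullet> i"
    "\<And>f h. f \<in> C_inf atl \<Longrightarrow> h \<in> C_inf atl \<Longrightarrow>
      PB f h p = (\<Sum>i\<in>Basis. \<Sum>j\<in>Basis. PB (u i) (u j) p * (differential atl f p i * differential atl h p j))"
proof -
  obtain u :: "'e \<Rightarrow> 'g \<Rightarrow> real" where u: "\<And>i. u i \<in> C_inf atl"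
    "\<And>i. \<forall>\<^sub>F q in nhds p. u i q = (chart_fun atl p q - chart_fun atl p p) \<bullet> i"
    "\<And>W f. derivation_at atl p W \<Longrightarrow> f \<in> C_inf atl \<Longrightarrow> W f = (\<Sum>i\<in>Basis. differential atl f p i * W (u i))"
    by (rule coordinate_functions[OF smooth_atl, of p]) (rule that)
  have "PB f h p = (\<Sum>i\<in>Basis. \<Sum>j\<in>Basis. PB (u i) (u j) p * (differential atl f p i * differential atl h p j))"
    if f: "f \<in> C_inf atl" and h: "h \<in> C_inf atl" for f h
  proof -
    have "PB f h p = (\<Sum>i\<in>Basis. differential atl f p i * PB (u i) h p)"
      by (rule u(3)[OF pb_derivation(1)[OF h] f])
    also have "\<dots> = (\<Sum>i\<in>Basis. differential atl f p i * (\<Sum>j\<in>Basis. differential atl h p j * PB (u i) (u j) p))"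
      by (intro sum.cong refl arg_cong2[of _ _ _ _ "(*)"] u(3)[OF pb_derivation(2)[OF u(1)] h])
    finally show ?thesis by (simp add: sum_distrib_left mult_ac)
  qed
  with u show ?thesis using that by blast
qed

text \<open>Lets identities between brackets of functions be read as identities between
  tensors.\<close>

lemma covector_realized:
  obtains f where "f \<in> C_inf atl" "differential atl f p = \<alpha>"
proof -
  obtain u :: "'e \<Rightarrow> 'g \<Rightarrow> real" where u: "\<And>i. u i \<in> C_inf atl"
    "\<And>i. \<forall>\<^sub>F q in nhds p. u i q = (chart_fun atl p q - chart_fun atl p p) \<bullet> i"
    by (rule coordinate_functions[OF smooth_atl, of p]) (rule that)
  have s: "msmooth_at atl model_atlas (\<lambda>q. \<alpha> i * u i q) q"
    "differential atl (\<lambda>q. \<alpha> i * u i q) p v = \<alpha> i * (v \<bullet> i)" for i q v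
    using msmooth_at_linear[OF bounded_linear_mult_right smooth_atl C_infD[OF u(1)]] differential_coordinate(2)[OF smooth_atl u(2)] by auto
  have "(\<lambda>q. \<Sum>i\<in>Basis. \<alpha> i * u i q) \<in> C_inf atl"
    using msmooth_at_sum[OF smooth_atl, of Basis "\<lambda>i q. \<alpha> i * u i q"] s(1) by (simp add: C_inf_iff)
  moreover have "differential atl (\<lambda>q. \<Sum>i\<in>Basis. \<alpha> i * u i q) p = \<alpha>"
  proof (rule blinfun_eqI)
    fix v
    have "differential atl (\<lambda>q. \<Sum>i\<in>Basis. \<alpha> i * u i q) p v = (\<Sum>i\<in>Basis. \<alpha> i * (v \<bullet> i))"
      using msmooth_at_sum[OF smooth_atl, of Basis "\<lambda>i q. \<alpha> i * u i q"] s by (simp add: blinfun.sum_left)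
    also have "\<dots> = \<alpha> v"
      using linear_Basis_sum[OF bounded_linear.linear[OF blinfun.bounded_linear_right], of \<alpha> v] by (simp add: mult.commute)
    finally show "differential atl (\<lambda>q. \<Sum>i\<in>Basis. \<alpha> i * u i q) p v = \<alpha> v" .
  qed
  ultimately show ?thesis by (rule that)
qed

text \<open>The definite description in \<open>bivector\<close> is met by the tensor whose
  components are the brackets of coordinates, and by no other, because differentials exhaust the
  covectors.\<close>

lemma bivector_pb:
  assumes "f \<in> C_inf atl" "h \<in> C_inf atl"
  shows "bivector G p (differential atl f p) (differential atl h p) = PB f h p"
proof -
  let ?P = "\<lambda>t :: 'e tensor2. \<forall>f\<in>C_inf atl. \<forall>h\<in>C_inf atl. PB f h p = t (differential atl f p) (differential atl h p)"
  obtain u where u: "\<And>f h. f \<in> C_inf atl \<Longrightarrow> h \<in> C_inf atl \<Longrightarrow>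
      PB f h p = (\<Sum>i\<in>Basis. \<Sum>j\<in>Basis. PB (u i) (u j) p * (differential atl f p i * differential atl h p j))"
    by (rule coordinates_pb[of p]) (rule that)
  have ex: "?P (tensor_of (\<lambda>i j. PB (u i) (u j) p))" using u by (simp add: tensor_of_apply)
  have un: "t = t'" if "?P t" "?P t'" for t t'
  proof (intro blinfun_eqI)
    fix \<alpha> \<beta> :: "'e dual"
    obtain f where f: "f \<in> C_inf atl" "differential atl f p = \<alpha>" by (rule covector_realized)
    obtain h where h: "h \<in> C_inf atl" "differential atl h p = \<beta>" by (rule covector_realized)
    from that f h show "t \<alpha> \<beta> = t' \<alpha> \<beta>" by metis
  qed
  have "?P (THE t. ?P t)"
    by (rule theI[where P = ?P, OF ex]) (rule un[OF _ ex])
  with assms show ?thesis by (simp add: bivector_def)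
qed

lemma bivector_antisym: "bivector G p \<alpha> \<beta> = - bivector G p \<beta> \<alpha>"
proof -
  obtain f where "f \<in> C_inf atl" "differential atl f p = \<alpha>" by (rule covector_realized)
  moreover obtain h where "h \<in> C_inf atl" "differential atl h p = \<beta>" by (rule covector_realized)
  ultimately show ?thesis using bivector_pb[of f h p] bivector_pb[of h f p] pb_antisym[of f h f] by simp
qed

text \<open>The Poisson property of the multiplication in tensor form: each half of the product
  bracket sees one factor through a translation.\<close>

lemma bivector_mult:
  "bivector G (g \<odot> k) \<alpha> \<beta> =
     bivector G g (\<alpha> o\<^sub>L tangent_map atl atl (\<lambda>h. h \<odot> k) g) (\<beta> o\<^sub>L tangent_map atl atl (\<lambda>h. h \<odot> k) g) +
     bivector G k (\<alpha> o\<^sub>L tangent_map atl atl (\<lambda>h. g \<odot> h) k) (\<beta> o\<^sub>L tangent_map atl atl (\<lambda>h. g \<odot> h) k)"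
proof -
  obtain f where f: "f \<in> C_inf atl" "differential atl f (g \<odot> k) = \<alpha>" by (rule covector_realized)
  obtain h where h: "h \<in> C_inf atl" "differential atl h (g \<odot> k) = \<beta>" by (rule covector_realized)
  note fh = f h
  have "prod_pb PB (f \<circ> (\<lambda>(g, h). g \<odot> h)) (h \<circ> (\<lambda>(g, h). g \<odot> h)) (g, k) = (PB f h \<circ> (\<lambda>(g, h). g \<odot> h)) (g, k)"
    using plg fh(1,3) unfolding poisson_lie_group_def Let_def by metis
  then have "PB f h (g \<odot> k) = PB (\<lambda>p. f (p \<odot> k)) (\<lambda>p. h (p \<odot> k)) g + PB (\<lambda>p. f (g \<odot> p)) (\<lambda>p. h (g \<odot> p)) k"
    by (simp add: prod_pb_def)
  moreover have s: "msmooth_at atl atl (\<lambda>h. h \<odot> k) g" "msmooth_at atl atl (\<lambda>h. g \<odot> h) k" by (intro group_smooth)+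
  have "differential atl (\<lambda>p. f (p \<odot> k)) g = differential atl f (g \<odot> k) o\<^sub>L tangent_map atl atl (\<lambda>h. h \<odot> k) g"
    "differential atl (\<lambda>p. f (g \<odot> p)) k = differential atl f (g \<odot> k) o\<^sub>L tangent_map atl atl (\<lambda>h. g \<odot> h) k"
    if "f \<in> C_inf atl" for f
    using tangent_map_compose[OF smooth_atl smooth_atl smooth_atlas_model C_infD[OF that]] s by blast+
  ultimately show ?thesis
    using fh by (simp add: bivector_pb[symmetric] C_inf_translate)
qed

section \<open>The left-trivialised Poisson tensor\<close>

abbreviation DV where "DV \<equiv> D_vee G"

lemma DV_apply:
  "DV g \<alpha> \<beta> = bivector G g (\<alpha> o\<^sub>L tangent_map atl atl (\<lambda>h. ginv g \<odot> h) g) (\<beta> o\<^sub>L tangent_map atl atl (\<lambda>h. ginv g \<odot> h) g)"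
  by (simp add: D_vee_def tensor_push_apply)

text \<open>In left trivialisation the contribution of the second factor is unchanged, while that of
  the first is conjugated by the inverse of \<open>k\<close>. At the unit this cocycle rule forces
  the tensor to vanish.\<close>

lemma DV_mult: "DV (g \<odot> k) \<alpha> \<beta> = DV g (\<alpha> o\<^sub>L Ad G (ginv k)) (\<beta> o\<^sub>L Ad G (ginv k)) + DV k \<alpha> \<beta>"
proof -
  have 1: "\<alpha> o\<^sub>L tangent_map atl atl (\<lambda>h. ginv (g \<odot> k) \<odot> h) (g \<odot> k) o\<^sub>L tangent_map atl atl (\<lambda>h. h \<odot> k) g =
      \<alpha> o\<^sub>L Ad G (ginv k) o\<^sub>L tangent_map atl atl (\<lambda>h. ginv g \<odot> h) g" for \<alpha> :: "'e dual"
  proof -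
    have "msmooth_at atl atl (\<lambda>h. ginv (g \<odot> k) \<odot> h) (g \<odot> k)" "msmooth_at atl atl (\<lambda>h. h \<odot> k) g" by (intro group_smooth)+
    note a = tangent_map_compose[OF smooth_atl smooth_atl smooth_atl this]
    have "msmooth_at atl atl (\<lambda>h. ginv k \<odot> h \<odot> ginv (ginv k)) (ginv g \<odot> g)" "msmooth_at atl atl (\<lambda>h. ginv g \<odot> h) g" by (intro group_smooth)+
    note b = tangent_map_compose[OF smooth_atl smooth_atl smooth_atl this]
    have "(\<lambda>h. ginv (g \<odot> k) \<odot> (h \<odot> k)) = (\<lambda>h. ginv k \<odot> (ginv g \<odot> h) \<odot> ginv (ginv k))"
      by (simp add: ginv_mult m_assoc)
    with a b have "tangent_map atl atl (\<lambda>h. ginv (g \<odot> k) \<odot> h) (g \<odot> k) o\<^sub>L tangent_map atl atl (\<lambda>h. h \<odot> k) g =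
        Ad G (ginv k) o\<^sub>L tangent_map atl atl (\<lambda>h. ginv g \<odot> h) g"
      unfolding Ad_def by simp
    then show ?thesis by (simp add: blinfun_compose_assoc)
  qed
  have 2: "\<alpha> o\<^sub>L tangent_map atl atl (\<lambda>h. ginv (g \<odot> k) \<odot> h) (g \<odot> k) o\<^sub>L tangent_map atl atl (\<lambda>h. g \<odot> h) k =
      \<alpha> o\<^sub>L tangent_map atl atl (\<lambda>h. ginv k \<odot> h) k" for \<alpha> :: "'e dual"
  proof -
    have "msmooth_at atl atl (\<lambda>h. ginv (g \<odot> k) \<odot> h) (g \<odot> k)" "msmooth_at atl atl (\<lambda>h. g \<odot> h) k" by (intro group_smooth)+
    note a = tangent_map_compose[OF smooth_atl smooth_atl smooth_atl this]
    have "(\<lambda>h. ginv (g \<odot> k) \<odot> (g \<odot> h)) = (\<lambda>h. ginv k \<odot> h)" by (simp add: ginv_mult m_assoc)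
    with a show ?thesis by (simp add: blinfun_compose_assoc)
  qed
  show ?thesis unfolding DV_apply[of "g \<odot> k"] bivector_mult 1 2 by (simp add: DV_apply)
qed

lemma DV_unit [simp]: "DV eG \<alpha> \<beta> = 0"
  using DV_mult[of eG eG \<alpha> \<beta>] by simp

lemma DV_antisym: "DV g \<alpha> \<beta> = - DV g \<beta> \<alpha>"
  unfolding DV_apply by (rule bivector_antisym)

end

context lie_grp
begin

text \<open>The coordinate fields of one chart, transported to the unit. Both the translation and
  the point of differentiation move with \<open>g\<close>, hence the moving base point in
  \<open>param_derivative_smooth\<close>.\<close>

lemma left_trivialization_smooth:
  assumes c: "(U, \<phi>) \<in> atl" and g0: "g0 \<in> U"
  shows "msmooth_at atl model_atlas (\<lambda>g. tangent_map atl atl (\<lambda>h. ginv g \<odot> h) g (tangent_map model_atlas atl (inv_into U \<phi>) (\<phi> g) v)) g0"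
proof -
  let ?c = "chart_fun atl eG"
  note d = smooth_atlasD[OF smooth_atl c]
  have ins: "msmooth_at model_atlas atl (inv_into U \<phi>) (\<phi> g)" if "g \<in> U" for g by (rule chart_msmooth(2)[OF smooth_atl c that])
  have "msmooth_at (prod_atlas atl model_atlas) model_atlas (\<lambda>z. ?c (ginv (fst z) \<odot> inv_into U \<phi> (snd z))) (g0, \<phi> g0)"
  proof (rule msmooth_at_compose[of _ atl])
    have "msmooth_at (prod_atlas atl model_atlas) atl (\<lambda>z. inv_into U \<phi> (snd z)) (g0, \<phi> g0)"
      by (rule msmooth_at_compose[of _ model_atlas]) (use ins[OF g0] in \<open>auto simp: msmooth_at_fst\<close>)
    then show "msmooth_at (prod_atlas atl model_atlas) atl (\<lambda>z. ginv (fst z) \<odot> inv_into U \<phi> (snd z)) (g0, \<phi> g0)"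
      by (intro group_smooth) (simp_all add: msmooth_at_fst)
    show "msmooth_at atl model_atlas ?c (ginv (fst (g0, \<phi> g0)) \<odot> inv_into U \<phi> (snd (g0, \<phi> g0)))"
      using chart_msmooth(1)[OF smooth_atl chart_at_mem[OF smooth_atl]] g0 d(5) by simp
  qed auto
  from param_derivative_smooth[OF smooth_atl this chart_msmooth(1)[OF smooth_atl c g0], of v]
  have s: "msmooth_at atl model_atlas (\<lambda>g. frechet_derivative (\<lambda>y. ?c (ginv g \<odot> inv_into U \<phi> y)) (at (\<phi> g)) v) g0" by simp
  have "\<forall>\<^sub>F g in nhds g0. frechet_derivative (\<lambda>y. ?c (ginv g \<odot> inv_into U \<phi> y)) (at (\<phi> g)) v =
      tangent_map atl atl (\<lambda>h. ginv g \<odot> h) g (tangent_map model_atlas atl (inv_into U \<phi>) (\<phi> g) v)"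
    using chart_isCont(3)[OF smooth_atl c g0]
  proof (rule eventually_mono)
    fix g assume g: "g \<in> U"
    have gi: "inv_into U \<phi> (\<phi> g) = g" using d(5) g by simp
    have l: "msmooth_at atl atl (\<lambda>h. ginv g \<odot> h) (inv_into U \<phi> (\<phi> g))" by (intro group_smooth)
    have m: "msmooth_at model_atlas atl (\<lambda>y. ginv g \<odot> inv_into U \<phi> y) (\<phi> g)"
      by (rule msmooth_at_compose[OF _ smooth_atl smooth_atl l ins[OF g]]) simp
    from frechet_derivative_at[OF tangent_map_has_derivative[OF _ smooth_atl m]]
    have "tangent_map model_atlas atl (\<lambda>y. ginv g \<odot> inv_into U \<phi> y) (\<phi> g) v =
        frechet_derivative (\<lambda>y. ?c (ginv g \<odot> inv_into U \<phi> y)) (at (\<phi> g)) v"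
      by (simp add: gi)
    moreover have "tangent_map model_atlas atl (\<lambda>y. ginv g \<odot> inv_into U \<phi> y) (\<phi> g) v =
        tangent_map atl atl (\<lambda>h. ginv g \<odot> h) g (tangent_map model_atlas atl (inv_into U \<phi>) (\<phi> g) v)"
      using tangent_map_compose_apply[OF _ smooth_atl smooth_atl l ins[OF g], of v] by (simp add: gi)
    ultimately show "frechet_derivative (\<lambda>y. ?c (ginv g \<odot> inv_into U \<phi> y)) (at (\<phi> g)) v =
      tangent_map atl atl (\<lambda>h. ginv g \<odot> h) g (tangent_map model_atlas atl (inv_into U \<phi>) (\<phi> g) v)" by simp
  qed
  from msmooth_at_cong[OF smooth_atl smooth_atlas_model this s] show ?thesis .
qed

text \<open>Obtained by differentiating the constant product of \<open>g\<close> and its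
  inverse.\<close>

lemma tangent_ginv_unit: "tangent_map atl atl (\<lambda>g. ginv g) eG x = - x"
proof -
  have "msmooth_at (prod_atlas atl atl) atl (\<lambda>z. fst z \<odot> snd z) (eG, ginv eG)" "msmooth_at atl atl (\<lambda>g. ginv g) eG"
    by (intro group_smooth)+
  from tangent_map_two_variables[OF smooth_atl smooth_atl smooth_atl smooth_atl this(1) msmooth_id this(2), of x]
  have "tangent_map atl atl (\<lambda>g. eG) eG x = tangent_map atl atl (\<lambda>g. g) eG x + tangent_map atl atl (\<lambda>g. g) eG (tangent_map atl atl (\<lambda>g. ginv g) eG x)"
    by (simp add: tangent_map_id)
  then have "x + tangent_map atl atl (\<lambda>g. ginv g) eG x = 0"
    by (simp add: tangent_map_id tangent_map_const)
  then show ?thesis by (simp add: eq_neg_iff_add_eq_0 add.commute)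
qed

end

context poisson_lie
begin

text \<open>Near the unit a translated covector is expanded in the differentials of the global
  coordinate functions, so the tensor becomes a sum of smooth coefficients times brackets. The
  cocycle rule of the defect later carries smoothness away from the unit.\<close>

lemma DV_smooth: "msmooth_at atl model_atlas (\<lambda>g. DV g \<alpha> \<beta>) eG"
proof -
  let ?\<phi> = "chart_fun atl eG" let ?U = "chart_dom atl eG"
  note c = chart_at_mem[OF smooth_atl, of eG]
  obtain u where u: "\<And>i. u i \<in> C_inf atl"
    "\<And>i. \<forall>\<^sub>F q in nhds eG. u i q = (chart_fun atl eG q - chart_fun atl eG eG) \<bullet> i"
    by (rule coordinates_pb[of eG]) (rule that)
  define T where "T = (\<lambda>i g. tangent_map atl atl (\<lambda>h. ginv g \<odot> h) g (tangent_map model_atlas atl (inv_into ?U ?\<phi>) (?\<phi> g) i))"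
  have Ts: "msmooth_at atl model_atlas (\<lambda>g. blinfun_apply \<alpha> (T i g)) eG" for \<alpha> :: "'e dual" and i
    unfolding T_def by (rule msmooth_at_linear(1)[OF blinfun.bounded_linear_right smooth_atl left_trivialization_smooth[OF c]])
  have "\<forall>\<^sub>F g in nhds eG. \<forall>i\<in>Basis. \<forall>v. differential atl (u i) g v = tangent_map atl model_atlas ?\<phi> g v \<bullet> i"
    using differential_coordinate(1)[OF smooth_atl u(2)] by (simp add: eventually_ball_finite)
  with chart_isCont(3)[OF smooth_atl c]
  have "\<forall>\<^sub>F g in nhds eG. g \<in> ?U \<and> (\<forall>i\<in>Basis. \<forall>v. differential atl (u i) g v = tangent_map atl model_atlas ?\<phi> g v \<bullet> i)"
    by (rule eventually_conj)
  then have "\<forall>\<^sub>F g in nhds eG. (\<Sum>i\<in>Basis. \<Sum>j\<in>Basis. (\<alpha> (T i g) * \<beta> (T j g)) * PB (u i) (u j) g) = DV g \<alpha> \<beta>"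
  proof (rule eventually_mono)
    fix g assume g: "g \<in> ?U \<and> (\<forall>i\<in>Basis. \<forall>v. differential atl (u i) g v = tangent_map atl model_atlas ?\<phi> g v \<bullet> i)"
    have cov: "\<alpha> o\<^sub>L tangent_map atl atl (\<lambda>h. ginv g \<odot> h) g = (\<Sum>i\<in>Basis. \<alpha> (T i g) *\<^sub>R differential atl (u i) g)" for \<alpha> :: "'e dual"
    proof (rule blinfun_eqI)
      fix v
      define w where "w = tangent_map atl model_atlas ?\<phi> g v"
      let ?L = "\<alpha> o\<^sub>L tangent_map atl atl (\<lambda>h. ginv g \<odot> h) g o\<^sub>L tangent_map model_atlas atl (inv_into ?U ?\<phi>) (?\<phi> g)"
      have "(\<alpha> o\<^sub>L tangent_map atl atl (\<lambda>h. ginv g \<odot> h) g) v = ?L w"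
        using chart_tangent_inverse[OF c(1), of g v] g by (simp add: w_def)
      also have "\<dots> = (\<Sum>i\<in>Basis. (w \<bullet> i) *\<^sub>R ?L i)"
        by (rule linear_Basis_sum[OF bounded_linear.linear[OF blinfun.bounded_linear_right]])
      also have "\<dots> = (\<Sum>i\<in>Basis. \<alpha> (T i g) *\<^sub>R differential atl (u i) g) v"
        using g by (simp add: T_def w_def blinfun.sum_left blinfun.scaleR_left mult.commute)
      finally show "(\<alpha> o\<^sub>L tangent_map atl atl (\<lambda>h. ginv g \<odot> h) g) v = (\<Sum>i\<in>Basis. \<alpha> (T i g) *\<^sub>R differential atl (u i) g) v" .
    qed
    show "(\<Sum>i\<in>Basis. \<Sum>j\<in>Basis. (\<alpha> (T i g) * \<beta> (T j g)) * PB (u i) (u j) g) = DV g \<alpha> \<beta>"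
      unfolding DV_apply cov
      by (simp add: blinfun.sum_left blinfun.sum_right blinfun.scaleR_left blinfun.scaleR_right bivector_pb u(1)
          sum_distrib_left mult_ac) (rule sum.swap)
  qed
  moreover have "msmooth_at atl model_atlas (\<lambda>g. \<Sum>i\<in>Basis. \<Sum>j\<in>Basis. (\<alpha> (T i g) * \<beta> (T j g)) * PB (u i) (u j) g) eG"
    by (intro msmooth_at_sum[OF smooth_atl, THEN conjunct1] msmooth_at_mult smooth_atl Ts C_infD pb_C[OF u(1) u(1) u(1)])
  ultimately show ?thesis by (rule msmooth_at_cong[OF smooth_atl smooth_atlas_model])
qed

lemma right_trivialization:
  "tensor_push (tangent_map atl atl (\<lambda>h. h \<odot> ginv g) g) (bivector G g) \<alpha> \<beta> = DV g (\<alpha> o\<^sub>L Ad G g) (\<beta> o\<^sub>L Ad G g)"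
proof -
  have "msmooth_at atl atl (\<lambda>h. g \<odot> h \<odot> ginv g) (ginv g \<odot> g)" "msmooth_at atl atl (\<lambda>h. ginv g \<odot> h) g" by (intro group_smooth)+
  from tangent_map_compose[OF smooth_atl smooth_atl smooth_atl this]
  have "tangent_map atl atl (\<lambda>h. h \<odot> ginv g) g = Ad G g o\<^sub>L tangent_map atl atl (\<lambda>h. ginv g \<odot> h) g"
    by (simp add: Ad_def)
  then show ?thesis by (simp add: tensor_push_apply DV_apply blinfun_compose_assoc)
qed

text \<open>The right-trivialised tensor is the left-trivialised one conjugated by
  \<open>Ad\<close>. In the product rule the derivative of \<open>Ad\<close> is multiplied by the
  tensor at the unit, which is zero, so to first order the choice of trivialisation does not
  matter.\<close>

lemma cobracket_apply: "cobracket G x \<alpha> \<beta> = differential atl (\<lambda>g. DV g \<alpha> \<beta>) eG x"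
proof -
  define d where "d = (\<lambda>i j. differential atl (\<lambda>g. DV g (dual_basis i) (dual_basis j)) eG x)"
  define R where "R = (\<lambda>i j g. DV g (dual_basis i o\<^sub>L Ad G g) (dual_basis j o\<^sub>L Ad G g))"
  have As: "msmooth_at atl model_atlas (\<lambda>g. Ad G g k \<bullet> i) eG" for k i
    by (rule msmooth_at_linear(1)[OF bounded_linear_inner_left smooth_atl Ad_smooth])
  have R: "R i j = (\<lambda>g. \<Sum>k\<in>Basis. \<Sum>l\<in>Basis. DV g (dual_basis k) (dual_basis l) * ((Ad G g k \<bullet> i) * (Ad G g l \<bullet> j)))" for i j
    unfolding R_def by (subst tensor_expansion) simp
  have terms: "msmooth_at atl model_atlas (\<lambda>g. DV g (dual_basis k) (dual_basis l) * ((Ad G g k \<bullet> i) * (Ad G g l \<bullet> j))) eG"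
    "differential atl (\<lambda>g. DV g (dual_basis k) (dual_basis l) * ((Ad G g k \<bullet> i) * (Ad G g l \<bullet> j))) eG x =
       d k l * ((k \<bullet> i) * (l \<bullet> j))" for k l i j
    using msmooth_at_mult[OF smooth_atl DV_smooth msmooth_at_mult[OF smooth_atl As As]]
      tangent_map_mult[OF smooth_atl DV_smooth msmooth_at_mult[OF smooth_atl As As]] by (simp_all add: d_def)
  have Rs: "msmooth_at atl model_atlas (R i j) eG" for i j
    unfolding R by (rule msmooth_at_double_sum(1)[OF smooth_atl terms(1)])
  have dR: "differential atl (R i j) eG x = d i j" if "i \<in> Basis" "j \<in> Basis" for i j
  proof -
    have "differential atl (R i j) eG x = (\<Sum>k\<in>Basis. \<Sum>l\<in>Basis. d k l * ((k \<bullet> i) * (l \<bullet> j)))"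
      unfolding R terms(2)[symmetric] by (rule msmooth_at_double_sum(2)[OF smooth_atl terms(1)])
    also have "\<dots> = (\<Sum>k\<in>Basis. \<Sum>l\<in>Basis. if l = j then (if k = i then d k l else 0) else 0)"
      using that by (intro sum.cong refl) (auto simp: inner_Basis)
    also have "\<dots> = d i j" using that by simp
    finally show ?thesis .
  qed
  define c where "c = (\<lambda>t. lie_exp G (t *\<^sub>R x))"
  have cs: "msmooth_at model_atlas atl c 0" "tangent_map model_atlas atl c 0 1 = x" "c 0 = eG"
    using lie_exp_curve[of x] by (simp_all add: c_def one_parameter_subgroup_iff)
  have vd: "((\<lambda>t. R i j (c t)) has_vector_derivative d i j) (at 0)" if "i \<in> Basis" "j \<in> Basis" for i j
  proof -
    have Rc: "msmooth_at atl model_atlas (R i j) (c 0)" using Rs cs(3) by simp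
    have "smooth_pt (\<lambda>t. R i j (c t)) 0"
      using msmooth_at_compose[OF _ smooth_atl smooth_atlas_model Rc cs(1)] by simp
    note hd = smooth_pt_has_derivative[OF this]
    have "frechet_derivative (\<lambda>t. R i j (c t)) (at 0) v = v *\<^sub>R d i j" for v
    proof -
      have "frechet_derivative (\<lambda>t. R i j (c t)) (at 0) v = frechet_derivative (\<lambda>t. R i j (c t)) (at 0) (v *\<^sub>R 1)" by simp
      also have "\<dots> = v *\<^sub>R frechet_derivative (\<lambda>t. R i j (c t)) (at 0) 1"
        by (rule linear_scale[OF bounded_linear.linear[OF has_derivative_bounded_linear[OF hd]]])
      also have "frechet_derivative (\<lambda>t. R i j (c t)) (at 0) 1 = d i j"
        using tangent_map_compose_apply[OF _ smooth_atl smooth_atlas_model Rc cs(1), of 1] dR[OF that] cs(2,3)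
        by (simp add: tangent_map_model_apply \<open>smooth_pt (\<lambda>t. R i j (c t)) 0\<close>)
      finally show ?thesis .
    qed
    then have "frechet_derivative (\<lambda>t. R i j (c t)) (at 0) = (\<lambda>v. v *\<^sub>R d i j)" by blast
    with hd show ?thesis by (simp add: has_vector_derivative_def)
  qed
  \<comment> \<open>The elementary tensors of basis vectors. With them the path in the definition of
    \<open>cobracket\<close> is a combination of fixed tensors with real coefficient
    functions.\<close>
  define E where "E = (\<lambda>i j :: 'e. tensor_of (\<lambda>k l. (if k = i then 1 else 0) * (if l = j then 1 else 0)))"
  have E: "E i j \<alpha> \<beta> = \<alpha> i * \<beta> j" if "i \<in> Basis" "j \<in> Basis" for i j and \<alpha> \<beta> :: "'e dual"
  proof -
    have "E i j \<alpha> \<beta> = (\<Sum>k\<in>Basis. \<Sum>l\<in>Basis. if l = j then (if k = i then \<alpha> k * \<beta> l else 0) else 0)"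
      unfolding E_def tensor_of_apply by (intro sum.cong refl) auto
    then show ?thesis using that by simp
  qed
  have "tensor_push (tangent_map atl atl (\<lambda>h. h \<odot> lie_exp G (- t *\<^sub>R x)) (lie_exp G (t *\<^sub>R x))) (bivector G (lie_exp G (t *\<^sub>R x))) =
      (\<Sum>i\<in>Basis. \<Sum>j\<in>Basis. R i j (c t) *\<^sub>R E i j)" for t
    unfolding lie_exp_minus
    by (intro blinfun_eqI, subst tensor_expansion)
       (simp add: right_trivialization R_def c_def blinfun.sum_left blinfun.scaleR_left E)
  moreover have "((\<lambda>t. \<Sum>i\<in>Basis. \<Sum>j\<in>Basis. R i j (c t) *\<^sub>R E i j) has_vector_derivative (\<Sum>i\<in>Basis. \<Sum>j\<in>Basis. d i j *\<^sub>R E i j)) (at 0)"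
  proof (intro has_vector_derivative_sum)
    fix i j :: 'e assume "i \<in> Basis" "j \<in> Basis"
    from has_vector_derivative_scaleR[OF vd[OF this, folded has_real_derivative_iff_has_vector_derivative] has_vector_derivative_const]
    show "((\<lambda>t. R i j (c t) *\<^sub>R E i j) has_vector_derivative d i j *\<^sub>R E i j) (at 0)" by simp
  qed
  ultimately have "cobracket G x = (\<Sum>i\<in>Basis. \<Sum>j\<in>Basis. d i j *\<^sub>R E i j)"
    by (simp add: cobracket_def vector_derivative_at)
  then have 1: "cobracket G x \<alpha> \<beta> = (\<Sum>i\<in>Basis. \<Sum>j\<in>Basis. d i j * (\<alpha> i * \<beta> j))"
    by (simp add: blinfun.sum_left blinfun.scaleR_left E)
  have t2: "msmooth_at atl model_atlas (\<lambda>g. DV g (dual_basis i) (dual_basis j) * (\<alpha> i * \<beta> j)) eG"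
    "differential atl (\<lambda>g. DV g (dual_basis i) (dual_basis j) * (\<alpha> i * \<beta> j)) eG x = d i j * (\<alpha> i * \<beta> j)" for i j
    using msmooth_at_linear[OF bounded_linear_mult_left smooth_atl DV_smooth] by (auto simp: d_def)
  have e: "(\<lambda>g. DV g \<alpha> \<beta>) = (\<lambda>g. \<Sum>i\<in>Basis. \<Sum>j\<in>Basis. DV g (dual_basis i) (dual_basis j) * (\<alpha> i * \<beta> j))"
    by (rule ext) (rule tensor_expansion)
  show ?thesis
    unfolding 1 e t2(2)[symmetric] by (rule msmooth_at_double_sum(2)[OF smooth_atl t2(1), symmetric])
qed

lemma cobracket_antisym: "cobracket G x \<alpha> \<beta> = - cobracket G x \<beta> \<alpha>"
proof -
  have "(\<lambda>g. DV g \<alpha> \<beta>) = (\<lambda>g. - DV g \<beta> \<alpha>)" using DV_antisym by blast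
  then show ?thesis
    using msmooth_at_linear(2)[OF bounded_linear_minus[OF bounded_linear_ident] smooth_atl DV_smooth, of \<beta> \<alpha> x]
    by (simp add: cobracket_apply)
qed

lemma bounded_linear_cobracket: "bounded_linear (\<lambda>x. cobracket G x \<alpha> \<beta>)"
  by (simp add: cobracket_apply blinfun.bounded_linear_right)

end

section \<open>Preconnections and bicovariance\<close>

text \<open>Moves the smoothness condition from the chart image to the manifold, so that the
  calculus of \<open>msmooth_at\<close> gives the module structure of the 1-forms.\<close>

lemma one_forms_iff:
  fixes A :: "('m::t2_space, 'e::euclidean_space) chart set"
  assumes A: "smooth_atlas A"
  shows "\<tau> \<in> one_forms A \<longleftrightarrow> (\<forall>(U, \<phi>)\<in>A. \<forall>g\<in>U. \<forall>v.
    msmooth_at A model_atlas (\<lambda>g. \<tau> g (tangent_map model_atlas A (inv_into U \<phi>) (\<phi> g) v)) g)"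
proof -
  have "smooth_pt (\<lambda>q. \<tau> (inv_into U \<phi> q) (tangent_map model_atlas A (inv_into U \<phi>) q v)) (\<phi> g) \<longleftrightarrow>
      msmooth_at A model_atlas (\<lambda>g. \<tau> g (tangent_map model_atlas A (inv_into U \<phi>) (\<phi> g) v)) g" (is "?l \<longleftrightarrow> ?r")
    if c: "(U, \<phi>) \<in> A" and g: "g \<in> U" for U \<phi> g v
  proof
    note d = smooth_atlasD[OF A c]
    assume ?l
    then have "msmooth_at A model_atlas (\<lambda>g. \<tau> (inv_into U \<phi> (\<phi> g)) (tangent_map model_atlas A (inv_into U \<phi>) (\<phi> g) v)) g"
      by (intro msmooth_at_compose[OF A smooth_atlas_model smooth_atlas_model _ chart_msmooth(1)[OF A c g],
            of "\<lambda>q. \<tau> (inv_into U \<phi> q) (tangent_map model_atlas A (inv_into U \<phi>) q v)"]) simp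
    moreover have "\<forall>\<^sub>F g in nhds g. \<tau> (inv_into U \<phi> (\<phi> g)) (tangent_map model_atlas A (inv_into U \<phi>) (\<phi> g) v) =
        \<tau> g (tangent_map model_atlas A (inv_into U \<phi>) (\<phi> g) v)"
      using chart_isCont(3)[OF A c g] by (rule eventually_mono) (simp add: d(5))
    ultimately show ?r by (rule msmooth_at_cong[OF A smooth_atlas_model, rotated])
  next
    note d = smooth_atlasD[OF A c]
    assume r: ?r
    have gi: "inv_into U \<phi> (\<phi> g) = g" using d(5) g by simp
    have "msmooth_at model_atlas model_atlas
        (\<lambda>q. \<tau> (inv_into U \<phi> q) (tangent_map model_atlas A (inv_into U \<phi>) (\<phi> (inv_into U \<phi> q)) v)) (\<phi> g)"
      by (rule msmooth_at_compose[OF smooth_atlas_model A smooth_atlas_model _ chart_msmooth(2)[OF A c g],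
            of "\<lambda>g. \<tau> g (tangent_map model_atlas A (inv_into U \<phi>) (\<phi> g) v)"]) (simp only: gi r)
    moreover have "\<forall>\<^sub>F q in nhds (\<phi> g). \<tau> (inv_into U \<phi> q) (tangent_map model_atlas A (inv_into U \<phi>) (\<phi> (inv_into U \<phi> q)) v) =
        \<tau> (inv_into U \<phi> q) (tangent_map model_atlas A (inv_into U \<phi>) q v)"
      using chart_isCont(4)[OF A c g] by (rule eventually_mono) (simp add: f_inv_into_f)
    ultimately show ?l unfolding msmooth_at_model_model by (rule smooth_pt_cong[rotated])
  qed
  then show ?thesis
    using smooth_atlasD(2)[OF A] unfolding one_forms_def smooth_on_iff by (simp add: split_beta) blast
qed

lemma one_formsD:
  fixes A :: "('m::t2_space, 'e::euclidean_space) chart set"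
  assumes "\<tau> \<in> one_forms A" "smooth_atlas A" "(U, \<phi>) \<in> A" "g \<in> U"
  shows "msmooth_at A model_atlas (\<lambda>g. \<tau> g (tangent_map model_atlas A (inv_into U \<phi>) (\<phi> g) v)) g"
  using assms unfolding one_forms_iff[OF assms(2)] by fast

lemma one_forms_scale:
  fixes A :: "('m::t2_space, 'e::euclidean_space) chart set"
  assumes A: "smooth_atlas A" and f: "f \<in> C_inf A" and \<tau>: "\<tau> \<in> one_forms A"
  shows "(\<lambda>g. f g *\<^sub>R \<tau> g) \<in> one_forms A"
proof -
  have "msmooth_at A model_atlas (\<lambda>g. f g * \<tau> g (tangent_map model_atlas A (inv_into U \<phi>) (\<phi> g) v)) g"
    if "(U, \<phi>) \<in> A" "g \<in> U" for U \<phi> g v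
    using f that by (intro msmooth_at_mult A one_formsD[OF \<tau>]) (auto simp: C_inf_iff[OF A])
  then show ?thesis by (auto simp: one_forms_iff[OF A] blinfun.scaleR_left)
qed

lemma one_forms_sum:
  fixes A :: "('m::t2_space, 'e::euclidean_space) chart set"
  assumes A: "smooth_atlas A" and \<tau>: "\<And>k. k \<in> K \<Longrightarrow> \<tau> k \<in> one_forms A"
  shows "(\<lambda>g. \<Sum>k\<in>K. \<tau> k g) \<in> one_forms A"
proof -
  have "msmooth_at A model_atlas (\<lambda>g. \<Sum>k\<in>K. \<tau> k g (tangent_map model_atlas A (inv_into U \<phi>) (\<phi> g) v)) g"
    if "(U, \<phi>) \<in> A" "g \<in> U" for U \<phi> g v
    using that by (intro msmooth_at_sum[OF A, THEN conjunct1] one_formsD[OF \<tau>] A)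
  then show ?thesis by (auto simp: one_forms_iff[OF A] blinfun.sum_left)
qed

lemma dual_bilinear_eqI:
  fixes B B' :: "'e::euclidean_space dual \<Rightarrow> 'e dual \<Rightarrow> 'v::real_vector"
  assumes "bilinear B" "bilinear B'"
    and "\<And>i j. i \<in> Basis \<Longrightarrow> j \<in> Basis \<Longrightarrow> B (dual_basis i) (dual_basis j) = B' (dual_basis i) (dual_basis j)"
  shows "B \<alpha> \<beta> = B' \<alpha> \<beta>"
proof -
  have "B \<alpha> \<beta> = (\<Sum>i\<in>Basis. \<Sum>j\<in>Basis. \<beta> j *\<^sub>R \<alpha> i *\<^sub>R B (dual_basis i) (dual_basis j))" if "bilinear B" for B :: "'e dual \<Rightarrow> 'e dual \<Rightarrow> 'v"
  proof -
    note l = that[unfolded bilinear_def]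
    have "B \<alpha> \<beta> = (\<Sum>i\<in>Basis. \<alpha> i *\<^sub>R B (dual_basis i) \<beta>)"
      using l by (subst dual_expansion[of \<alpha>]) (simp add: linear_sum[of "\<lambda>x. B x \<beta>"] linear_scale[of "\<lambda>x. B x \<beta>"])
    also have "\<dots> = (\<Sum>i\<in>Basis. \<Sum>j\<in>Basis. \<beta> j *\<^sub>R \<alpha> i *\<^sub>R B (dual_basis i) (dual_basis j))"
      using l by (intro sum.cong refl, subst dual_expansion[of \<beta>])
        (simp add: linear_sum linear_scale scaleR_sum_right mult.commute)
    finally show ?thesis .
  qed
  from this[OF assms(1)] this[OF assms(2)] assms(3) show ?thesis by simp
qed

lemma cotensor_apply: "cotensor \<phi> \<psi> x y = \<phi> x * \<psi> y"
  by (simp add: cotensor_def bounded_linear_Blinfun_apply bounded_linear_scaleR_const blinfun.bounded_linear_right blinfun.scaleR_left)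

section \<open>The coadjoint action and the left-invariant frame\<close>

context lie_grp
begin

lemma linear_br: "linear (br x)" "linear (\<lambda>x. br x y)"
  using bilinear_bracket by (auto simp: bilinear_def)

lemma coad_apply: "coad G x \<phi> y = - \<phi> (br x y)"
proof -
  have "bounded_linear (\<lambda>y. - \<phi> (br x y))"
    by (rule bounded_linear_minus[OF bounded_linear_compose[OF blinfun.bounded_linear_right
          linear_br(1)[unfolded linear_conv_bounded_linear]]])
  then show ?thesis by (simp add: coad_def bounded_linear_Blinfun_apply)
qed

lemma dual_cobracket_apply: "dual_cobracket G \<phi> x y = \<phi> (br x y)"
proof -
  have "bounded_linear (\<lambda>y. \<phi> (br x y))" for x
    by (rule bounded_linear_compose[OF blinfun.bounded_linear_right linear_br(1)[unfolded linear_conv_bounded_linear]])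
  then have i: "Blinfun (\<lambda>y. \<phi> (br x y)) y = \<phi> (br x y)" for x y
    by (simp add: bounded_linear_Blinfun_apply)
  have "linear (\<lambda>x. Blinfun (\<lambda>y. \<phi> (br x y)))"
    by (intro linearI blinfun_eqI)
       (simp_all add: i blinfun.add_left blinfun.scaleR_left,
        simp_all add: linear_add[OF linear_br(2)] linear_scale[OF linear_br(2)] blinfun.add_right blinfun.scaleR_right)
  then show ?thesis
    by (simp add: dual_cobracket_def bounded_linear_Blinfun_apply i linear_conv_bounded_linear)
qed

lemma bilinear_coad: "bilinear (coad G)"
  unfolding bilinear_def
  by (auto intro!: linearI blinfun_eqI simp: coad_apply blinfun.add_left blinfun.scaleR_left blinfun.add_right blinfun.scaleR_right
      linear_add[OF linear_br(2)] linear_scale[OF linear_br(2)])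

lemma lie_module_coad: "lie_module G (coad G)"
  unfolding lie_module_def
  by (auto intro!: bilinear_coad blinfun_eqI simp: coad_apply blinfun.diff_left blinfun.diff_right jacobi)

lemma coAd_apply: "coAd G g \<phi> v = \<phi> (Ad G (ginv g) v)"
  by (simp add: coAd_def)

lemma coAd_mult: "coAd G (g \<odot> h) \<phi> = coAd G g (coAd G h \<phi>)"
  by (rule blinfun_eqI) (simp add: coAd_apply ginv_mult Ad_mult)

text \<open>Dual form of the invariance of the bracket under \<open>Ad\<close>; in the cocycle rule
  it moves the group element past the infinitesimal action.\<close>

lemma coAd_coad: "coAd G g (coad G y \<psi>) = coad G (Ad G g y) (coAd G g \<psi>)"
proof (rule blinfun_eqI)
  fix v
  have "Ad G (ginv g) (br (Ad G g y) v) = br y (Ad G (ginv g) v)"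
    using Ad_bracket[of "ginv g" "Ad G g y" v] by simp
  then show "coAd G g (coad G y \<psi>) v = coad G (Ad G g y) (coAd G g \<psi>) v"
    by (simp add: coAd_apply coad_apply)
qed

text \<open>Form and field refer to varying reference charts. Inserting one fixed chart and its
  inverse splits the pairing into components of the field and components of the form, all smooth
  near \<open>g0\<close>.\<close>

lemma coefficient_smooth:
  assumes \<tau>: "\<tau> \<in> one_forms atl"
  shows "(\<lambda>g. \<tau> g (left_field G x g)) \<in> C_inf atl"
  unfolding C_inf_iff[OF smooth_atl]
proof
  fix g0
  let ?U = "chart_dom atl g0" let ?\<phi> = "chart_fun atl g0"
  note c = chart_at_mem[OF smooth_atl, of g0]
  define w where "w = (\<lambda>g. tangent_map atl model_atlas (\<lambda>h. ?\<phi> (g \<odot> h)) eG x)"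
  define t where "t = (\<lambda>i g. \<tau> g (tangent_map model_atlas atl (inv_into ?U ?\<phi>) (?\<phi> g) i))"
  have "msmooth_at atl model_atlas (\<lambda>g. w g \<bullet> i) g0" for i
    unfolding w_def by (intro msmooth_at_linear(1)[OF bounded_linear_inner_left smooth_atl] chart_translate_smooth[OF c])
  moreover have "msmooth_at atl model_atlas (t i) g0" for i
    unfolding t_def by (rule one_formsD[OF \<tau> smooth_atl c])
  ultimately have "msmooth_at atl model_atlas (\<lambda>g. \<Sum>i\<in>Basis. (w g \<bullet> i) * t i g) g0"
    by (intro msmooth_at_sum[OF smooth_atl, THEN conjunct1] msmooth_at_mult smooth_atl)
  moreover have "\<forall>\<^sub>F g in nhds g0. (\<Sum>i\<in>Basis. (w g \<bullet> i) * t i g) = \<tau> g (left_field G x g)"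
    using chart_isCont(3)[OF smooth_atl c]
  proof (rule eventually_mono)
    fix g assume g: "g \<in> ?U"
    let ?L = "\<tau> g o\<^sub>L tangent_map model_atlas atl (inv_into ?U ?\<phi>) (?\<phi> g)"
    have "\<tau> g (left_field G x g) = ?L (w g)"
      using chart_tangent_inverse[OF c(1) g] chart_left_field[OF c(1) g] by (simp add: w_def)
    also have "\<dots> = (\<Sum>i\<in>Basis. (w g \<bullet> i) *\<^sub>R ?L i)"
      by (rule linear_Basis_sum[OF bounded_linear.linear[OF blinfun.bounded_linear_right]])
    finally show "(\<Sum>i\<in>Basis. (w g \<bullet> i) * t i g) = \<tau> g (left_field G x g)" by (simp add: t_def)
  qed
  ultimately show "msmooth_at atl model_atlas (\<lambda>g. \<tau> g (left_field G x g)) g0"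
    by (rule msmooth_at_cong[OF smooth_atl smooth_atlas_model, rotated])
qed

lemma left_form_smooth: "left_form G \<alpha> \<in> one_forms atl"
proof -
  have "msmooth_at atl model_atlas (\<lambda>g. left_form G \<alpha> g (tangent_map model_atlas atl (inv_into U \<phi>) (\<phi> g) v)) g"
    if "(U, \<phi>) \<in> atl" "g \<in> U" for U \<phi> g v
    using msmooth_at_linear(1)[OF blinfun.bounded_linear_right smooth_atl left_trivialization_smooth[OF that]]
    by (simp add: left_form_def)
  then show ?thesis by (auto simp: one_forms_iff[OF smooth_atl])
qed

lemma frame_expansion:
  fixes \<tau> :: "'g \<Rightarrow> 'e dual"
  shows "(\<Sum>k\<in>Basis. \<tau> g (left_field G k g) *\<^sub>R left_form G (dual_basis k) g) = \<tau> g"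
proof (rule blinfun_eqI)
  fix v
  define w where "w = tangent_map atl atl (\<lambda>h. ginv g \<odot> h) g v"
  have "msmooth_at atl atl (\<lambda>h. g \<odot> h) (ginv g \<odot> g)" "msmooth_at atl atl (\<lambda>h. ginv g \<odot> h) g" by (intro group_smooth)+
  from tangent_map_compose_apply[OF smooth_atl smooth_atl smooth_atl this, of v] have v: "left_field G w g = v"
    by (simp add: w_def left_field_def tangent_map_id)
  let ?L = "\<tau> g o\<^sub>L tangent_map atl atl (\<lambda>h. g \<odot> h) eG"
  have "\<tau> g v = ?L w" using v by (simp add: left_field_def)
  also have "\<dots> = (\<Sum>k\<in>Basis. (w \<bullet> k) *\<^sub>R ?L k)"
    by (rule linear_Basis_sum[OF bounded_linear.linear[OF blinfun.bounded_linear_right]])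
  finally show "blinfun_apply (\<Sum>k\<in>Basis. \<tau> g (left_field G k g) *\<^sub>R left_form G (dual_basis k) g) v = \<tau> g v"
    by (simp add: blinfun.sum_left blinfun.scaleR_left left_form_def left_field_def w_def mult.commute)
qed

lemma left_form_unit [simp]: "left_form G \<alpha> eG = \<alpha>"
proof -
  have e: "(\<lambda>h. ginv eG \<odot> h) = (\<lambda>h. h)" by (simp add: fun_eq_iff)
  show ?thesis unfolding left_form_def e by (simp add: tangent_map_id)
qed

end

context poisson_lie
begin

section \<open>The defect of bicovariance\<close>

text \<open>Antisymmetry of the Lie bracket turns \<open>coad G d2 \<psi>\<close> evaluated at
  \<open>y\<close> into minus \<open>coad G y \<psi>\<close> evaluated at \<open>d2\<close>, so the
  summation disappears into the tensor.\<close>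

lemma sweedler_coad:
  fixes t :: "'e tensor2" and \<phi> \<psi> :: "'e dual"
  shows "blinfun_apply (sweedler t (\<lambda>d1 d2. \<phi> d1 *\<^sub>R coad G d2 \<psi>)) y = - t \<phi> (coad G y \<psi>)"
proof -
  have "coad G y \<psi> j = - coad G j \<psi> y" for j using bracket_antisym[of y j] by (simp add: coad_apply blinfun.minus_right)
  then show ?thesis
    unfolding tensor_expansion[of t \<phi>]
    by (simp add: sweedler_def blinfun.sum_left blinfun.scaleR_left sum_negf mult.assoc)
qed

text \<open>The outer coadjoint action of the bicovariance condition is moved onto \<open>y\<close>
  as \<open>Ad\<close>, and the Poisson term has a plus sign because of the sign in
  \<open>sweedler_coad\<close>.\<close>

definition bicov_defect :: "('e dual \<Rightarrow> 'e dual \<Rightarrow> 'e dual) \<Rightarrow> 'e dual \<Rightarrow> 'e dual \<Rightarrow> 'e \<Rightarrow> 'g \<Rightarrow> real" where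
  "bicov_defect \<Xi> \<phi> \<psi> y g = \<Xi> \<phi> \<psi> y - \<Xi> (coAd G g \<phi>) (coAd G g \<psi>) (Ad G g y) + DV g \<phi> (coad G y \<psi>)"

lemma bicov_defect_zero_iff:
  fixes \<phi> \<psi> :: "'e dual"
  shows "\<Xi> \<phi> \<psi> - coAd G (ginv g) (\<Xi> (coAd G g \<phi>) (coAd G g \<psi>)) = sweedler (DV g) (\<lambda>d1 d2. \<phi> d1 *\<^sub>R coad G d2 \<psi>)
    \<longleftrightarrow> (\<forall>y. bicov_defect \<Xi> \<phi> \<psi> y g = 0)"
proof -
  have "blinfun_apply (\<Xi> \<phi> \<psi> - coAd G (ginv g) (\<Xi> (coAd G g \<phi>) (coAd G g \<psi>))) y =
      blinfun_apply (sweedler (DV g) (\<lambda>d1 d2. \<phi> d1 *\<^sub>R coad G d2 \<psi>)) y \<longleftrightarrow> bicov_defect \<Xi> \<phi> \<psi> y g = 0" for y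
    by (simp add: sweedler_coad bicov_defect_def blinfun.diff_left coAd_apply add_eq_0_iff)
      (auto simp: algebra_simps)
  then show ?thesis by (metis blinfun_eqI)
qed

text \<open>The terms in \<Xi> telescope, since the value at \<open>h\<close> with transported
  arguments starts where the value at \<open>g\<close> ends. The Poisson terms add up by
  \<open>DV_mult\<close>, once \<open>coAd_coad\<close> has moved the transport through the
  coadjoint action.\<close>

lemma bicov_defect_mult:
  "bicov_defect \<Xi> \<phi> \<psi> y (h \<odot> g) = bicov_defect \<Xi> (coAd G g \<phi>) (coAd G g \<psi>) (Ad G g y) h + bicov_defect \<Xi> \<phi> \<psi> y g"
  by (simp add: bicov_defect_def coAd_mult Ad_mult DV_mult coAd_coad[symmetric]) (simp add: coAd_def)

text \<open>Product rule in three moving arguments: \<open>Ad\<close> contributes the bracket, and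
  each covector its infinitesimal coadjoint action, with the sign coming from the inverse in
  \<open>coAd\<close>.\<close>

lemma bicov_defect_derivative:
  assumes \<Xi>: "bilinear \<Xi>"
  shows "msmooth_at atl model_atlas (bicov_defect \<Xi> \<phi> \<psi> y) eG"
    "differential atl (bicov_defect \<Xi> \<phi> \<psi> y) eG x =
      (coad G x (\<Xi> \<phi> \<psi>) - \<Xi> (coad G x \<phi>) \<psi> - \<Xi> \<phi> (coad G x \<psi>)) y + cobracket G x \<phi> (coad G y \<psi>)"
proof -
  \<comment> \<open>Riesz vectors stand in for covectors, because the smooth calculus takes values
    in Euclidean spaces; \<Xi> thereby becomes the bilinear map \<open>B\<close> on vectors
    below.\<close>
  define v where "v = (\<lambda>\<phi> :: 'e dual. \<Sum>a\<in>Basis. \<phi> a *\<^sub>R a)"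
  have v: "dual_basis (v \<phi>) = \<phi>" for \<phi>
  proof (rule blinfun_eqI)
    fix z
    have "\<phi> z = (\<Sum>a\<in>Basis. (z \<bullet> a) *\<^sub>R \<phi> a)"
      by (rule linear_Basis_sum[OF bounded_linear.linear[OF blinfun.bounded_linear_right]])
    then show "dual_basis (v \<phi>) z = \<phi> z"
      by (simp add: v_def inner_sum_left inner_sum_right mult.commute)
  qed
  define V where "V = (\<lambda>\<phi> g. v (coAd G g \<phi>))"
  have V1: "msmooth_at atl model_atlas (\<lambda>g. \<phi> (Ad G (ginv g) a) *\<^sub>R a) eG"
    "tangent_map atl model_atlas (\<lambda>g. \<phi> (Ad G (ginv g) a) *\<^sub>R a) eG x = coad G x \<phi> a *\<^sub>R a" for \<phi> :: "'e dual" and a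
  proof -
    have s: "msmooth_at atl model_atlas (\<lambda>g. Ad G g a) (ginv eG)" by (rule Ad_smooth)
    have i: "msmooth_at atl atl (\<lambda>g. ginv g) eG" by (intro group_smooth)
    have bl: "bounded_linear (\<lambda>w. blinfun_apply \<phi> w *\<^sub>R a)"
      by (intro bounded_linear_scaleR_const blinfun.bounded_linear_right)
    note c = msmooth_at_compose[OF smooth_atl smooth_atl smooth_atlas_model s i]
    have "tangent_map atl model_atlas (\<lambda>g. Ad G (ginv g) a) eG x = - br x a"
      using tangent_map_compose_apply[OF smooth_atl smooth_atl smooth_atlas_model s i, of x]
      by (simp add: tangent_ginv_unit blinfun.minus_right Ad_derivative)
    then show "msmooth_at atl model_atlas (\<lambda>g. \<phi> (Ad G (ginv g) a) *\<^sub>R a) eG"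
      "tangent_map atl model_atlas (\<lambda>g. \<phi> (Ad G (ginv g) a) *\<^sub>R a) eG x = coad G x \<phi> a *\<^sub>R a"
      using msmooth_at_linear[OF bl smooth_atl c] by (simp_all add: coad_apply blinfun.minus_right)
  qed
  have V: "msmooth_at atl model_atlas (V \<phi>) eG" "tangent_map atl model_atlas (V \<phi>) eG x = v (coad G x \<phi>)" for \<phi>
  proof -
    have "V \<phi> = (\<lambda>g. \<Sum>a\<in>Basis. \<phi> (Ad G (ginv g) a) *\<^sub>R a)" by (simp add: V_def v_def coAd_apply)
    then show "msmooth_at atl model_atlas (V \<phi>) eG" "tangent_map atl model_atlas (V \<phi>) eG x = v (coad G x \<phi>)"
      using msmooth_at_sum[OF smooth_atl, of Basis "\<lambda>a g. \<phi> (Ad G (ginv g) a) *\<^sub>R a" eG] V1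
      by (simp_all add: v_def blinfun.sum_left)
  qed
  define B where "B = (\<lambda>p q. v (\<Xi> (dual_basis p) (dual_basis q)))"
  have db: "dual_basis (p + q) = dual_basis p + dual_basis q" "dual_basis (r *\<^sub>R p) = r *\<^sub>R dual_basis p" for p q :: 'e and r
    by (auto intro!: blinfun_eqI simp: inner_add_left inner_add_right blinfun.add_left blinfun.scaleR_left)
  have vlin: "v (\<phi> + \<psi>) = v \<phi> + v \<psi>" "v (r *\<^sub>R \<phi>) = r *\<^sub>R v \<phi>" for \<phi> \<psi> r
    by (simp_all add: v_def blinfun.add_left blinfun.scaleR_left scaleR_add_left sum.distrib scaleR_sum_right)
  have "bilinear B"
    unfolding bilinear_def B_def
    by (auto intro!: linearI simp: db vlin bilinear_ladd[OF \<Xi>] bilinear_radd[OF \<Xi>] bilinear_lmul[OF \<Xi>] bilinear_rmul[OF \<Xi>])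
  then have B: "bounded_bilinear B" by (simp add: bilinear_conv_bounded_bilinear)
  have vi: "v \<phi> \<bullet> z = \<phi> z" for \<phi> z using arg_cong[OF v[of \<phi>], of "\<lambda>\<phi>. \<phi> z"] by (simp add: inner_commute)
  have BV: "B (V \<phi> g) (V \<psi> g) \<bullet> Ad G g y = \<Xi> (coAd G g \<phi>) (coAd G g \<psi>) (Ad G g y)" for g
    by (simp add: B_def V_def v vi)
  note s1 = msmooth_at_bilinear[OF B smooth_atl V(1) V(1), of \<phi> \<psi>]
  note s2 = msmooth_at_bilinear[OF bounded_bilinear_inner smooth_atl s1(1) Ad_smooth, of y]
  have coAd1: "coAd G eG \<phi> = \<phi>" for \<phi> by (rule blinfun_eqI) (simp add: coAd_apply)
  have d2: "differential atl (\<lambda>g. \<Xi> (coAd G g \<phi>) (coAd G g \<psi>) (Ad G g y)) eG x =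
      \<Xi> \<phi> \<psi> (br x y) + (\<Xi> \<phi> (coad G x \<psi>) y + \<Xi> (coad G x \<phi>) \<psi> y)"
    using s2(2)[of x] unfolding s1(2) V(2) BV
    by (simp add: Ad_derivative B_def V_def v vi coAd1 inner_add_left)
  have m2: "msmooth_at atl model_atlas (\<lambda>g. \<Xi> (coAd G g \<phi>) (coAd G g \<psi>) (Ad G g y)) eG"
    using s2(1) unfolding BV .
  note n2 = msmooth_at_linear[OF bounded_linear_minus[OF bounded_linear_ident] smooth_atl m2]
  note a1 = msmooth_at_add[OF smooth_atl msmooth_at_const[OF smooth_atl smooth_atlas_model] n2(1), of "\<Xi> \<phi> \<psi> y"]
  note a2 = msmooth_at_add[OF smooth_atl a1(1) DV_smooth, of \<phi> "coad G y \<psi>"]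
  have e: "bicov_defect \<Xi> \<phi> \<psi> y =
      (\<lambda>g. \<Xi> \<phi> \<psi> y + - \<Xi> (coAd G g \<phi>) (coAd G g \<psi>) (Ad G g y) + DV g \<phi> (coad G y \<psi>))"
    by (simp add: bicov_defect_def fun_eq_iff)
  show "msmooth_at atl model_atlas (bicov_defect \<Xi> \<phi> \<psi> y) eG" unfolding e by (rule a2(1))
  show "differential atl (bicov_defect \<Xi> \<phi> \<psi> y) eG x =
      (coad G x (\<Xi> \<phi> \<psi>) - \<Xi> (coad G x \<phi>) \<psi> - \<Xi> \<phi> (coad G x \<psi>)) y + cobracket G x \<phi> (coad G y \<psi>)"
    unfolding e a2(2) a1(2)
    by (simp add: blinfun.add_left blinfun.diff_left n2(2) d2 tangent_map_const cobracket_apply coad_apply)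
qed

text \<open>The defect is a cocycle: near \<open>g\<close> it is a right translate of a defect near the unit, up to a
  constant. So if its derivative vanishes at the unit, then it is locally constant everywhere.\<close>

lemma bicov_defect_vanishes_iff:
  assumes conn: "connected (UNIV :: 'g set)" and \<Xi>: "bilinear \<Xi>"
  shows "(\<forall>g \<phi> \<psi> y. bicov_defect \<Xi> \<phi> \<psi> y g = 0) \<longleftrightarrow>
    (\<forall>x \<phi> \<psi> y. (coad G x (\<Xi> \<phi> \<psi>) - \<Xi> (coad G x \<phi>) \<psi> - \<Xi> \<phi> (coad G x \<psi>)) y + cobracket G x \<phi> (coad G y \<psi>) = 0)"
    (is "?L \<longleftrightarrow> ?R")
proof
  assume ?L
  then have "bicov_defect \<Xi> \<phi> \<psi> y = (\<lambda>g. 0)" for \<phi> \<psi> y by blast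
  then have "differential atl (bicov_defect \<Xi> \<phi> \<psi> y) eG x = 0" for x \<phi> \<psi> y by (simp add: tangent_map_const)
  then show ?R unfolding bicov_defect_derivative(2)[OF \<Xi>] by blast
next
  assume ?R
  then have "differential atl (bicov_defect \<Xi> \<phi> \<psi> y) eG x = 0" for x \<phi> \<psi> y
    unfolding bicov_defect_derivative(2)[OF \<Xi>] by blast
  then have d0: "differential atl (bicov_defect \<Xi> \<phi> \<psi> y) eG = 0" for \<phi> \<psi> y by (intro blinfun_eqI) simp
  have sm: "msmooth_at atl model_atlas (bicov_defect \<Xi> \<phi> \<psi> y) g \<and> differential atl (bicov_defect \<Xi> \<phi> \<psi> y) g = 0" for \<phi> \<psi> y g
  proof -
    let ?F = "bicov_defect \<Xi> (coAd G g \<phi>) (coAd G g \<psi>) (Ad G g y)"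
    have t: "msmooth_at atl atl (\<lambda>h. h \<odot> ginv g) g" by (intro group_smooth)
    have F: "msmooth_at atl model_atlas ?F (g \<odot> ginv g)" using bicov_defect_derivative(1)[OF \<Xi>] by simp
    note s = msmooth_at_compose[OF smooth_atl smooth_atl smooth_atlas_model F t]
    note a = msmooth_at_add[OF smooth_atl s msmooth_at_const[OF smooth_atl smooth_atlas_model], of "bicov_defect \<Xi> \<phi> \<psi> y g"]
    have z: "tangent_map atl model_atlas (\<lambda>h. ?F (h \<odot> ginv g)) g = 0"
      using tangent_map_compose[OF smooth_atl smooth_atl smooth_atlas_model F t] d0 by (simp add: blinfun_eqI)
    have "bicov_defect \<Xi> \<phi> \<psi> y = (\<lambda>h. ?F (h \<odot> ginv g) + bicov_defect \<Xi> \<phi> \<psi> y g)"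
    proof
      fix h
      have "h \<odot> ginv g \<odot> g = h" by (simp add: m_assoc)
      then show "bicov_defect \<Xi> \<phi> \<psi> y h = ?F (h \<odot> ginv g) + bicov_defect \<Xi> \<phi> \<psi> y g"
        using bicov_defect_mult[of \<Xi> \<phi> \<psi> y "h \<odot> ginv g" g] by simp
    qed
    then show ?thesis using a z by (simp add: tangent_map_const)
  qed
  have "bicov_defect \<Xi> \<phi> \<psi> y g = bicov_defect \<Xi> \<phi> \<psi> y eG" for g \<phi> \<psi> y
    by (rule tangent_map_zero_constant[OF smooth_atl smooth_atlas_model open_UNIV conn]) (use sm in auto)
  moreover have "bicov_defect \<Xi> \<phi> \<psi> y eG = 0" for \<phi> \<psi> y
    using bicov_defect_mult[of \<Xi> \<phi> \<psi> y eG eG] by (simp add: coAd_def)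
  ultimately show ?L by metis
qed

section \<open>Left-covariant preconnections\<close>

text \<open>Isolating these scalar components reduces each law of a preconnection to an identity
  between real functions.\<close>

definition connection_coeff :: "('e dual \<Rightarrow> 'e dual \<Rightarrow> 'e dual) \<Rightarrow> ('g \<Rightarrow> real) \<Rightarrow> ('g \<Rightarrow> 'e dual) \<Rightarrow> 'e \<Rightarrow> 'g \<Rightarrow> real" where
  "connection_coeff \<Xi> a \<tau> k g = PB a (\<lambda>g. \<tau> g (left_field G k g)) g +
     (\<Sum>i\<in>Basis. \<Sum>j\<in>Basis. \<Xi> (dual_basis i) (dual_basis j) k * LF i a g * \<tau> g (left_field G j g))"

lemma preconn_of_alt:
  "preconn_of G \<Xi> a \<tau> = (\<lambda>g. \<Sum>k\<in>Basis. connection_coeff \<Xi> a \<tau> k g *\<^sub>R left_form G (dual_basis k) g)"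
  by (simp add: preconn_of_def connection_coeff_def Let_def)

lemma C_inf_sum: "(\<And>i. i \<in> I \<Longrightarrow> f i \<in> C_inf atl) \<Longrightarrow> (\<lambda>g. \<Sum>i\<in>I. f i g) \<in> C_inf atl"
  unfolding C_inf_iff[OF smooth_atl] by (intro allI msmooth_at_sum[OF smooth_atl, THEN conjunct1]) auto

lemma C_inf_const: "(\<lambda>g. c) \<in> C_inf atl"
  by (simp add: C_inf_iff msmooth_at_const)

text \<open>The laws hold componentwise because the bracket and the left-invariant fields are
  derivations. In the rule for \<open>b\<close> times a form, the bracket of \<open>a\<close> and
  \<open>b\<close> multiplies the components of the form, which \<open>frame_expansion\<close>
  reassembles.\<close>

lemma preconnection_preconn_of: "preconnection G (preconn_of G \<Xi>)"
  unfolding preconnection_def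
proof (intro ballI allI)
  fix a b :: "'g \<Rightarrow> real" and \<tau> \<sigma> :: "'g \<Rightarrow> 'e dual" and r :: real
  assume a: "a \<in> C_inf atl" and b: "b \<in> C_inf atl" and \<tau>: "\<tau> \<in> one_forms atl" and \<sigma>: "\<sigma> \<in> one_forms atl"
  note t = coefficient_smooth[OF \<tau>] and s = coefficient_smooth[OF \<sigma>]
  have cs: "connection_coeff \<Xi> a \<tau> k \<in> C_inf atl" for k
  proof -
    have "(\<lambda>g. \<Sum>i\<in>Basis. \<Sum>j\<in>Basis. \<Xi> (dual_basis i) (dual_basis j) k * LF i a g * \<tau> g (left_field G j g)) \<in> C_inf atl"
      by (intro C_inf_sum C_inf_algebra(2) C_inf_const LF_smooth a t)
    from C_inf_algebra(1)[OF pb_C[OF a t a] this] show ?thesis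
      unfolding connection_coeff_def[abs_def] .
  qed
  have "preconn_of G \<Xi> a \<tau> \<in> one_forms atl"
    unfolding preconn_of_alt by (intro one_forms_sum one_forms_scale smooth_atl cs left_form_smooth)
  moreover have "connection_coeff \<Xi> (\<lambda>g. r * a g + b g) \<tau> k g = r * connection_coeff \<Xi> a \<tau> k g + connection_coeff \<Xi> b \<tau> k g" for k g
    by (simp add: connection_coeff_def pb_linear1[OF a b t] LF_algebra(1)[OF a b])
       (simp add: algebra_simps sum.distrib sum_distrib_left)
  then have "preconn_of G \<Xi> (\<lambda>g. r * a g + b g) \<tau> = (\<lambda>g. r *\<^sub>R preconn_of G \<Xi> a \<tau> g + preconn_of G \<Xi> b \<tau> g)"
    by (simp add: preconn_of_alt scaleR_add_left sum.distrib scaleR_sum_right)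
  moreover have "connection_coeff \<Xi> a (\<lambda>g. r *\<^sub>R \<tau> g + \<sigma> g) k g = r * connection_coeff \<Xi> a \<tau> k g + connection_coeff \<Xi> a \<sigma> k g" for k g
    by (simp add: connection_coeff_def blinfun.add_left blinfun.scaleR_left pb_linear2[OF t s a])
       (simp add: algebra_simps sum.distrib sum_distrib_left)
  then have "preconn_of G \<Xi> a (\<lambda>g. r *\<^sub>R \<tau> g + \<sigma> g) = (\<lambda>g. r *\<^sub>R preconn_of G \<Xi> a \<tau> g + preconn_of G \<Xi> a \<sigma> g)"
    by (simp add: preconn_of_alt scaleR_add_left sum.distrib scaleR_sum_right)
  moreover have "connection_coeff \<Xi> (\<lambda>g. a g * b g) \<tau> k g = b g * connection_coeff \<Xi> a \<tau> k g + a g * connection_coeff \<Xi> b \<tau> k g" for k g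
    by (simp add: connection_coeff_def pb_leibniz1[OF a b t] LF_algebra(2)[OF a b])
       (simp add: algebra_simps sum.distrib sum_distrib_left)
  then have "preconn_of G \<Xi> (\<lambda>g. a g * b g) \<tau> = (\<lambda>g. b g *\<^sub>R preconn_of G \<Xi> a \<tau> g + a g *\<^sub>R preconn_of G \<Xi> b \<tau> g)"
    by (simp add: preconn_of_alt scaleR_add_left sum.distrib scaleR_sum_right)
  moreover have "connection_coeff \<Xi> a (\<lambda>g. b g *\<^sub>R \<tau> g) k g = b g * connection_coeff \<Xi> a \<tau> k g + PB a b g * \<tau> g (left_field G k g)" for k g
    by (simp add: connection_coeff_def blinfun.scaleR_left pb_leibniz2[OF b t a])
       (simp add: algebra_simps sum.distrib sum_distrib_left)
  then have "preconn_of G \<Xi> a (\<lambda>g. b g *\<^sub>R \<tau> g) = (\<lambda>g. b g *\<^sub>R preconn_of G \<Xi> a \<tau> g + PB a b g *\<^sub>R \<tau> g)"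
    by (subst (2) frame_expansion[symmetric])
       (simp add: preconn_of_alt scaleR_add_left sum.distrib scaleR_sum_right)
  ultimately show "preconn_of G \<Xi> a \<tau> \<in> one_forms atl \<and>
      preconn_of G \<Xi> (\<lambda>g. r * a g + b g) \<tau> = (\<lambda>g. r *\<^sub>R preconn_of G \<Xi> a \<tau> g + preconn_of G \<Xi> b \<tau> g) \<and>
      preconn_of G \<Xi> a (\<lambda>g. r *\<^sub>R \<tau> g + \<sigma> g) = (\<lambda>g. r *\<^sub>R preconn_of G \<Xi> a \<tau> g + preconn_of G \<Xi> a \<sigma> g) \<and>
      preconn_of G \<Xi> (\<lambda>g. a g * b g) \<tau> = (\<lambda>g. b g *\<^sub>R preconn_of G \<Xi> a \<tau> g + a g *\<^sub>R preconn_of G \<Xi> b \<tau> g) \<and>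
      preconn_of G \<Xi> a (\<lambda>g. b g *\<^sub>R \<tau> g) = (\<lambda>g. b g *\<^sub>R preconn_of G \<Xi> a \<tau> g + PB a b g *\<^sub>R \<tau> g)"
    by blast
qed

text \<open>At the unit the components of a frame form are 0 or 1, so the double sum keeps only
  structure constants with second index \<open>j\<close>; the bracket term is the same for every
  \<Xi>.\<close>

lemma preconn_of_unit:
  assumes "j \<in> Basis" "k \<in> Basis" "a \<in> C_inf atl"
  shows "preconn_of G \<Xi> a (left_form G (dual_basis j)) eG k =
    PB a (\<lambda>g. left_form G (dual_basis j) g (left_field G k g)) eG +
    (\<Sum>i\<in>Basis. \<Xi> (dual_basis i) (dual_basis j) k * differential atl a eG i)"
proof -
  have "preconn_of G \<Xi> a (left_form G (dual_basis j)) eG k = connection_coeff \<Xi> a (left_form G (dual_basis j)) k eG"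
    using assms(2) by (simp add: preconn_of_alt blinfun.sum_left blinfun.scaleR_left inner_Basis if_distrib cong: if_cong)
  also have "(\<Sum>l\<in>Basis. \<Xi> (dual_basis i) (dual_basis l) k * LF i a eG * left_form G (dual_basis j) eG (left_field G l eG)) =
      \<Xi> (dual_basis i) (dual_basis j) k * differential atl a eG i" for i
  proof -
    have "(\<Sum>l\<in>Basis. \<Xi> (dual_basis i) (dual_basis l) k * LF i a eG * left_form G (dual_basis j) eG (left_field G l eG)) =
        (\<Sum>l\<in>Basis. if l = j then \<Xi> (dual_basis i) (dual_basis l) k * LF i a eG else 0)"
      using assms(1) by (intro sum.cong refl) (auto simp: inner_Basis)
    then show ?thesis using assms(1,3) by (simp add: LF_unit)
  qed
  ultimately show ?thesis by (simp add: connection_coeff_def)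
qed

text \<open>\<open>bicovariant\<close> asks for some \<Xi> inducing the preconnection, and this ties
  it to the given one. A function with prescribed differential at the unit picks out a single
  structure constant, while the bracket terms cancel.\<close>

lemma preconn_of_inj:
  assumes "bilinear \<Xi>" "bilinear \<Xi>'"
    and eq: "\<And>a \<tau>. a \<in> C_inf atl \<Longrightarrow> \<tau> \<in> one_forms atl \<Longrightarrow> preconn_of G \<Xi> a \<tau> = preconn_of G \<Xi>' a \<tau>"
  shows "\<Xi> = \<Xi>'"
proof (rule ext, rule ext, rule dual_bilinear_eqI[OF assms(1,2)])
  fix i j :: 'e assume ij: "i \<in> Basis" "j \<in> Basis"
  show "\<Xi> (dual_basis i) (dual_basis j) = \<Xi>' (dual_basis i) (dual_basis j)"
  proof (rule blinfun_euclidean_eqI)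
    fix k :: 'e assume k: "k \<in> Basis"
    obtain a where a: "a \<in> C_inf atl" "differential atl a eG = dual_basis i" by (rule covector_realized)
    have s: "(\<Sum>l\<in>Basis. \<Xi> (dual_basis l) (dual_basis j) k * differential atl a eG l) = \<Xi> (dual_basis i) (dual_basis j) k"
      for \<Xi> :: "'e dual \<Rightarrow> 'e dual \<Rightarrow> 'e dual"
    proof -
      have "(\<Sum>l\<in>Basis. \<Xi> (dual_basis l) (dual_basis j) k * differential atl a eG l) =
          (\<Sum>l\<in>Basis. if l = i then \<Xi> (dual_basis l) (dual_basis j) k else 0)"
        using ij by (intro sum.cong refl) (auto simp: a inner_Basis)
      then show ?thesis using ij by simp
    qed
    have "preconn_of G \<Xi> a (left_form G (dual_basis j)) eG k = preconn_of G \<Xi>' a (left_form G (dual_basis j)) eG k"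
      using eq[OF a(1) left_form_smooth] by simp
    then show "\<Xi> (dual_basis i) (dual_basis j) k = \<Xi>' (dual_basis i) (dual_basis j) k"
      by (simp add: preconn_of_unit ij k a(1) s)
  qed
qed

lemma bicovariant_preconn_of_iff:
  assumes "bilinear \<Xi>"
  shows "bicovariant G (preconn_of G \<Xi>) \<longleftrightarrow> (\<forall>g \<phi> \<psi> y. bicov_defect \<Xi> \<phi> \<psi> y g = 0)"
proof -
  have "left_covariant_via G \<Xi>' (preconn_of G \<Xi>) \<longleftrightarrow> \<Xi>' = \<Xi>" for \<Xi>'
    using preconn_of_inj[OF assms, of \<Xi>'] preconnection_preconn_of assms unfolding left_covariant_via_def by blast
  then show ?thesis unfolding bicovariant_def bicov_defect_zero_iff by auto
qed

section \<open>Equivalent forms of (\<ast>)\<close>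

text \<open>Contracting the second leg of the dual cobracket with \<open>x\<close> is the coadjoint
  action of \<open>x\<close>: the sign in \<open>coad\<close> cancels against the reversed order in
  the bracket.\<close>

lemma co_sweedler_dual_cobracket:
  fixes B :: "'e dual \<Rightarrow> 'v::real_vector" and \<phi> :: "'e dual"
  assumes "linear B"
  shows "co_sweedler (dual_cobracket G \<phi>) (\<lambda>\<phi>1 \<phi>2. \<phi>2 x *\<^sub>R B \<phi>1) = B (coad G x \<phi>)"
proof -
  have "\<phi> (br i x) = (\<Sum>j\<in>Basis. \<phi> (br i j) * (x \<bullet> j))" for i
    using linear_Basis_sum[of "\<lambda>j. \<phi> (br i j)" x]
      linear_compose[OF linear_br(1)[of i] bounded_linear.linear[OF blinfun.bounded_linear_right[of \<phi>]]]
    by (simp add: o_def mult.commute)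
  then have "coad G x \<phi> i = (\<Sum>j\<in>Basis. \<phi> (br i j) * (x \<bullet> j))" for i
    using bracket_antisym[of x i] by (simp add: coad_apply blinfun.minus_right)
  then have "(\<Sum>j\<in>Basis. dual_cobracket G \<phi> i j *\<^sub>R (x \<bullet> j) *\<^sub>R B (dual_basis i)) = coad G x \<phi> i *\<^sub>R B (dual_basis i)" for i
    by (simp add: dual_cobracket_apply scaleR_sum_left)
  then have "co_sweedler (dual_cobracket G \<phi>) (\<lambda>\<phi>1 \<phi>2. \<phi>2 x *\<^sub>R B \<phi>1) = (\<Sum>i\<in>Basis. coad G x \<phi> i *\<^sub>R B (dual_basis i))"
    by (simp add: co_sweedler_def)
  also have "\<dots> = B (coad G x \<phi>)"
    by (subst (2) dual_expansion) (simp add: linear_sum[OF assms] linear_scale[OF assms])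
  finally show ?thesis .
qed

text \<open>The crossed-module axiom contracts the second leg of the cobracket and (\<ast>) the
  first; antisymmetry of \<delta> accounts for the exchange.\<close>

lemma sweedler_cobracket_flip:
  fixes B :: "'e \<Rightarrow> 'v::real_vector" and \<phi> :: "'e dual"
  shows "sweedler (cobracket G x) (\<lambda>x1 x2. \<phi> x2 *\<^sub>R B x1) = - sweedler (cobracket G x) (\<lambda>x1 x2. \<phi> x1 *\<^sub>R B x2)"
proof -
  have "sweedler (cobracket G x) (\<lambda>x1 x2. \<phi> x2 *\<^sub>R B x1) =
      (\<Sum>j\<in>Basis. \<Sum>i\<in>Basis. cobracket G x (dual_basis i) (dual_basis j) *\<^sub>R \<phi> j *\<^sub>R B i)"
    unfolding sweedler_def by (rule sum.swap)
  also have "\<dots> = (\<Sum>j\<in>Basis. \<Sum>i\<in>Basis. - (cobracket G x (dual_basis j) (dual_basis i) *\<^sub>R \<phi> j *\<^sub>R B i))"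
    by (intro sum.cong refl) (subst cobracket_antisym, simp)
  finally show ?thesis by (simp add: sweedler_def sum_negf)
qed

text \<open>With \<open>-\<Xi>\<close> as second operation the compatibility axiom is the negative
  of (\<ast>), rearranged; the module law for \<open>coad\<close> is the Jacobi identity.\<close>

lemma crossed_module_iff:
  assumes \<Xi>: "bilinear \<Xi>"
  shows "left_almost_crossed_module G (coad G) (\<lambda>\<phi> \<psi>. - \<Xi> \<phi> \<psi>) \<longleftrightarrow>
    (\<forall>x \<phi> \<psi>. coad G x (\<Xi> \<phi> \<psi>) - \<Xi> (coad G x \<phi>) \<psi> - \<Xi> \<phi> (coad G x \<psi>) =
       sweedler (cobracket G x) (\<lambda>x1 x2. \<phi> x1 *\<^sub>R coad G x2 \<psi>))"
proof -
  have l: "linear (\<lambda>\<phi>. \<Xi> \<phi> \<psi>)" "linear (\<Xi> \<phi>)" for \<phi> \<psi> using \<Xi> by (auto simp: bilinear_def)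
  have bil: "bilinear (\<lambda>\<phi> \<psi>. - \<Xi> \<phi> \<psi>)"
    unfolding bilinear_def using l linear_compose_neg by auto
  have "(co_sweedler (dual_cobracket G \<phi>) (\<lambda>\<phi>1 \<phi>2. \<phi>2 x *\<^sub>R - \<Xi> \<phi>1 \<psi>) +
      sweedler (cobracket G x) (\<lambda>x1 x2. \<phi> x2 *\<^sub>R coad G x1 \<psi>) = coad G x (- \<Xi> \<phi> \<psi>) - - \<Xi> \<phi> (coad G x \<psi>)) \<longleftrightarrow>
      coad G x (\<Xi> \<phi> \<psi>) - \<Xi> (coad G x \<phi>) \<psi> - \<Xi> \<phi> (coad G x \<psi>) =
        sweedler (cobracket G x) (\<lambda>x1 x2. \<phi> x1 *\<^sub>R coad G x2 \<psi>)" (is "?e \<longleftrightarrow> ?r") for x \<phi> \<psi>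
  proof -
    have 1: "co_sweedler (dual_cobracket G \<phi>) (\<lambda>\<phi>1 \<phi>2. \<phi>2 x *\<^sub>R - \<Xi> \<phi>1 \<psi>) = - \<Xi> (coad G x \<phi>) \<psi>"
      by (rule co_sweedler_dual_cobracket[OF linear_compose_neg[OF l(1)]])
    have 2: "coad G x (- \<Xi> \<phi> \<psi>) = - coad G x (\<Xi> \<phi> \<psi>)"
      using bilinear_coad bilinear_rneg by blast
    show ?thesis unfolding 1 2 sweedler_cobracket_flip
      by (auto simp: algebra_simps)
  qed
  then show ?thesis unfolding left_almost_crossed_module_def using lie_module_coad bil by simp
qed

lemma dual_bracket_apply: "dual_bracket G \<phi> \<psi> x = cobracket G x \<phi> \<psi>"
  by (simp add: dual_bracket_def bounded_linear_Blinfun_apply bounded_linear_cobracket)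

lemma co_sweedler_apply:
  "blinfun_apply (blinfun_apply (co_sweedler t B) y) x = co_sweedler t (\<lambda>\<phi> \<psi>. B \<phi> \<psi> y x)"
  by (simp add: co_sweedler_def blinfun.sum_left blinfun.scaleR_left)

text \<open>Evaluation on \<open>y\<close> and \<open>x\<close>, in this order, makes the argument
  of the second leg the Lie algebra element of (\<ast>). On the left the dual cobrackets contract to
  coadjoint actions; on the right the dual bracket becomes the cobracket of
  \<open>x\<close>.\<close>

lemma dual_equation_iff:
  assumes \<Xi>: "bilinear \<Xi>"
  shows "dual_cobracket G (\<Xi> \<phi> \<psi>)
        - co_sweedler (dual_cobracket G \<phi>) (\<lambda>\<phi>1 \<phi>2. cotensor (\<Xi> \<phi>1 \<psi>) \<phi>2)
        - co_sweedler (dual_cobracket G \<psi>) (\<lambda>\<psi>1 \<psi>2. cotensor (\<Xi> \<phi> \<psi>1) \<psi>2) =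
      co_sweedler (dual_cobracket G \<psi>) (\<lambda>\<psi>1 \<psi>2. cotensor \<psi>1 (dual_bracket G \<phi> \<psi>2)) \<longleftrightarrow>
    (\<forall>x. coad G x (\<Xi> \<phi> \<psi>) - \<Xi> (coad G x \<phi>) \<psi> - \<Xi> \<phi> (coad G x \<psi>) =
       sweedler (cobracket G x) (\<lambda>x1 x2. \<phi> x1 *\<^sub>R coad G x2 \<psi>))" (is "?l = ?r \<longleftrightarrow> _")
proof -
  have l: "linear (\<lambda>\<phi>. \<Xi> \<phi> \<psi> y)" "linear (\<lambda>\<psi>. \<Xi> \<phi> \<psi> y)" for \<phi> \<psi> y
    using \<Xi> by (auto intro!: linearI simp: bilinear_ladd bilinear_radd bilinear_lmul bilinear_rmul blinfun.add_left blinfun.scaleR_left)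
  have L: "?l y x = (coad G x (\<Xi> \<phi> \<psi>) - \<Xi> (coad G x \<phi>) \<psi> - \<Xi> \<phi> (coad G x \<psi>)) y" for x y
  proof -
    have "dual_cobracket G (\<Xi> \<phi> \<psi>) y x = coad G x (\<Xi> \<phi> \<psi>) y"
      using bracket_antisym[of y x] by (simp add: dual_cobracket_apply coad_apply blinfun.minus_right)
    then show ?thesis
      using co_sweedler_dual_cobracket[OF l(1), of \<phi> x \<psi> y] co_sweedler_dual_cobracket[OF l(2), of \<psi> x \<phi> y]
      by (simp add: blinfun.diff_left co_sweedler_apply cotensor_apply mult.commute)
  qed
  have R: "?r y x = sweedler (cobracket G x) (\<lambda>x1 x2. \<phi> x1 *\<^sub>R coad G x2 \<psi>) y" for x y
  proof -
    have coad: "coad G y \<psi> j = (\<Sum>i\<in>Basis. - (dual_cobracket G \<psi> i j * (y \<bullet> i)))" for j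
      using linear_Basis_sum[of "\<lambda>i. \<psi> (br i j)" y]
        linear_compose[OF linear_br(2)[of j] bounded_linear.linear[OF blinfun.bounded_linear_right[of \<psi>]]]
      by (simp add: o_def coad_apply dual_cobracket_apply sum_negf mult.commute)
    have "?r y x = (\<Sum>i\<in>Basis. \<Sum>j\<in>Basis. dual_cobracket G \<psi> i j * ((y \<bullet> i) * cobracket G x \<phi> (dual_basis j)))"
      unfolding co_sweedler_apply by (simp add: co_sweedler_def cotensor_apply dual_bracket_apply)
    also have "\<dots> = (\<Sum>j\<in>Basis. - coad G y \<psi> j * cobracket G x \<phi> (dual_basis j))"
      by (subst sum.swap) (simp add: coad sum_negf sum_distrib_right mult.assoc)
    also have "\<dots> = - cobracket G x \<phi> (\<Sum>j\<in>Basis. coad G y \<psi> j *\<^sub>R dual_basis j)"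
      by (simp add: blinfun.sum_right blinfun.scaleR_right sum_negf)
    finally show ?thesis by (simp add: dual_expansion[symmetric] sweedler_coad)
  qed
  have "?l = ?r \<longleftrightarrow> (\<forall>x y. ?l y x = ?r y x)" by (metis blinfun_eqI)
  then show ?thesis unfolding L R by (metis blinfun_eqI)
qed

text \<open>Pairing with \<open>y\<close> through \<open>sweedler_coad\<close> brings (\<ast>) into
  the form of the derivative of the defect at the unit.\<close>

lemma star_iff_defect:
  "(\<forall>x \<phi> \<psi>. coad G x (\<Xi> \<phi> \<psi>) - \<Xi> (coad G x \<phi>) \<psi> - \<Xi> \<phi> (coad G x \<psi>) =
       sweedler (cobracket G x) (\<lambda>x1 x2. \<phi> x1 *\<^sub>R coad G x2 \<psi>)) \<longleftrightarrow>
   (\<forall>x \<phi> \<psi> y. (coad G x (\<Xi> \<phi> \<psi>) - \<Xi> (coad G x \<phi>) \<psi> - \<Xi> \<phi> (coad G x \<psi>)) y + cobracket G x \<phi> (coad G y \<psi>) = 0)"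
proof -
  have "\<alpha> = sweedler (cobracket G x) (\<lambda>x1 x2. \<phi> x1 *\<^sub>R coad G x2 \<psi>) \<longleftrightarrow>
      (\<forall>y. \<alpha> y + cobracket G x \<phi> (coad G y \<psi>) = 0)" for \<alpha> \<phi> \<psi> :: "'e dual" and x
  proof -
    have "\<alpha> = sweedler (cobracket G x) (\<lambda>x1 x2. \<phi> x1 *\<^sub>R coad G x2 \<psi>) \<longleftrightarrow>
        (\<forall>y. \<alpha> y = - cobracket G x \<phi> (coad G y \<psi>))" by (metis blinfun_eqI sweedler_coad)
    then show ?thesis by (simp add: eq_neg_iff_add_eq_0)
  qed
  then show ?thesis by simp
qed

end

theorem theorem3p1:
  fixes G :: "('g::{t2_space,second_countable_topology}, 'e::euclidean_space) poisson_data"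
    and \<Xi> :: "'e dual \<Rightarrow> 'e dual \<Rightarrow> 'e dual"
  assumes "poisson_lie_group G"
    and "connected (UNIV :: 'g set)"
    and "simply_connected (UNIV :: 'g set)"
    and "bilinear \<Xi>"
  shows "let star = (\<forall>x \<phi> \<psi>.
             coad G x (\<Xi> \<phi> \<psi>) - \<Xi> (coad G x \<phi>) \<psi> - \<Xi> \<phi> (coad G x \<psi>) =
             sweedler (cobracket G x) (\<lambda>x1 x2. \<phi> x1 *\<^sub>R coad G x2 \<psi>))
         in (bicovariant G (preconn_of G \<Xi>) \<longleftrightarrow> star) \<and>
            (star \<longleftrightarrow> left_almost_crossed_module G (coad G) (\<lambda>\<phi> \<psi>. - \<Xi> \<phi> \<psi>)) \<and>
            (star \<longleftrightarrow> (\<forall>\<phi> \<psi>.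
               dual_cobracket G (\<Xi> \<phi> \<psi>)
                 - co_sweedler (dual_cobracket G \<phi>) (\<lambda>\<phi>1 \<phi>2. cotensor (\<Xi> \<phi>1 \<psi>) \<phi>2)
                 - co_sweedler (dual_cobracket G \<psi>) (\<lambda>\<psi>1 \<psi>2. cotensor (\<Xi> \<phi> \<psi>1) \<psi>2) =
               co_sweedler (dual_cobracket G \<psi>) (\<lambda>\<psi>1 \<psi>2. cotensor \<psi>1 (dual_bracket G \<phi> \<psi>2))))"
proof -
  interpret poisson_lie G by unfold_locales (rule assms(1))
  show ?thesis
    unfolding Let_def crossed_module_iff[OF assms(4)] dual_equation_iff[OF assms(4)]
      bicovariant_preconn_of_iff[OF assms(4)] bicov_defect_vanishes_iff[OF assms(2,4)] star_iff_defect[symmetric]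
    by blast
qed

end
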